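(* Let $\{\{X_{\alpha,t}\}_{t\ge0}\}_{\alpha\in\mathbb{R}}$ be the dyadic grand coupling of Brownian motion (defined in the context). For any $\alpha<\beta$ and $s>0$, with $\psi:=|\alpha-\beta|/\sqrt{s}$, $$\mathbf{P}\big(\exists\,t\ge s\ \text{s.t.}\ X_{\alpha,t}\ne X_{\beta,t}\big)=\mathbf{P}\big(\exists\,\gamma_1,\gamma_2\in[\alpha,\beta],\ t\ge s\ \text{s.t.}\ X_{\gamma_1,t}\ne X_{\gamma_2,t}\big)$$ $$=\int_{\psi/2}^{\infty}\left(\sum_{k=1}^{\infty}2(-1)^{k+1}\exp\left(-\frac{k^2\pi^2}{2\zeta^2}\right)\right)\frac{\zeta^{-2}\psi}{\ln2}\left(\min\{\zeta\psi^{-1},1\}-\frac12\right)\mathrm{d}\zeta .$$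
   Context: Dyadic grand coupling: Let $\{Y_t\}_{t\ge0}$ be a Bessel process of dimension $3$ started at $0$, let $W_i$ ($i\in\mathbb{Z}$) be i.i.d. uniform on $\{1,-1\}$, independent of $\{Y_t\}$, and let $\Theta\sim\mathrm{Unif}[0,1]$ be independent of $(\{Y_t\}_{t\ge 0},\{W_i\}_i)$. Write $a\bmod b:=a-b\lfloor a/b\rfloor$ for $b>0$. For $\theta\in[0,1]$, $\alpha\in\mathbb{R}$, $j\in\mathbb{Z}$ let $$G_{\theta,\alpha,j}:=\begin{cases}W_j&\text{if }\left(\alpha-\sum_{k=-\infty}^{j-1}W_k2^{k+\theta-1}+2^{j+\theta-1}\right)\bmod 2^{j+\theta+1}\in[0,2^{j+\theta}),\\-W_j&\text{otherwise.}\end{cases}$$ For $i\in\mathbb{Z}$ let $T_{\theta,i}:=\inf\{t\ge0:Y_t=2^{i+\theta}\}$. Let $X_{\theta,\alpha,0}:=\alpha$, and for $t>0$, with $i$ the integer satisfying $T_{\theta,i-1}<t\le T_{\theta,i}$, let $$X_{\theta,\alpha,t}:=\alpha+\sum_{j=-\infty}^{i-1}G_{\theta,\alpha,j}2^{j+\theta-1}+(Y_t-2^{i+\theta-1})G_{\theta,\alpha,i}.$$ Finally $X_{\alpha,t}:=X_{\Theta,\alpha,t}$. (Each $\{X_{\alpha,t}\}_{t\ge0}$ is a standard one-dimensional Brownian motion started at $\alpha$.) *)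

theory Defs
  imports "HOL-Probability.Probability" "HOL-Library.Real_Mod"
begin

text \<open>
  Processes are families indexed by real times, of which only the times \<open>t \<ge> 0\<close> matter.
  The law of a process is taken on the product sigma-algebra over \<open>{0..}\<close>.
\<close>

definition path_of :: "(real \<Rightarrow> 'a \<Rightarrow> 'b) \<Rightarrow> 'a \<Rightarrow> real \<Rightarrow> 'b" where
  "path_of Y \<omega> = (\<lambda>t\<in>{0..}. Y t \<omega>)"

abbreviation path_space :: "(real \<Rightarrow> 'b::topological_space) measure" where
  "path_space \<equiv> (\<Pi>\<^sub>M t\<in>{0..}. borel)"

definition brownian_motion :: "'b measure \<Rightarrow> (real \<Rightarrow> 'b \<Rightarrow> real ^ 'n) \<Rightarrow> bool" where
  "brownian_motion N B \<longleftrightarrow>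
     prob_space N \<and>
     (\<forall>t\<ge>0. B t \<in> borel_measurable N) \<and>
     (\<forall>\<omega>\<in>space N. B 0 \<omega> = 0 \<and> continuous_on {0..} (\<lambda>t. B t \<omega>)) \<and>
     (\<forall>s t. 0 \<le> s \<and> s < t \<longrightarrow>
        distributed N lborel (\<lambda>\<omega>. B t \<omega> - B s \<omega>)
          (\<lambda>x. \<Prod>i\<in>UNIV. ennreal (normal_density 0 (sqrt (t - s)) (x $ i)))) \<and>
     (\<forall>(n::nat) \<tau>. 0 \<le> \<tau> 0 \<and> (\<forall>k<n. \<tau> k \<le> \<tau> (Suc k)) \<longrightarrow>
        prob_space.indep_vars N (\<lambda>_. borel) (\<lambda>k \<omega>. B (\<tau> (Suc k)) \<omega> - B (\<tau> k) \<omega>) {..<n})"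

text \<open>
  A Bessel process of dimension 3 started at 0 is a continuous nonnegative process with the law
  of the Euclidean norm of a standard three-dimensional Brownian motion.  The Brownian motion may
  live on a different probability space \<open>N\<close>; taking the points of \<open>N\<close> to be functions
  \<open>real \<Rightarrow> real ^ 3\<close> is no restriction, as the law of a Brownian motion can be realised by the
  coordinate process on the continuous paths.
\<close>

definition bessel3_process :: "'a measure \<Rightarrow> (real \<Rightarrow> 'a \<Rightarrow> real) \<Rightarrow> bool" where
  "bessel3_process M Y \<longleftrightarrow>
     (\<forall>t\<ge>0. Y t \<in> borel_measurable M) \<and>
     (\<forall>\<omega>\<in>space M. Y 0 \<omega> = 0 \<and> (\<forall>t\<ge>0. 0 \<le> Y t \<omega>) \<and> continuous_on {0..} (\<lambda>t. Y t \<omega>)) \<and>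
     (\<exists>(N :: (real \<Rightarrow> real ^ 3) measure) (B :: real \<Rightarrow> (real \<Rightarrow> real ^ 3) \<Rightarrow> real ^ 3).
        brownian_motion N B \<and>
        distr M path_space (path_of Y) = distr N path_space (path_of (\<lambda>t \<omega>. norm (B t \<omega>))))"

text \<open>
  The library's \<open>indep_var\<close> needs both variables to have the same type, so
  independence is stated for the generated sigma-algebras.
\<close>

abbreviation sigma_gen :: "'a measure \<Rightarrow> ('a \<Rightarrow> 'b) \<Rightarrow> 'b measure \<Rightarrow> 'a set set" where
  "sigma_gen M f N \<equiv> sets (vimage_algebra (space M) f N)"

abbreviation sign_space :: "real measure" where
  "sign_space \<equiv> count_space {1, -1}"

locale dyadic_coupling = prob_space M for M :: "'a measure" +
  fixes Y :: "real \<Rightarrow> 'a \<Rightarrow> real"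
    and W :: "int \<Rightarrow> 'a \<Rightarrow> real"
    and \<Theta> :: "'a \<Rightarrow> real"
  assumes bessel: "bessel3_process M Y"
    and W_indep: "indep_vars (\<lambda>_. sign_space) W UNIV"
    and W_distr: "\<And>i. distr M sign_space (W i) = uniform_count_measure {1, -1}"
    and Theta_measurable: "\<Theta> \<in> borel_measurable M"
    and Theta_distr: "distr M borel \<Theta> = uniform_measure lborel {0..1}"
    and Y_W_indep:
      "indep_set (sigma_gen M (path_of Y) path_space)
                 (sigma_gen M (\<lambda>\<omega> i. W i \<omega>) (\<Pi>\<^sub>M i\<in>UNIV. sign_space))"
    and Theta_indep:
      "indep_set (sigma_gen M \<Theta> borel)
                 (sigma_gen M (\<lambda>\<omega>. (path_of Y \<omega>, \<lambda>i. W i \<omega>))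
                    (path_space \<Otimes>\<^sub>M (\<Pi>\<^sub>M i\<in>UNIV. sign_space)))"

definition dyadic_G :: "(int \<Rightarrow> real) \<Rightarrow> real \<Rightarrow> real \<Rightarrow> int \<Rightarrow> real" where
  "dyadic_G w \<theta> \<alpha> j =
     (if (\<alpha> - (\<Sum>\<^sub>\<infinity>k\<in>{..j - 1}. w k * 2 powr (of_int k + \<theta> - 1)) + 2 powr (of_int j + \<theta> - 1))
           rmod (2 powr (of_int j + \<theta> + 1)) \<in> {0..<2 powr (of_int j + \<theta>)}
      then w j else - w j)"

text \<open>Hitting times are extended reals, so that the infimum of the empty set is \<open>\<infinity>\<close>.\<close>

definition dyadic_T :: "(real \<Rightarrow> real) \<Rightarrow> real \<Rightarrow> int \<Rightarrow> ereal" where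
  "dyadic_T y \<theta> i = (INF t\<in>{t. 0 \<le> t \<and> y t = 2 powr (of_int i + \<theta>)}. ereal t)"

text \<open>
  Almost surely the index \<open>i\<close> below exists and is unique for every \<open>t > 0\<close>; on the exceptional
  null event it is left unspecified.
\<close>

definition dyadic_X ::
    "(real \<Rightarrow> real) \<Rightarrow> (int \<Rightarrow> real) \<Rightarrow> real \<Rightarrow> real \<Rightarrow> real \<Rightarrow> real" where
  "dyadic_X y w \<theta> \<alpha> t =
     (if t = 0 then \<alpha>
      else let i = (THE i. dyadic_T y \<theta> (i - 1) < ereal t \<and> ereal t \<le> dyadic_T y \<theta> i) in
        \<alpha> + (\<Sum>\<^sub>\<infinity>j\<in>{..i - 1}. dyadic_G w \<theta> \<alpha> j * 2 powr (of_int j + \<theta> - 1))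
          + (y t - 2 powr (of_int i + \<theta> - 1)) * dyadic_G w \<theta> \<alpha> i)"

definition dyadic_grand_coupling ::
    "(real \<Rightarrow> 'a \<Rightarrow> real) \<Rightarrow> (int \<Rightarrow> 'a \<Rightarrow> real) \<Rightarrow> ('a \<Rightarrow> real) \<Rightarrow> real \<Rightarrow> real \<Rightarrow> 'a \<Rightarrow> real" where
  "dyadic_grand_coupling Y W \<Theta> \<alpha> t \<omega> = dyadic_X (\<lambda>u. Y u \<omega>) (\<lambda>i. W i \<omega>) (\<Theta> \<omega>) \<alpha> t"

end

theory Submission
  imports Defs
begin

text \<open>
  Let \<open>L = 2 powr (j + \<theta>)\<close>.  When \<open>Y\<close> first reaches \<open>L / 2\<close>, the particle started at \<open>\<alpha>\<close> is at the
  point nearest to \<open>\<alpha>\<close> of a shifted lattice of mesh \<open>L\<close>, and when \<open>Y\<close> first reaches \<open>L\<close>, adjacent lattice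
  points have merged in pairs.  Hence the flow is monotone in the starting point, so that all particles
  from \<open>[\<alpha>, \<beta>]\<close> have merged as soon as the two extreme ones have.  The lattice shift is a binary expansion
  with the digits \<open>W\<close>, hence uniform, and the probability that a lattice cell boundary separates \<open>\<alpha>\<close>
  from \<open>\<beta>\<close> is \<open>min ((\<beta> - \<alpha>) / L) 1\<close>.  Averaging over \<open>\<theta>\<close> leaves an integral against the law of the
  running maximum of \<open>Y\<close> on \<open>[0, s]\<close>.

  That law comes from the martingales \<open>exp (l\<^sup>2 t / 2) * sinc (l |B\<^sub>t|)\<close> of a three-dimensional Brownian
  motion \<open>B\<close>.  For \<open>l = k pi / z\<close> they vanish on the sphere of radius \<open>z\<close>, and stopping there gives the
  mean of \<open>sinc (k pi |B\<^sub>s| / z)\<close> on the event that \<open>|B|\<close> has stayed below \<open>z\<close>.  The Abel means of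
  \<open>\<Sum>k\<ge>1. 2 * (-1) ^ (k + 1) * sinc (k \<phi>)\<close> tend boundedly to 1 for \<open>\<phi>\<close> in \<open>[0, pi)\<close>, which turns these
  means into the probability of that event.
\<close>

section \<open>Gaussian averages of radial functions\<close>

text \<open>Averaging a radial function over a three-dimensional Gaussian reduces to one dimension:
  if \<open>f\<close> is radial, \<open>t * f t\<close> evolves under the one-dimensional heat flow.
  Polynomials in \<open>exp (- (norm x)\<^sup>2)\<close> suffice to prove this without polar
  coordinates. Stopping is done in discrete time: on a grid of mesh \<open>s / n\<close> the stopped
  martingale has mean 1 by telescoping, and the overshoot across the sphere vanishes as the grid is
  refined. That limit fails for paths whose maximum equals the radius exactly. Only radii that are
  atoms of the law of the maximum are affected, hence countably many, and the formula is needed only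
  for almost every \<zeta> under the final integral. The integration over \<zeta> stems from the
  random scale: for \<open>i\<close> an integer and \<theta> uniform on the unit interval,
  \<open>\<theta> + i\<close> covers the line with Lebesgue measure, so the logarithm of the mesh
  has no preferred value. Finally, the event quantifies over uncountably many times; its
  measurability rests on an explicit description valid for every outcome.\<close>

lemma exp_mult_normal_density:
  fixes c \<mu> \<sigma> x :: real
  assumes "c \<ge> 0" "\<sigma> > 0"
  defines "q \<equiv> 1 + 2 * c * \<sigma>\<^sup>2"
  shows "exp (- c * x\<^sup>2) * normal_density \<mu> \<sigma> x
    = exp (- c * \<mu>\<^sup>2 / q) / sqrt q * normal_density (\<mu> / q) (\<sigma> / sqrt q) x"
proof -
  have q: "q > 0" using assms by (simp add: add_pos_nonneg)
  have e: "- c * x\<^sup>2 + - (x - \<mu>)\<^sup>2 / (2 * \<sigma>\<^sup>2) = - c * \<mu>\<^sup>2 / q + - (x - \<mu> / q)\<^sup>2 / (2 * (\<sigma>\<^sup>2 / q))"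
    unfolding power2_diff using q assms(2)
    apply (simp add: field_simps)
    apply (simp add: q_def)
    apply algebra
    done
  have "exp (- c * x\<^sup>2) * normal_density \<mu> \<sigma> x
      = 1 / sqrt (2 * pi * \<sigma>\<^sup>2) * exp (- c * x\<^sup>2 + - (x - \<mu>)\<^sup>2 / (2 * \<sigma>\<^sup>2))"
    unfolding normal_density_def exp_add by (simp add: mult_ac)
  also have "\<dots> = 1 / sqrt (2 * pi * \<sigma>\<^sup>2) * (exp (- c * \<mu>\<^sup>2 / q) * exp (- (x - \<mu> / q)\<^sup>2 / (2 * (\<sigma>\<^sup>2 / q))))"
    unfolding e exp_add ..
  also have "1 / sqrt (2 * pi * \<sigma>\<^sup>2) = 1 / sqrt q * (1 / sqrt (2 * pi * (\<sigma>\<^sup>2 / q)))"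
    using q assms(2) by (simp add: real_sqrt_divide real_sqrt_mult)
  finally show ?thesis
    unfolding normal_density_def using q by (simp add: power_divide)
qed

text \<open>Tonelli's theorem for products over \<open>Basis\<close>, transported to coordinates:
  \<open>ax\<close> enumerates the standard axes.\<close>

lemma nn_integral_vec_prod:
  fixes f :: "'n::finite \<Rightarrow> real \<Rightarrow> ennreal"
  assumes [measurable]: "\<And>i. f i \<in> borel_measurable borel"
  shows "(\<integral>\<^sup>+x. (\<Prod>i\<in>UNIV. f i (x $ i)) \<partial>lborel) = (\<Prod>i\<in>UNIV. (\<integral>\<^sup>+x. f i x \<partial>lborel))"
proof -
  define ax :: "'n \<Rightarrow> real ^ 'n" where "ax i = axis i 1" for i
  have inj: "inj ax" by (auto simp: inj_def ax_def axis_eq_axis)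
  have B: "Basis = range ax" by (auto simp: Basis_vec_def ax_def)
  define g where "g b = f (inv ax b)" for b
  have "(\<integral>\<^sup>+x. (\<Prod>b\<in>Basis. g b (x \<bullet> b)) \<partial>lborel) = (\<Prod>b\<in>Basis. (\<integral>\<^sup>+x. g b x \<partial>lborel))"
    by (rule nn_integral_lborel_prod) (auto simp: g_def)
  then show ?thesis
    using inj unfolding B prod.reindex[OF inj] o_def g_def inv_f_f[OF inj]
    by (simp add: ax_def cart_eq_inner_axis)
qed

definition gauss_density :: "real \<Rightarrow> real ^ 'n::finite \<Rightarrow> ennreal" where
  "gauss_density \<sigma> x = (\<Prod>i\<in>UNIV. ennreal (normal_density 0 \<sigma> (x $ i)))"

lemma measurable_gauss_density [measurable]: "gauss_density \<sigma> \<in> borel_measurable borel"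
  unfolding gauss_density_def[abs_def] by measurable

lemma integral_exp_mult_normal_density:
  assumes "c \<ge> 0" "\<sigma> > 0"
  shows "(\<integral>x. exp (- c * x\<^sup>2) * normal_density \<mu> \<sigma> x \<partial>lborel)
     = exp (- c * \<mu>\<^sup>2 / (1 + 2 * c * \<sigma>\<^sup>2)) / sqrt (1 + 2 * c * \<sigma>\<^sup>2)"
    and "(\<integral>x. x * (exp (- c * x\<^sup>2) * normal_density \<mu> \<sigma> x) \<partial>lborel)
     = exp (- c * \<mu>\<^sup>2 / (1 + 2 * c * \<sigma>\<^sup>2)) / sqrt (1 + 2 * c * \<sigma>\<^sup>2) * (\<mu> / (1 + 2 * c * \<sigma>\<^sup>2))"
    and "integrable lborel (\<lambda>x. exp (- c * x\<^sup>2) * normal_density \<mu> \<sigma> x)"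
proof -
  have q: "1 + 2 * c * \<sigma>\<^sup>2 > 0" using assms by (simp add: add_pos_nonneg)
  then have s: "0 < \<sigma> / sqrt (1 + 2 * c * \<sigma>\<^sup>2)" using assms by simp
  show "(\<integral>x. exp (- c * x\<^sup>2) * normal_density \<mu> \<sigma> x \<partial>lborel)
     = exp (- c * \<mu>\<^sup>2 / (1 + 2 * c * \<sigma>\<^sup>2)) / sqrt (1 + 2 * c * \<sigma>\<^sup>2)"
    and "integrable lborel (\<lambda>x. exp (- c * x\<^sup>2) * normal_density \<mu> \<sigma> x)"
    unfolding exp_mult_normal_density[OF assms] using s by simp_all
  have "(\<integral>x. normal_density (\<mu> / (1 + 2 * c * \<sigma>\<^sup>2)) (\<sigma> / sqrt (1 + 2 * c * \<sigma>\<^sup>2)) x * x \<partial>lborel) =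
     \<mu> / (1 + 2 * c * \<sigma>\<^sup>2)"
    using integral_normal_moment_nz_1[OF s] by simp
  then have "(\<integral>x. K * (normal_density (\<mu> / (1 + 2 * c * \<sigma>\<^sup>2)) (\<sigma> / sqrt (1 + 2 * c * \<sigma>\<^sup>2)) x * x) \<partial>lborel) =
     K * (\<mu> / (1 + 2 * c * \<sigma>\<^sup>2))" for K :: real
    unfolding integral_mult_right_zero by (rule arg_cong)
  moreover have "(\<integral>x. x * (K * f x) \<partial>lborel) = (\<integral>x. K * (f x * x) \<partial>lborel)" for K :: real and f
    by (rule Bochner_Integration.integral_cong) auto
  ultimately show "(\<integral>x. x * (exp (- c * x\<^sup>2) * normal_density \<mu> \<sigma> x) \<partial>lborel)
     = exp (- c * \<mu>\<^sup>2 / (1 + 2 * c * \<sigma>\<^sup>2)) / sqrt (1 + 2 * c * \<sigma>\<^sup>2) * (\<mu> / (1 + 2 * c * \<sigma>\<^sup>2))"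
    unfolding exp_mult_normal_density[OF assms] by simp
qed

lemma nn_integral_exp_mult_normal_density:
  assumes "c \<ge> 0" "\<sigma> > 0"
  shows "(\<integral>\<^sup>+x. ennreal (exp (- c * x\<^sup>2)) * ennreal (normal_density \<mu> \<sigma> x) \<partial>lborel)
     = ennreal (exp (- c * \<mu>\<^sup>2 / (1 + 2 * c * \<sigma>\<^sup>2)) / sqrt (1 + 2 * c * \<sigma>\<^sup>2))"
  using nn_integral_eq_integral[OF integral_exp_mult_normal_density(3)[OF assms, of \<mu>]]
    integral_exp_mult_normal_density(1)[OF assms, of \<mu>] assms
  by (simp add: ennreal_mult normal_density_nonneg)

text \<open>The integrand factors over the coordinates. Each of the three contributes
  \<open>1 / sqrt q\<close>, which is where the factor \<open>1 / (q * sqrt q)\<close> comes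
  from.\<close>

lemma nn_integral_exp_gauss_density:
  fixes x :: "real ^ 3"
  assumes "c \<ge> 0" "\<sigma> > 0"
  defines "q \<equiv> 1 + 2 * c * \<sigma>\<^sup>2"
  shows "(\<integral>\<^sup>+y. ennreal (exp (- c * (norm (x + y))\<^sup>2)) * gauss_density \<sigma> y \<partial>lborel)
     = ennreal (exp (- c * (norm x)\<^sup>2 / q) / (q * sqrt q))"
proof -
  have q: "q > 0" using assms by (simp add: add_pos_nonneg)
  have n: "(norm v)\<^sup>2 = (\<Sum>i\<in>UNIV. (v $ i)\<^sup>2)" for v :: "real ^ 3"
    by (simp add: norm_vec_def L2_set_def sum_nonneg)
  have e: "ennreal (exp (- c * (norm v)\<^sup>2)) = (\<Prod>i\<in>UNIV. ennreal (exp (- c * (v $ i)\<^sup>2)))" for c and v :: "real ^ 3"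
    unfolding n by (simp add: prod_ennreal exp_sum sum_distrib_left sum_negf flip: exp_sum)
  have "(\<integral>\<^sup>+y. ennreal (exp (- c * (norm (x + y))\<^sup>2)) * gauss_density \<sigma> y \<partial>lborel)
     = (\<integral>\<^sup>+y. (\<Prod>i\<in>UNIV. ennreal (exp (- c * (x $ i + y $ i)\<^sup>2)) * ennreal (normal_density 0 \<sigma> (y $ i))) \<partial>lborel)"
    unfolding e gauss_density_def prod.distrib by simp
  also have "\<dots> = (\<Prod>i\<in>UNIV. (\<integral>\<^sup>+y. ennreal (exp (- c * (x $ i + y)\<^sup>2)) * ennreal (normal_density 0 \<sigma> y) \<partial>lborel))"
    by (rule nn_integral_vec_prod) simp
  also have "\<dots> = (\<Prod>i\<in>UNIV. ennreal (exp (- c * (x $ i)\<^sup>2 / q) / sqrt q))"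
  proof (rule prod.cong)
    fix i
    \<comment> \<open>Translating by \<open>- (x $ i)\<close> moves the shift from the exponential
      into the mean of the normal density.\<close>
    have "(\<integral>\<^sup>+y. ennreal (exp (- c * (x $ i + y)\<^sup>2)) * ennreal (normal_density 0 \<sigma> y) \<partial>lborel)
      = (\<integral>\<^sup>+y. ennreal (exp (- c * (x $ i + (- (x $ i) + y))\<^sup>2)) * ennreal (normal_density 0 \<sigma> (- (x $ i) + y)) \<partial>lborel)"
      by (subst lborel_distr_plus[symmetric, of "- (x $ i)"]) (simp add: nn_integral_distr)
    also have "\<dots> = (\<integral>\<^sup>+y. ennreal (exp (- c * y\<^sup>2)) * ennreal (normal_density (x $ i) \<sigma> y) \<partial>lborel)"
      by (simp add: normal_density_def)
    finally show "(\<integral>\<^sup>+y. ennreal (exp (- c * (x $ i + y)\<^sup>2)) * ennreal (normal_density 0 \<sigma> y) \<partial>lborel)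
       = ennreal (exp (- c * (x $ i)\<^sup>2 / q) / sqrt q)"
      using nn_integral_exp_mult_normal_density[OF assms(1,2)] by (simp add: q_def)
  qed simp
  also have "\<dots> = ennreal (\<Prod>i\<in>(UNIV::3 set). exp (- c / q * (x $ i)\<^sup>2) * (1 / sqrt q))"
    using q by (subst prod_ennreal) auto
  also have "(\<Prod>i\<in>(UNIV::3 set). exp (- c / q * (x $ i)\<^sup>2) * (1 / sqrt q)) = exp (- c / q * (norm x)\<^sup>2) * (1 / (q * sqrt q))"
    unfolding prod.distrib using q
    by (simp add: n exp_sum sum_distrib_left sum_negf sum_divide_distrib power3_eq_cube flip: exp_sum)
  finally show ?thesis by simp
qed

definition gauss :: "real \<Rightarrow> (real ^ 3) measure" where
  "gauss \<sigma> = density lborel (gauss_density \<sigma>)"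

lemma sets_gauss [measurable_cong]: "sets (gauss \<sigma>) = sets borel"
  by (simp add: gauss_def)

lemma space_gauss [simp]: "space (gauss \<sigma>) = UNIV"
  by (simp add: gauss_def)

lemma nn_integral_exp_gauss:
  assumes "c \<ge> 0" "\<sigma> > 0"
  shows "(\<integral>\<^sup>+y. ennreal (exp (- c * (norm (x + y))\<^sup>2)) \<partial>gauss \<sigma>)
     = ennreal (exp (- c * (norm x)\<^sup>2 / (1 + 2 * c * \<sigma>\<^sup>2)) / ((1 + 2 * c * \<sigma>\<^sup>2) * sqrt (1 + 2 * c * \<sigma>\<^sup>2)))"
  unfolding gauss_def using nn_integral_exp_gauss_density[OF assms]
  by (subst nn_integral_density) (simp_all add: mult.commute)

lemma prob_space_gauss:
  assumes "\<sigma> > 0"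
  shows "prob_space (gauss \<sigma>)"
  by (rule prob_spaceI) (use nn_integral_exp_gauss[of 0 \<sigma> 0] assms in simp)

lemma integral_exp_gauss:
  assumes "c \<ge> 0" "\<sigma> > 0"
  shows "(\<integral>y. exp (- c * (norm (x + y))\<^sup>2) \<partial>gauss \<sigma>)
     = exp (- c * (norm x)\<^sup>2 / (1 + 2 * c * \<sigma>\<^sup>2)) / ((1 + 2 * c * \<sigma>\<^sup>2) * sqrt (1 + 2 * c * \<sigma>\<^sup>2))"
proof -
  have "1 + 2 * c * \<sigma>\<^sup>2 > 0" using assms by (simp add: add_pos_nonneg)
  then show ?thesis
    using nn_integral_exp_gauss[OF assms, of x]
    by (subst integral_eq_nn_integral) simp_all
qed

text \<open>Both sides are continuous in \<open>f\<close> for the supremum norm and agree on monomials.\<close>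

lemma integral_gauss_radial:
  fixes f :: "real \<Rightarrow> real"
  assumes [measurable]: "f \<in> borel_measurable borel" and cont: "continuous_on {0..1} f"
    and \<sigma>: "\<sigma> > 0" and x: "x \<noteq> 0"
  shows "(\<integral>y. f (exp (- (norm (x + y))\<^sup>2)) \<partial>gauss \<sigma>)
     = (\<integral>t. normal_density (norm x) \<sigma> t * (t * f (exp (- t\<^sup>2))) \<partial>lborel) / norm x"
proof -
  define r where "r = norm x"
  have r: "r > 0" using x by (simp add: r_def)
  interpret G: prob_space "gauss \<sigma>" by (rule prob_space_gauss[OF \<sigma>])
  define L where "L h = (\<integral>y. h (exp (- (norm (x + y))\<^sup>2)) \<partial>gauss \<sigma>)" for h :: "real \<Rightarrow> real"
  define R where "R h = (\<integral>t. normal_density r \<sigma> t * (t * h (exp (- t\<^sup>2))) \<partial>lborel) / r" for h :: "real \<Rightarrow> real"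
  \<comment> \<open>\<open>m\<close> bounds the norm of \<open>R\<close> with respect to the
    supremum norm on the unit interval; \<open>L\<close> has norm at most 1, being an average over a
    probability measure.\<close>
  define m where "m = (\<integral>t. \<bar>normal_density r \<sigma> t * t\<bar> \<partial>lborel) / r"
  have m0: "m \<ge> 0" using r by (simp add: m_def)
  have Lint: "integrable (gauss \<sigma>) (\<lambda>y. h (exp (- (norm (x + y))\<^sup>2)))"
    if [measurable]: "h \<in> borel_measurable borel" and c: "\<And>u. u \<in> {0..1} \<Longrightarrow> \<bar>h u\<bar> \<le> B" for h and B :: real
    by (rule G.integrable_const_bound[where B=B]) (auto intro!: AE_I2 c)
  have Rint: "integrable lborel (\<lambda>t. normal_density r \<sigma> t * (t * h (exp (- t\<^sup>2))))"
    and Rbound: "\<bar>R h\<bar> \<le> B * m"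
    if [measurable]: "h \<in> borel_measurable borel" and c: "\<And>u. u \<in> {0..1} \<Longrightarrow> \<bar>h u\<bar> \<le> B" for h and B :: real
  proof -
    have B: "B \<ge> 0" using c[of 0] by simp
    have i: "integrable lborel (\<lambda>t. B * (normal_density r \<sigma> t * t))"
      using integrable_normal_moment_nz_1[OF \<sigma>] by auto
    have le: "\<bar>normal_density r \<sigma> t * (t * h (exp (- t\<^sup>2)))\<bar> \<le> B * \<bar>normal_density r \<sigma> t * t\<bar>" for t
      using mult_left_mono[OF c[of "exp (- t\<^sup>2)"], of "\<bar>normal_density r \<sigma> t * t\<bar>"]
      by (simp add: abs_mult mult_ac)
    show int: "integrable lborel (\<lambda>t. normal_density r \<sigma> t * (t * h (exp (- t\<^sup>2))))"
      by (rule Bochner_Integration.integrable_bound[OF i]) (use le B in \<open>auto simp: abs_mult mult_ac intro!: AE_I2\<close>)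
    have "\<bar>\<integral>t. normal_density r \<sigma> t * (t * h (exp (- t\<^sup>2))) \<partial>lborel\<bar>
       \<le> (\<integral>t. \<bar>normal_density r \<sigma> t * (t * h (exp (- t\<^sup>2)))\<bar> \<partial>lborel)"
      by (rule integral_abs_bound)
    also have "\<dots> \<le> (\<integral>t. B * \<bar>normal_density r \<sigma> t * t\<bar> \<partial>lborel)"
      by (rule integral_mono) (use le int integrable_normal_moment_nz_1[OF \<sigma>] in \<open>auto intro!: integrable_mult_right integrable_abs\<close>)
    finally show "\<bar>R h\<bar> \<le> B * m"
      using r by (simp add: R_def m_def divide_right_mono)
  qed
  \<comment> \<open>With \<open>q = 1 + 2 * real n * \<sigma>\<^sup>2\<close>, the factor
    \<open>exp (- real n * t\<^sup>2)\<close> tilts the normal law to mean \<open>r / q\<close>. Its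
    first moment divided by \<open>r\<close> leaves an extra \<open>1 / q\<close>, exactly what two
    further dimensions contribute on the other side.\<close>
  have monom: "L (\<lambda>u. u ^ n) = R (\<lambda>u. u ^ n)" for n
  proof -
    have e: "exp (- t\<^sup>2) ^ n = exp (- real n * t\<^sup>2)" for t :: real
      by (simp add: exp_of_nat_mult flip: exp_of_nat_mult)
    have q: "1 + 2 * real n * \<sigma>\<^sup>2 > 0" by (simp add: add_pos_nonneg)
    have "L (\<lambda>u. u ^ n) = exp (- real n * r\<^sup>2 / (1 + 2 * real n * \<sigma>\<^sup>2)) / ((1 + 2 * real n * \<sigma>\<^sup>2) * sqrt (1 + 2 * real n * \<sigma>\<^sup>2))"
      unfolding L_def e using integral_exp_gauss[of "real n" \<sigma> x] \<sigma> by (simp add: r_def)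
    moreover have "(\<integral>t. normal_density r \<sigma> t * (t * exp (- real n * t\<^sup>2)) \<partial>lborel)
       = exp (- real n * r\<^sup>2 / (1 + 2 * real n * \<sigma>\<^sup>2)) / sqrt (1 + 2 * real n * \<sigma>\<^sup>2) * (r / (1 + 2 * real n * \<sigma>\<^sup>2))"
      using integral_exp_mult_normal_density(2)[of "real n" \<sigma> r] \<sigma> by (simp add: mult_ac)
    ultimately show ?thesis
      unfolding R_def e using r q by simp
  qed
  have lim: "\<bar>L f - R f\<bar> \<le> e * (1 + m)" if e: "e > 0" for e
  proof -
    obtain p where p: "real_polynomial_function p" "\<And>u. u \<in> {0..1} \<Longrightarrow> \<bar>f u - p u\<bar> < e"
      using Stone_Weierstrass_real_polynomial_function[OF _ cont e] by auto
    obtain a n where pa: "p = (\<lambda>u. \<Sum>i\<le>n. a i * u ^ i)"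
      using p(1) real_polynomial_function_iff_sum by auto
    have [measurable]: "p \<in> borel_measurable borel" unfolding pa by measurable
    have pw: "\<bar>u ^ i\<bar> \<le> 1" if "u \<in> {0..1}" for u :: real and i using that by (auto intro: power_le_one)
    have "L p = R p"
    proof -
      have "L p = (\<Sum>i\<le>n. a i * L (\<lambda>u. u ^ i))"
        unfolding L_def pa
        by (subst Bochner_Integration.integral_sum) (auto intro!: Lint[of "\<lambda>u. u ^ _" 1] integrable_mult_right pw)
      moreover have "R p = (\<Sum>i\<le>n. a i * R (\<lambda>u. u ^ i))"
      proof -
        have "(\<integral>t. normal_density r \<sigma> t * (t * p (exp (- t\<^sup>2))) \<partial>lborel)
          = (\<integral>t. (\<Sum>i\<le>n. a i * (normal_density r \<sigma> t * (t * exp (- t\<^sup>2) ^ i))) \<partial>lborel)"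
          unfolding pa sum_distrib_left by (simp only: mult_ac)
        also have "\<dots> = (\<Sum>i\<le>n. a i * (\<integral>t. normal_density r \<sigma> t * (t * exp (- t\<^sup>2) ^ i) \<partial>lborel))"
          by (subst Bochner_Integration.integral_sum) (auto intro!: Rint[of "\<lambda>u. u ^ _" 1] integrable_mult_right pw)
        finally show ?thesis unfolding R_def by (simp add: sum_divide_distrib)
      qed
      ultimately show ?thesis using monom by simp
    qed
    have b1: "\<exists>B. \<forall>u\<in>{0..1}. \<bar>p u\<bar> \<le> B"
    proof -
      have "\<bar>p u\<bar> \<le> (\<Sum>i\<le>n. \<bar>a i\<bar>)" if u: "u \<in> {0..1}" for u
        unfolding pa using pw[OF u] mult_left_mono[OF pw[OF u], of "\<bar>a _\<bar>"]
        by (intro order.trans[OF sum_abs] sum_mono) (simp add: abs_mult)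
      then show ?thesis by blast
    qed
    then obtain B where B: "\<And>u. u \<in> {0..1} \<Longrightarrow> \<bar>p u\<bar> \<le> B" by blast
    have Bf: "\<bar>f u\<bar> \<le> B + e" if "u \<in> {0..1}" for u using B[OF that] p(2)[OF that] by linarith
    have d: "\<bar>f u - p u\<bar> \<le> e" if "u \<in> {0..1}" for u using p(2)[OF that] by simp
    have "L (\<lambda>u. f u - p u) = L f - L p"
      unfolding L_def using Lint[of f, OF _ Bf] Lint[of p, OF _ B] by simp
    moreover have "R (\<lambda>u. f u - p u) = R f - R p"
      unfolding R_def right_diff_distrib using Rint[of f, OF _ Bf] Rint[of p, OF _ B]
      by (simp add: diff_divide_distrib)
    moreover have "\<bar>R (\<lambda>u. f u - p u)\<bar> \<le> e * m"
      by (rule Rbound) (use d in auto)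
    moreover have "\<bar>L (\<lambda>u. f u - p u)\<bar> \<le> e"
    proof -
      have "\<bar>L (\<lambda>u. f u - p u)\<bar> \<le> (\<integral>y. \<bar>f (exp (- (norm (x + y))\<^sup>2)) - p (exp (- (norm (x + y))\<^sup>2))\<bar> \<partial>gauss \<sigma>)"
        unfolding L_def by (rule integral_abs_bound)
      also have "\<dots> \<le> (\<integral>y. e \<partial>gauss \<sigma>)"
        by (rule integral_mono) (use d in \<open>auto intro!: integrable_abs Lint[of "\<lambda>u. f u - p u" e, simplified]\<close>)
      finally show ?thesis by (simp add: G.prob_space[simplified])
    qed
    ultimately show ?thesis using \<open>L p = R p\<close> by (simp add: algebra_simps)
  qed
  have "\<bar>L f - R f\<bar> \<le> 0"
  proof (rule field_le_epsilon)
    fix e :: real assume "e > 0"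
    then show "\<bar>L f - R f\<bar> \<le> 0 + e"
      using lim[of "e / (1 + m)"] m0 by simp
  qed
  then show ?thesis by (simp add: L_def R_def r_def)
qed

text \<open>After centring, the addition formula leaves the means of a cosine and a sine, the real
  and imaginary parts of the standard normal characteristic function. That function is real, so the
  sine mean vanishes and the cosine mean is the damping factor.\<close>

lemma integral_sin_normal_density:
  assumes \<sigma>: "\<sigma> > 0"
  shows "(\<integral>t. normal_density r \<sigma> t * sin (l * t) \<partial>lborel) = sin (l * r) * exp (- l\<^sup>2 * \<sigma>\<^sup>2 / 2)"
proof -
  interpret S: real_distribution std_normal_distribution by (rule real_dist_normal_dist)
  have *: "(\<integral>x. iexp (l * \<sigma> * x) \<partial>std_normal_distribution) = of_real (exp (- (l * \<sigma>)\<^sup>2 / 2))"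
    using fun_cong[OF char_std_normal_distribution, of "l * \<sigma>"] by (simp add: char_def)
  have int: "integrable std_normal_distribution (\<lambda>x. iexp (l * \<sigma> * x))"
    by (rule S.integrable_const_bound[where B=1]) (auto simp del: of_real_mult)
  have c: "(\<integral>x. cos (l * \<sigma> * x) \<partial>std_normal_distribution) = exp (- (l * \<sigma>)\<^sup>2 / 2)"
    and s: "(\<integral>x. sin (l * \<sigma> * x) \<partial>std_normal_distribution) = 0"
    using arg_cong[OF *, of Re] arg_cong[OF *, of Im]
      integral_Re[OF int] integral_Im[OF int] by (simp_all add: Re_exp Im_exp)
  have ic: "integrable std_normal_distribution (\<lambda>x. cos (l * \<sigma> * x))"
    and isn: "integrable std_normal_distribution (\<lambda>x. sin (l * \<sigma> * x))"
    by (rule S.integrable_const_bound[where B=1]; auto)+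
  have "(\<integral>t. normal_density r \<sigma> t * sin (l * t) \<partial>lborel)
    = \<bar>\<sigma>\<bar> *\<^sub>R (\<integral>x. normal_density r \<sigma> (r + \<sigma> * x) * sin (l * (r + \<sigma> * x)) \<partial>lborel)"
    using \<sigma> by (intro lborel_integral_real_affine) simp
  also have "\<dots> = (\<integral>x. \<bar>\<sigma>\<bar> *\<^sub>R (normal_density r \<sigma> (r + \<sigma> * x) * sin (l * (r + \<sigma> * x))) \<partial>lborel)"
    by simp
  also have "\<dots> = (\<integral>x. std_normal_density x * sin (l * (r + \<sigma> * x)) \<partial>lborel)"
    using \<sigma> by (intro Bochner_Integration.integral_cong)
      (auto simp: normal_density_def real_sqrt_mult power_mult_distrib)
  also have "\<dots> = (\<integral>x. sin (l * (r + \<sigma> * x)) \<partial>std_normal_distribution)"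
    by (subst integral_density) (auto)
  also have "\<dots> = (\<integral>x. sin (l * r) * cos (l * \<sigma> * x) + cos (l * r) * sin (l * \<sigma> * x) \<partial>std_normal_distribution)"
    by (simp add: sin_add ring_distribs mult.assoc)
  also have "\<dots> = sin (l * r) * exp (- (l * \<sigma>)\<^sup>2 / 2)"
    using ic isn c s by simp
  finally show ?thesis by (simp add: power_mult_distrib)
qed

section \<open>Radial eigenfunctions of Gaussian averaging\<close>

lemma isCont_sinc_mult: "isCont (\<lambda>x. sinc (l * x)) x"
  using isCont_o2[OF _ isCont_sinc, of x "\<lambda>x. l * x"] by simp

lemma abs_sinc_le_1: "\<bar>sinc x\<bar> \<le> 1"
  using abs_sin_x_le_abs_x[of x] by (simp add: abs_divide divide_le_eq)

text \<open>On three-space and for \<open>l \<noteq> 0\<close>, this is the radial eigenfunction of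
  the Laplacian with eigenvalue \<open>- l\<^sup>2\<close>, normalised to 1 at the origin.\<close>

definition sincn :: "real \<Rightarrow> 'a::real_normed_vector \<Rightarrow> real" where
  "sincn l x = sinc (l * norm x)"

lemma continuous_on_sincn [continuous_intros]: "continuous_on S f \<Longrightarrow> continuous_on S (\<lambda>x. sincn l (f x))"
  unfolding sincn_def by (intro continuous_on_sinc continuous_intros)

lemma measurable_sincn [measurable]: "sincn l \<in> borel_measurable borel"
  by (intro borel_measurable_continuous_onI continuous_on_sincn continuous_intros)

lemma abs_sincn_le_1: "\<bar>sincn l x\<bar> \<le> 1"
  unfolding sincn_def by (rule abs_sinc_le_1)

lemma integral_gauss_sincn_nonzero:
  fixes x :: "real ^ 3"
  assumes \<sigma>: "\<sigma> > 0" and l: "l \<noteq> 0" and x: "x \<noteq> 0"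
  shows "(\<integral>y. sincn l (x + y) \<partial>gauss \<sigma>) = exp (- l\<^sup>2 * \<sigma>\<^sup>2 / 2) * sincn l x"
proof -
  \<comment> \<open>The substitution \<open>u = exp (- r\<^sup>2)\<close> maps radii to (0, 1]. The
    value 0 at \<open>u = 0\<close> is the limit at infinite radius, so \<open>f\<close> is
    continuous on the whole compact interval.\<close>
  define f where "f u = (if u \<le> 0 then 0 else sincn l (sqrt (- ln u)))" for u :: real
  have [measurable]: "f \<in> borel_measurable borel" unfolding f_def[abs_def] by measurable
  have cont: "continuous_on {0..1} f"
    unfolding continuous_on_eq_continuous_within
  proof
    fix u :: real assume u: "u \<in> {0..1}"
    show "continuous (at u within {0..1}) f"
    proof (cases "u = 0")
      case False
      then have u: "u > 0" using u by simp
      have c: "continuous (at u) (\<lambda>u. sincn l (sqrt (- ln u)))"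
      proof -
        have "continuous_on {0<..} (\<lambda>u::real. sincn l (sqrt (- ln u)))"
          by (intro continuous_intros) auto
        then show ?thesis using u by (simp add: continuous_on_eq_continuous_at)
      qed
      have ev: "\<forall>\<^sub>F v in nhds u. f v = sincn l (sqrt (- ln v))"
        using eventually_nhds_in_open[of "{0<..}" u] u by (auto elim!: eventually_mono simp: f_def)
      have "continuous (at u) f"
        using isCont_cong[OF ev] c by simp
      then show ?thesis by (rule continuous_at_imp_continuous_at_within)
    next
      case True
      have "((\<lambda>u. sincn l (sqrt (- ln u))) \<longlongrightarrow> 0) (at_right 0)"
      proof -
        have ev: "\<forall>\<^sub>F u::real in at_right 0. u \<in> {0<..<1}"
          by (rule eventually_at_right_real) simp
        show ?thesis
        proof (rule Lim_null_comparison[where g = "\<lambda>u. 1 / (\<bar>l\<bar> * sqrt (- ln u))"])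
          show "\<forall>\<^sub>F u in at_right 0. norm (sincn l (sqrt (- ln u))) \<le> 1 / (\<bar>l\<bar> * sqrt (- ln u))"
            using ev
          proof eventually_elim
            case (elim u)
            then have "sqrt (- ln u) > 0" by simp
            then show ?case using l by (simp add: sincn_def abs_mult divide_right_mono)
          qed
          have t1: "LIM u at_right 0. sqrt (- ln u) :> at_top"
            by (rule filterlim_compose[OF sqrt_at_top]) (use ln_at_0 in \<open>simp add: filterlim_uminus_at_top\<close>)
          have "LIM u at_right 0. \<bar>l\<bar> * sqrt (- ln u) :> at_top"
            by (rule filterlim_tendsto_pos_mult_at_top[OF tendsto_const _ t1]) (use l in auto)
          then show "((\<lambda>u. 1 / (\<bar>l\<bar> * sqrt (- ln u))) \<longlongrightarrow> 0) (at_right 0)"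
            by (intro tendsto_divide_0[OF tendsto_const] filterlim_at_top_imp_at_infinity)
        qed
      qed
      then have "(f \<longlongrightarrow> 0) (at_right 0)"
        by (rule Lim_transform_eventually) (auto simp: f_def eventually_at_filter)
      then show ?thesis
        unfolding True continuous_within
        by (auto simp: f_def intro: tendsto_within_subset at_within_Icc_at_right[of 0 1, THEN ssubst])
    qed
  qed
  have fe: "f (exp (- t\<^sup>2)) = sinc (l * t)" for t :: real
    by (auto simp: f_def sincn_def abs_if)
  have "(\<integral>y. sincn l (x + y) \<partial>gauss \<sigma>) = (\<integral>y. f (exp (- (norm (x + y))\<^sup>2)) \<partial>gauss \<sigma>)"
    unfolding fe by (simp add: sincn_def)
  also have "\<dots> = (\<integral>t. normal_density (norm x) \<sigma> t * (t * f (exp (- t\<^sup>2))) \<partial>lborel) / norm x"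
    by (rule integral_gauss_radial) (use cont \<sigma> x in auto)
  \<comment> \<open>\<open>t * sinc (l * t)\<close> equals \<open>sin (l * t) / l\<close>, also at
    \<open>t = 0\<close>.\<close>
  also have "\<dots> = (\<integral>t. (normal_density (norm x) \<sigma> t * sin (l * t)) / l \<partial>lborel) / norm x"
    unfolding fe using l by (intro arg_cong[where f = "\<lambda>u. u / _"] Bochner_Integration.integral_cong) auto
  also have "\<dots> = exp (- l\<^sup>2 * \<sigma>\<^sup>2 / 2) * sincn l x"
    using l x integral_sin_normal_density[OF \<sigma>, of "norm x" l] by (simp add: sincn_def)
  finally show ?thesis .
qed

text \<open>The radial identity divides by \<open>norm x\<close>; the origin is reached as the limit
  of the nonzero points \<open>v n\<close>, by dominated convergence.\<close>

lemma integral_gauss_sincn: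
  fixes x :: "real ^ 3"
  assumes \<sigma>: "\<sigma> > 0" and l: "l \<noteq> 0"
  shows "(\<integral>y. sincn l (x + y) \<partial>gauss \<sigma>) = exp (- l\<^sup>2 * \<sigma>\<^sup>2 / 2) * sincn l x"
proof (cases "x = 0")
  case True
  interpret G: prob_space "gauss \<sigma>" by (rule prob_space_gauss[OF \<sigma>])
  define v :: "nat \<Rightarrow> real ^ 3" where "v n = (1 / real (Suc n)) *\<^sub>R axis 1 1" for n
  have v0: "v n \<noteq> 0" for n by (simp add: v_def)
  have v: "v \<longlonglongrightarrow> 0"
    unfolding v_def using LIMSEQ_inverse_real_of_nat tendsto_scaleR[OF _ tendsto_const]
    by (fastforce simp: inverse_eq_divide)
  have tend: "(\<lambda>n. sincn l (v n + y)) \<longlonglongrightarrow> sincn l (0 + y)" for y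
    by (rule continuous_on_tendsto_compose[of UNIV "sincn l", OF _ tendsto_add[OF v tendsto_const]])
       (auto intro!: continuous_intros)
  have "(\<lambda>n. \<integral>y. sincn l (v n + y) \<partial>gauss \<sigma>) \<longlonglongrightarrow> (\<integral>y. sincn l (0 + y) \<partial>gauss \<sigma>)"
    by (rule integral_dominated_convergence[where w = "\<lambda>_. 1"])
       (use tend abs_sincn_le_1 in auto)
  moreover have "(\<lambda>n. \<integral>y. sincn l (v n + y) \<partial>gauss \<sigma>) \<longlonglongrightarrow> exp (- l\<^sup>2 * \<sigma>\<^sup>2 / 2) * sincn l (0 + 0 :: real ^ 3)"
    unfolding integral_gauss_sincn_nonzero[OF \<sigma> l v0]
    using tend[of 0] by (auto intro!: tendsto_intros)
  ultimately show ?thesis using LIMSEQ_unique True by fastforce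
qed (rule integral_gauss_sincn_nonzero[OF assms])

section \<open>An exponential martingale of three-dimensional Brownian motion\<close>

lemma brownian_motion_distr:
  fixes B :: "real \<Rightarrow> 'b \<Rightarrow> real ^ 3"
  assumes "brownian_motion N B" "0 \<le> a" "a < b"
  shows "distr N borel (\<lambda>\<omega>. B b \<omega> - B a \<omega>) = gauss (sqrt (b - a))"
proof -
  have "distributed N lborel (\<lambda>\<omega>. B b \<omega> - B a \<omega>) (gauss_density (sqrt (b - a)))"
    using assms unfolding brownian_motion_def gauss_density_def[abs_def] by blast
  then show ?thesis
    unfolding gauss_def by (simp add: distributed_distr_eq_density[symmetric] cong: distr_cong)
qed

locale bm3 = prob_space N for N :: "'b measure" +
  fixes B :: "real \<Rightarrow> 'b \<Rightarrow> real ^ 3"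
  assumes bm: "brownian_motion N B"
begin

lemma B_measurable [measurable]: "t \<ge> 0 \<Longrightarrow> B t \<in> borel_measurable N"
  using bm by (simp add: brownian_motion_def)

lemma B_0: "\<omega> \<in> space N \<Longrightarrow> B 0 \<omega> = 0"
  using bm by (simp add: brownian_motion_def)

lemma B_cont: "\<omega> \<in> space N \<Longrightarrow> continuous_on {0..} (\<lambda>t. B t \<omega>)"
  using bm by (simp add: brownian_motion_def)

text \<open>Survival of the grid-time stopping rule. It is determined by the first \<open>k\<close>
  increments, hence independent of the next one, which leads from time \<open>k * h\<close> to
  \<open>Suc k * h\<close>.\<close>

definition below :: "real \<Rightarrow> real \<Rightarrow> nat \<Rightarrow> 'b \<Rightarrow> bool" where
  "below h z k \<omega> \<longleftrightarrow> (\<forall>j\<le>k. norm (B (real j * h) \<omega>) < z)"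

definition mart :: "real \<Rightarrow> real \<Rightarrow> 'b \<Rightarrow> real" where
  "mart l t \<omega> = exp (l\<^sup>2 * t / 2) * sincn l (B t \<omega>)"

lemma mart_measurable [measurable]: "t \<ge> 0 \<Longrightarrow> mart l t \<in> borel_measurable N"
  unfolding mart_def[abs_def] by measurable

lemma below_measurable [measurable]: "h \<ge> 0 \<Longrightarrow> Measurable.pred N (below h z k)"
  unfolding below_def by measurable

lemma abs_mart_le: "t \<le> s \<Longrightarrow> \<bar>mart l t \<omega>\<bar> \<le> exp (l\<^sup>2 * s / 2)"
  unfolding mart_def abs_mult
  by (rule order.trans[OF mult_left_le[OF abs_sincn_le_1]]) (auto intro: mult_left_mono)

text \<open>Averaging over the next increment multiplies \<open>sincn l\<close> by
  \<open>exp (- l\<^sup>2 * h / 2)\<close>, and the exponential prefactor of \<open>mart\<close>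
  grows by the inverse. Conditioning on the past takes the form of Fubini's theorem over the
  independent blocks of increments \<open>{..<k}\<close> and \<open>{k}\<close>.\<close>

lemma mart_step:
  assumes h: "h > 0" and l: "l \<noteq> 0"
  shows "(\<integral>\<omega>. (if below h z k \<omega> then mart l (real (Suc k) * h) \<omega> else 0) \<partial>N)
    = (\<integral>\<omega>. (if below h z k \<omega> then mart l (real k * h) \<omega> else 0) \<partial>N)"
proof -
  define D where "D i \<omega> = B (real (Suc i) * h) \<omega> - B (real i * h) \<omega>" for i \<omega>
  have "indep_vars (\<lambda>_. borel) D {..<Suc k}"
    unfolding D_def[abs_def] using bm h unfolding brownian_motion_def
    by (elim conjE allE[of _ "Suc k"] allE[of _ "\<lambda>i. real i * h"]) (auto intro!: mult_right_mono)
  then have ind: "indep_var (PiM {..<k} (\<lambda>_. borel)) (\<lambda>\<omega>. restrict (\<lambda>i. D i \<omega>) {..<k})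
      (PiM {k} (\<lambda>_. borel)) (\<lambda>\<omega>. restrict (\<lambda>i. D i \<omega>) {k})"
    by (rule indep_var_restrict) auto
  have [measurable]: "D i \<in> borel_measurable N" for i
    unfolding D_def[abs_def] by (intro borel_measurable_diff B_measurable) (use h in auto)
  define V where "V p j = (\<Sum>i<j. p i)" for p :: "nat \<Rightarrow> real ^ 3" and j
  define A where "A p \<longleftrightarrow> (\<forall>j\<le>k. norm (V p j) < z)" for p
  define P where "P = PiM {..<k} (\<lambda>_. borel :: (real ^ 3) measure)"
  define Q where "Q = PiM {k} (\<lambda>_. borel :: (real ^ 3) measure)"
  have VB: "V (\<lambda>i. D i \<omega>) j = B (real j * h) \<omega>" if "\<omega> \<in> space N" for \<omega> j
    unfolding V_def D_def using sum_lessThan_telescope[of "\<lambda>i. B (real i * h) \<omega>" j] B_0[OF that] by simp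
  have Vr: "V (restrict p {..<k}) j = V p j" if "j \<le> k" for p j
    unfolding V_def using that by (intro sum.cong) auto
  have [measurable]: "(\<lambda>p. V p j) \<in> borel_measurable P" if "j \<le> k" for j
    unfolding V_def P_def using that by (intro borel_measurable_sum measurable_component_singleton) auto
  have [measurable]: "Measurable.pred P A"
    unfolding A_def by measurable
  have [measurable]: "(\<lambda>q. q k) \<in> borel_measurable Q"
    unfolding Q_def by (intro measurable_component_singleton) auto
  define pp where "pp \<omega> = restrict (\<lambda>i. D i \<omega>) {..<k}" for \<omega>
  define qq where "qq \<omega> = restrict (\<lambda>i. D i \<omega>) {k}" for \<omega>
  have [measurable]: "pp \<in> measurable N P" "qq \<in> measurable N Q"
    unfolding pp_def[abs_def] qq_def[abs_def] P_def Q_def by measurable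
  have jd: "distr N (P \<Otimes>\<^sub>M Q) (\<lambda>\<omega>. (pp \<omega>, qq \<omega>)) = distr N P pp \<Otimes>\<^sub>M distr N Q qq"
    using ind unfolding indep_var_distribution_eq pp_def[abs_def] qq_def[abs_def] P_def Q_def by simp
  interpret PP: prob_space "distr N P pp" by (rule prob_space_distr) measurable
  interpret QQ: prob_space "distr N Q qq" by (rule prob_space_distr) measurable
  interpret PQ: pair_prob_space "distr N P pp" "distr N Q qq" ..
  have Ab: "A (pp \<omega>) \<longleftrightarrow> below h z k \<omega>" if "\<omega> \<in> space N" for \<omega>
    unfolding A_def below_def pp_def using VB[OF that] by (simp add: Vr)
  define e where "e = exp (l\<^sup>2 * (real (Suc k) * h) / 2)"
  define g where "g x = (if A (fst x) then e * sincn l (V (fst x) k + snd x k) else 0)" for x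
  have [measurable]: "g \<in> borel_measurable (P \<Otimes>\<^sub>M Q)"
    unfolding g_def[abs_def] by measurable
  have gint: "integrable (distr N P pp \<Otimes>\<^sub>M distr N Q qq) g"
    by (rule PQ.integrable_const_bound[where B=e])
       (auto simp: g_def e_def abs_mult abs_sincn_le_1 intro!: AE_I2)
  have inner: "(\<integral>q. g (p, q) \<partial>distr N Q qq) = (if A p then exp (l\<^sup>2 * (real k * h) / 2) * sincn l (V p k) else 0)" for p
  proof (cases "A p")
    case True
    have "(\<integral>q. g (p, q) \<partial>distr N Q qq) = e * (\<integral>q. sincn l (V p k + q k) \<partial>distr N Q qq)"
      using True by (simp add: g_def)
    also have "(\<integral>q. sincn l (V p k + q k) \<partial>distr N Q qq) = (\<integral>\<omega>. sincn l (V p k + D k \<omega>) \<partial>N)"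
      by (subst integral_distr) (auto simp: qq_def)
    also have "\<dots> = (\<integral>y. sincn l (V p k + y) \<partial>distr N borel (D k))"
      by (subst integral_distr) auto
    also have "distr N borel (D k) = gauss (sqrt h)"
      unfolding D_def[abs_def] using h brownian_motion_distr[OF bm, of "real k * h" "real (Suc k) * h"]
      by (simp add: algebra_simps)
    also have "(\<integral>y. sincn l (V p k + y) \<partial>gauss (sqrt h)) = exp (- l\<^sup>2 * h / 2) * sincn l (V p k)"
      using integral_gauss_sincn[of "sqrt h" l "V p k"] h l by simp
    also have "e * \<dots> = exp (l\<^sup>2 * (real k * h) / 2) * sincn l (V p k)"
      unfolding e_def by (simp add: ring_distribs add_divide_distrib flip: exp_add mult.assoc)
    finally show ?thesis using True by simp
  qed (simp add: g_def)
  have "(\<integral>\<omega>. (if below h z k \<omega> then mart l (real (Suc k) * h) \<omega> else 0) \<partial>N) = (\<integral>\<omega>. g (pp \<omega>, qq \<omega>) \<partial>N)"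
  proof (rule Bochner_Integration.integral_cong)
    fix \<omega> assume \<omega>: "\<omega> \<in> space N"
    have "V (pp \<omega>) k + qq \<omega> k = B (real (Suc k) * h) \<omega>"
      using VB[OF \<omega>, of k] VB[OF \<omega>, of "Suc k"] by (simp add: pp_def Vr qq_def) (simp add: V_def)
    then show "(if below h z k \<omega> then mart l (real (Suc k) * h) \<omega> else 0) = g (pp \<omega>, qq \<omega>)"
      using Ab[OF \<omega>] by (simp add: g_def mart_def e_def)
  qed simp
  also have "\<dots> = (\<integral>x. g x \<partial>(distr N P pp \<Otimes>\<^sub>M distr N Q qq))"
    unfolding jd[symmetric] by (subst integral_distr) auto
  also have "\<dots> = (\<integral>p. (\<integral>q. g (p, q) \<partial>distr N Q qq) \<partial>distr N P pp)"
    by (rule PQ.integral_fst'[OF gint, symmetric])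
  also have "\<dots> = (\<integral>\<omega>. (if A (pp \<omega>) then exp (l\<^sup>2 * (real k * h) / 2) * sincn l (V (pp \<omega>) k) else 0) \<partial>N)"
    unfolding inner by (subst integral_distr) auto
  also have "\<dots> = (\<integral>\<omega>. (if below h z k \<omega> then mart l (real k * h) \<omega> else 0) \<partial>N)"
  proof (rule Bochner_Integration.integral_cong)
    fix \<omega> assume \<omega>: "\<omega> \<in> space N"
    have "V (pp \<omega>) k = B (real k * h) \<omega>" using VB[OF \<omega>] by (simp add: pp_def Vr)
    then show "(if A (pp \<omega>) then exp (l\<^sup>2 * (real k * h) / 2) * sincn l (V (pp \<omega>) k) else 0)
      = (if below h z k \<omega> then mart l (real k * h) \<omega> else 0)"
      using Ab[OF \<omega>] by (simp add: mart_def)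
  qed simp
  finally show ?thesis .
qed

text \<open>\<open>mart\<close> stopped at the first grid time outside the ball, capped at step
  \<open>n\<close>. As a sum of increments its mean follows term by term from
  \<open>mart_step\<close>; the 1 is the value at time 0.\<close>

definition stopped :: "real \<Rightarrow> real \<Rightarrow> real \<Rightarrow> nat \<Rightarrow> 'b \<Rightarrow> real" where
  "stopped l h z n \<omega> = 1 + (\<Sum>k<n. if below h z k \<omega> then mart l (real (Suc k) * h) \<omega> - mart l (real k * h) \<omega> else 0)"

lemma stopped_measurable [measurable]: "h \<ge> 0 \<Longrightarrow> stopped l h z n \<in> borel_measurable N"
  unfolding stopped_def[abs_def] by measurable

lemma stopped_integral:
  assumes h: "h > 0" and l: "l \<noteq> 0"
  shows "(\<integral>\<omega>. stopped l h z n \<omega> \<partial>N) = 1"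
proof -
  have i: "integrable N (\<lambda>\<omega>. if below h z k \<omega> then mart l (real j * h) \<omega> else 0)" for k j
    by (rule integrable_const_bound[where B = "exp (l\<^sup>2 * (real j * h) / 2)"])
       (use h in \<open>auto intro!: AE_I2 abs_mart_le\<close>)
  have e: "(if below h z k \<omega> then mart l (real (Suc k) * h) \<omega> - mart l (real k * h) \<omega> else 0)
     = (if below h z k \<omega> then mart l (real (Suc k) * h) \<omega> else 0) - (if below h z k \<omega> then mart l (real k * h) \<omega> else 0)" for k \<omega>
    by simp
  show ?thesis
    unfolding stopped_def e using mart_step[OF h l] i
    by (subst Bochner_Integration.integral_add)
       (auto simp del: of_nat_Suc intro!: Bochner_Integration.integrable_sum Bochner_Integration.integrable_diff simp: prob_space)
qed

lemma stopped_cases: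
  assumes "\<omega> \<in> space N" "z > 0"
  obtains K where "K \<le> n" "stopped l h z n \<omega> = mart l (real K * h) \<omega>"
    "\<And>j. j < K \<Longrightarrow> norm (B (real j * h) \<omega>) < z" "K < n \<Longrightarrow> norm (B (real K * h) \<omega>) \<ge> z"
proof -
  have "\<exists>K\<le>n. stopped l h z n \<omega> = mart l (real K * h) \<omega> \<and> (\<forall>j<K. norm (B (real j * h) \<omega>) < z)
      \<and> (K < n \<longrightarrow> norm (B (real K * h) \<omega>) \<ge> z)"
  proof (induction n)
    case 0
    then show ?case using B_0[OF assms(1)] by (simp add: stopped_def mart_def sincn_def)
  next
    case (Suc n)
    then obtain K where K: "K \<le> n" "stopped l h z n \<omega> = mart l (real K * h) \<omega>"
      "\<forall>j<K. norm (B (real j * h) \<omega>) < z" "K < n \<longrightarrow> norm (B (real K * h) \<omega>) \<ge> z" by blast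
    show ?case
    proof (cases "below h z n \<omega>")
      case True
      then have "K = n" using K by (force simp: below_def)
      then have "stopped l h z (Suc n) \<omega> = mart l (real (Suc n) * h) \<omega>"
        using True K(2) by (simp add: stopped_def)
      then show ?thesis using True by (intro exI[of _ "Suc n"]) (auto simp: below_def)
    next
      case False
      then have "norm (B (real K * h) \<omega>) \<ge> z"
        using K by (cases "K = n") (auto simp: below_def le_less not_less)
      moreover have "stopped l h z (Suc n) \<omega> = mart l (real K * h) \<omega>"
        using False K(2) by (simp add: stopped_def)
      ultimately show ?thesis using K by (intro exI[of _ K]) auto
    qed
  qed
  then show ?thesis using that by blast
qed

end

section \<open>Maxima of continuous paths and the alternating series\<close>

lemma closure_Rats_unit_interval: "closure (\<rat> \<inter> {0..1::real}) = {0..1}"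
proof
  have "closure ({0<..<1::real} \<inter> \<rat>) = closure {0<..<1}"
    by (rule closure_open_Int_superset) (simp_all only: Rats_closure_real open_greaterThanLessThan subset_UNIV)
  moreover have "closure ({0<..<1::real} \<inter> \<rat>) \<subseteq> closure (\<rat> \<inter> {0..1::real})"
    by (rule closure_mono) force
  ultimately show "{0..1} \<subseteq> closure (\<rat> \<inter> {0..1::real})"
    by (simp only: closure_greaterThanLessThan zero_less_one)
  show "closure (\<rat> \<inter> {0..1::real}) \<subseteq> {0..1}"
    by (rule closure_minimal) (blast, rule closed_atLeastAtMost)
qed

text \<open>The supremum runs over rational fractions of the interval because the product
  sigma-algebra sees only countably many times. In \<open>ennreal\<close> it exists for every path;
  on continuous nonnegative paths it is the maximum over \<open>{a..a+b}\<close>.\<close>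

definition maxpath :: "real \<Rightarrow> real \<Rightarrow> (real \<Rightarrow> real) \<Rightarrow> real" where
  "maxpath a b p = enn2real (SUP q\<in>\<rat> \<inter> {0..1}. ennreal (p (a + q * b)))"

lemma measurable_maxpath:
  assumes "a \<ge> 0" "b \<ge> 0"
  shows "maxpath a b \<in> borel_measurable path_space"
  unfolding maxpath_def[abs_def]
proof -
  have "(\<lambda>p. SUP q\<in>\<rat> \<inter> {0..1}. ennreal (p (a + q * b))) \<in> borel_measurable path_space"
  proof (rule borel_measurable_SUP)
    show "countable (\<rat> \<inter> {0..1::real})" by (rule countable_Int1) (rule countable_rat)
    fix q :: real assume "q \<in> \<rat> \<inter> {0..1}"
    then have "a + q * b \<in> {0..}" using assms by simp
    then have "(\<lambda>p. p (a + q * b)) \<in> borel_measurable path_space"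
      by (rule measurable_component_singleton)
    then show "(\<lambda>p. ennreal (p (a + q * b))) \<in> borel_measurable path_space"
      by (rule measurable_compose[OF _ measurable_ennreal])
  qed
  then show "(\<lambda>p. enn2real (SUP q\<in>\<rat> \<inter> {0..1}. ennreal (p (a + q * b)))) \<in> borel_measurable path_space"
    by measurable
qed

lemma maxpath_attained:
  assumes c: "continuous_on {a..a+b} p" and b: "b \<ge> 0" and nn: "\<And>t. t \<in> {a..a+b} \<Longrightarrow> p t \<ge> 0"
  shows "\<exists>t\<in>{a..a+b}. p t = maxpath a b p \<and> (\<forall>u\<in>{a..a+b}. p u \<le> p t)"
proof -
  obtain t where t: "t \<in> {a..a+b}" "\<And>u. u \<in> {a..a+b} \<Longrightarrow> p u \<le> p t"
    using continuous_attains_sup[of "{a..a+b}" p] c b by auto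
  define S where "S = (SUP q\<in>\<rat> \<inter> {0..1}. ennreal (p (a + q * b)))"
  have mem: "a + q * b \<in> {a..a+b}" if "q \<in> {0..1}" for q
    using that b mult_right_mono[of q 1 b] by auto
  have S: "S \<le> ennreal (p t)"
    unfolding S_def by (rule SUP_least) (use mem t in \<open>auto intro!: ennreal_leI\<close>)
  then have Sf: "S < top" by (rule le_less_trans) simp
  have le: "p (a + q * b) \<le> enn2real S" if "q \<in> \<rat> \<inter> {0..1}" for q
  proof -
    have "ennreal (p (a + q * b)) \<le> S" unfolding S_def using that by (rule SUP_upper)
    then have "enn2real (ennreal (p (a + q * b))) \<le> enn2real S" using Sf by (rule enn2real_mono)
    then show ?thesis using nn[OF mem] that by simp
  qed
  obtain x where x: "x \<in> {0..1}" "t = a + x * b"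
  proof (cases "b = 0")
    case True then show ?thesis using t that[of 0] by auto
  next
    case False
    then have "(t - a) / b \<in> {0..1}" "t = a + (t - a) / b * b" using t(1) b by (auto simp: divide_le_eq)
    then show ?thesis by (rule that)
  qed
  have cc: "continuous_on {0..1} (\<lambda>q. p (a + q * b))"
  proof (rule continuous_on_compose2[OF c])
    show "continuous_on {0..1} (\<lambda>q. a + q * b)" by (intro continuous_intros)
    show "(\<lambda>q. a + q * b) ` {0..1} \<subseteq> {a..a + b}" using mem by blast
  qed
  have "p (a + x * b) \<le> enn2real S"
    by (rule continuous_le_on_closure[of "\<rat> \<inter> {0..1}" "\<lambda>q. p (a + q * b)"])
       (use le x cc in \<open>auto simp: closure_Rats_unit_interval\<close>)
  moreover have "enn2real S \<le> p t"
    using enn2real_mono[OF S] nn[OF t(1)] by simp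
  ultimately have "p t = enn2real S" using x by simp
  then show ?thesis using t unfolding maxpath_def S_def by blast
qed

lemma maxpath_less_iff:
  assumes "continuous_on {a..a+b} p" "b \<ge> 0" "\<And>t. t \<in> {a..a+b} \<Longrightarrow> p t \<ge> 0"
  shows "maxpath a b p < z \<longleftrightarrow> (\<forall>t\<in>{a..a+b}. p t < z)"
    and "z \<le> maxpath a b p \<longleftrightarrow> (\<exists>t\<in>{a..a+b}. z \<le> p t)"
    and "z < maxpath a b p \<longleftrightarrow> (\<exists>t\<in>{a..a+b}. z < p t)"
proof -
  obtain t where t: "t \<in> {a..a+b}" "p t = maxpath a b p" "\<And>u. u \<in> {a..a+b} \<Longrightarrow> p u \<le> p t"
    using maxpath_attained[OF assms] by blast
  show "maxpath a b p < z \<longleftrightarrow> (\<forall>t\<in>{a..a+b}. p t < z)"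
    unfolding t(2)[symmetric] using t(1,3) by (meson le_less_trans)
  show "z \<le> maxpath a b p \<longleftrightarrow> (\<exists>t\<in>{a..a+b}. z \<le> p t)"
    unfolding t(2)[symmetric] using t(1,3) by (meson order.trans)
  show "z < maxpath a b p \<longleftrightarrow> (\<exists>t\<in>{a..a+b}. z < p t)"
    unfolding t(2)[symmetric] using t(1,3) by (meson less_le_trans)
qed

text \<open>The set of hits is closed, so its infimum is a hit; a value of at least \<open>z\<close>
  any earlier would, by the intermediate value theorem, give an earlier hit.\<close>

lemma first_passage:
  fixes f :: "real \<Rightarrow> real"
  assumes c: "continuous_on {a..b} f" and "a \<le> b" "f a \<le> z" "z \<le> f b"
  obtains t where "t \<in> {a..b}" "f t = z" "\<And>u. a \<le> u \<Longrightarrow> u < t \<Longrightarrow> f u < z"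
proof -
  define S where "S = {t \<in> {a..b}. f t = z}"
  have "closed S" unfolding S_def using continuous_closed_preimage_constant[OF c] by simp
  moreover have "S \<noteq> {}" using IVT'[of f a z b] assms by (auto simp: S_def)
  moreover have bb: "bdd_below S" by (auto simp: S_def intro: bdd_belowI[of _ a])
  ultimately have t: "Inf S \<in> S" by (simp add: closed_contains_Inf)
  show ?thesis
  proof (rule that[of "Inf S"])
    show "Inf S \<in> {a..b}" "f (Inf S) = z" using t by (auto simp: S_def)
    fix u assume u: "a \<le> u" "u < Inf S"
    show "f u < z"
    proof (rule ccontr)
      assume "\<not> f u < z"
      have "Inf S \<in> {a..b}" using t by (simp add: S_def)
      then have "continuous_on {a..u} f" using c u by (auto intro: continuous_on_subset)
      then have "\<exists>v\<ge>a. v \<le> u \<and> f v = z"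
        using IVT'[of f a z u] \<open>\<not> f u < z\<close> assms(3) u(1) by simp
      then obtain v where "a \<le> v" "v \<le> u" "f v = z" by blast
      then have "v \<in> S" using u \<open>Inf S \<in> {a..b}\<close> by (simp add: S_def)
      then show False using cInf_lower[OF _ bb, of v] u \<open>v \<le> u\<close> by simp
    qed
  qed
qed

section \<open>Abel means of the alternating series\<close>

lemma arctan_damped_le:
  assumes "0 < q" "q < 1" "0 < \<phi>" "\<phi> < pi"
  shows "0 \<le> arctan (q * sin \<phi> / (1 + q * cos \<phi>))" "arctan (q * sin \<phi> / (1 + q * cos \<phi>)) \<le> \<phi> / 2"
proof -
  have s: "sin \<phi> > 0" using assms sin_gt_zero by simp
  have c: "- 1 < cos \<phi>" using assms cos_monotone_0_pi[of \<phi> pi] by simp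
  have p1: "1 + q * cos \<phi> > 0"
    using mult_strict_left_mono[OF c, of q] assms by simp
  show "0 \<le> arctan (q * sin \<phi> / (1 + q * cos \<phi>))"
    using p1 s assms by simp
  \<comment> \<open>The quotient increases with \<open>q\<close>, and at \<open>q = 1\<close> it is
    the tangent of half the angle.\<close>
  have "q * sin \<phi> / (1 + q * cos \<phi>) \<le> sin \<phi> / (1 + cos \<phi>)"
    using p1 c s assms by (simp add: divide_le_eq le_divide_eq pos_divide_le_eq pos_le_divide_eq algebra_simps)
  also have "\<dots> = tan (\<phi> / 2)"
    using tan_half[of "\<phi> / 2"] by simp
  finally have "arctan (q * sin \<phi> / (1 + q * cos \<phi>)) \<le> arctan (tan (\<phi> / 2))"
    by (simp add: arctan_le_iff)
  then show "arctan (q * sin \<phi> / (1 + q * cos \<phi>)) \<le> \<phi> / 2"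
    using assms by (simp add: arctan_tan)
qed

text \<open>At \<open>q = 1\<close> this would be the Fourier series of the sawtooth \<phi> on (-pi,
  pi), divided by \<phi>. It converges only conditionally, and not at all at
  \<open>\<phi> = 0\<close>. Damping with \<open>q < 1\<close> makes it absolutely convergent, so
  that sum and expectation can be exchanged.\<close>

definition abel :: "real \<Rightarrow> real \<Rightarrow> real" where
  "abel q \<phi> = (\<Sum>k. 2 * (-1) ^ k * q ^ Suc k * sinc (real (Suc k) * \<phi>))"

lemma abel_0:
  assumes "0 < q" "q < 1"
  shows "abel q 0 = 2 * q / (1 + q)"
proof -
  have "(\<lambda>k. 2 * q * (- q) ^ k) sums (2 * q * (1 / (1 - (- q))))"
    using assms by (intro sums_mult geometric_sums) simp
  moreover have "2 * q * (- q) ^ k = 2 * (-1) ^ k * q ^ Suc k * sinc (real (Suc k) * 0)" for k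
    by (simp add: power_minus')
  ultimately show ?thesis unfolding abel_def by (simp only: sums_unique[symmetric]) simp
qed

text \<open>The series is \<open>2 / \<phi>\<close> times the imaginary part of
  \<open>ln (1 + q * cis \<phi>)\<close>, and \<open>1 + q * cis \<phi>\<close> lies in the right
  half-plane, where the argument is an arctangent.\<close>

lemma abel_pos:
  assumes q: "0 < q" "q < 1" and \<phi>: "0 < \<phi>" "\<phi> < pi"
  shows "abel q \<phi> = 2 / \<phi> * arctan (q * sin \<phi> / (1 + q * cos \<phi>))"
proof -
  define w where "w = of_real q * cis \<phi>"
  have "norm w < 1" using q by (simp add: w_def norm_mult)
  then have "(\<lambda>n. Im ((-1) ^ Suc n / of_nat n * w ^ n)) sums Im (ln (1 + w))"
    by (intro sums_Im Ln_series)
  moreover have "Im ((-1) ^ Suc n / of_nat n * w ^ n) = (-1) ^ Suc n / real n * (q ^ n * sin (real n * \<phi>))" for n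
  proof -
    have "(-1) ^ Suc n / of_nat n * w ^ n = of_real ((-1) ^ Suc n / real n * q ^ n) * cis (real n * \<phi>)"
      by (simp add: w_def power_mult_distrib Complex.DeMoivre)
    then show ?thesis by (simp del: of_real_mult of_real_divide)
  qed
  ultimately have "(\<lambda>n. (-1) ^ Suc n / real n * (q ^ n * sin (real n * \<phi>))) sums Im (ln (1 + w))" by (simp only:)
  \<comment> \<open>The term with \<open>n = 0\<close> is 0, so shifting the index leaves the sum
    unchanged.\<close>
  then have "(\<lambda>n. (-1) ^ Suc (Suc n) / real (Suc n) * (q ^ Suc n * sin (real (Suc n) * \<phi>))) sums Im (ln (1 + w))"
    using sums_Suc_iff[of "\<lambda>n. (-1) ^ Suc n / real n * (q ^ n * sin (real n * \<phi>))" "Im (ln (1 + w))"] by simp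
  then have "(\<lambda>n. 2 / \<phi> * ((-1) ^ Suc (Suc n) / real (Suc n) * (q ^ Suc n * sin (real (Suc n) * \<phi>)))) sums (2 / \<phi> * Im (ln (1 + w)))"
    by (rule sums_mult)
  moreover have "2 / \<phi> * ((-1) ^ Suc (Suc n) / real (Suc n) * (q ^ Suc n * sin (real (Suc n) * \<phi>)))
     = 2 * (-1) ^ n * q ^ Suc n * sinc (real (Suc n) * \<phi>)" for n
    using \<phi> by (simp add: field_simps del: of_nat_Suc)
  ultimately have "abel q \<phi> = 2 / \<phi> * Im (ln (1 + w))"
    unfolding abel_def by (simp only: sums_unique[symmetric])
  moreover have "Im (ln (1 + w)) = arctan (q * sin \<phi> / (1 + q * cos \<phi>))"
  proof -
    have c: "- 1 < cos \<phi>" using \<phi> cos_monotone_0_pi[of \<phi> pi] by simp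
    have p1: "Re (1 + w) > 0"
      using mult_strict_left_mono[OF c, of q] q by (simp add: w_def)
    then have "1 + w \<noteq> 0" by force
    then show ?thesis
      using arg_conv_arctan[OF p1] by (simp add: Arg_eq_Im_Ln w_def)
  qed
  ultimately show ?thesis by simp
qed

text \<open>The arctangent is at most \<open>\<phi> / 2\<close>. The constant 1 dominates when
  \<open>q\<close> tends to 1 under the expectation.\<close>

lemma abs_abel_le_1:
  assumes q: "0 < q" "q < 1" and \<phi>: "0 \<le> \<phi>" "\<phi> < pi"
  shows "\<bar>abel q \<phi>\<bar> \<le> 1"
proof (cases "\<phi> = 0")
  case True
  then show ?thesis using q abel_0[OF q] by simp
next
  case False
  then have \<phi>: "0 < \<phi>" "\<phi> < pi" using \<phi> by auto
  show ?thesis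
    unfolding abel_pos[OF q \<phi>] using arctan_damped_le[OF q \<phi>] \<phi> by (simp add: field_simps)
qed

lemma abel_tendsto_1:
  assumes \<phi>: "0 \<le> \<phi>" "\<phi> < pi"
  shows "((\<lambda>q. abel q \<phi>) \<longlongrightarrow> 1) (at_left 1)"
proof -
  have ev: "\<forall>\<^sub>F q in at_left 1. q \<in> {0<..<1::real}"
    by (rule eventually_at_left_real) simp
  show ?thesis
  proof (cases "\<phi> = 0")
    case True
    have "((\<lambda>q. 2 * q / (1 + q)) \<longlongrightarrow> 2 * 1 / (1 + 1::real)) (at_left 1)"
      by (intro tendsto_intros) auto
    then have "((\<lambda>q. 2 * q / (1 + q)) \<longlongrightarrow> 1) (at_left (1::real))" by simp
    then show ?thesis
      by (rule Lim_transform_eventually) (use ev in \<open>eventually_elim, simp add: True abel_0\<close>)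
  next
    case False
    then have \<phi>: "0 < \<phi>" "\<phi> < pi" using \<phi> by auto
    have c: "- 1 < cos \<phi>" using \<phi> cos_monotone_0_pi[of \<phi> pi] by simp
    have t: "1 * sin \<phi> / (1 + 1 * cos \<phi>) = tan (\<phi> / 2)"
      using tan_half[of "\<phi> / 2"] by simp
    have "((\<lambda>q. 2 / \<phi> * arctan (q * sin \<phi> / (1 + q * cos \<phi>))) \<longlongrightarrow> 2 / \<phi> * arctan (1 * sin \<phi> / (1 + 1 * cos \<phi>))) (at_left 1)"
      using c by (intro tendsto_intros) auto
    also have "2 / \<phi> * arctan (1 * sin \<phi> / (1 + 1 * cos \<phi>)) = 1"
      unfolding t using \<phi> by (simp add: arctan_tan)
    finally show ?thesis
      by (rule Lim_transform_eventually) (use ev in \<open>eventually_elim, simp add: \<phi> abel_pos\<close>)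
  qed
qed

text \<open>Tannery's theorem: since \<open>(k + 1)\<^sup>2 \<ge> k\<close>, the terms are dominated
  by \<open>2 * u ^ k\<close> with \<open>u = exp (- a)\<close>, uniformly for \<open>q\<close>
  between 0 and 1.\<close>

lemma damped_sum_tendsto:
  fixes a :: real
  assumes a: "a > 0"
  shows "((\<lambda>q. \<Sum>k. 2 * (-1) ^ k * q ^ Suc k * exp (- (real (Suc k))\<^sup>2 * a)) \<longlongrightarrow>
     (\<Sum>k. 2 * (-1) ^ k * exp (- (real (Suc k))\<^sup>2 * a))) (at_left 1)" (is ?A)
    and "summable (\<lambda>k. 2 * (-1) ^ k * exp (- (real (Suc k))\<^sup>2 * a))" (is ?B)
    and "summable (\<lambda>k. norm (2 * (-1) ^ k * exp (- (real (Suc k))\<^sup>2 * a)))" (is ?C)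
proof -
  define u where "u = exp (- a)"
  have u: "0 < u" "u < 1" using a by (auto simp: u_def)
  have le: "exp (- (real (Suc k))\<^sup>2 * a) \<le> u ^ k" for k
  proof -
    have "exp (- (real (Suc k))\<^sup>2 * a) \<le> exp (- (real k * a))"
    proof -
      have "real k * 1 \<le> real (Suc k) * real (Suc k)" by (rule mult_mono) auto
      then have "real k * a \<le> (real (Suc k))\<^sup>2 * a"
        using a by (intro mult_right_mono) (auto simp: power2_eq_square simp del: of_nat_Suc)
      then show ?thesis by simp
    qed
    also have "\<dots> = u ^ k" unfolding u_def by (simp add: exp_of_nat_mult flip: exp_of_nat_mult)
    finally show ?thesis .
  qed
  have *: "eventually (\<lambda>q. summable (\<lambda>k. norm (2 * (-1) ^ k * q ^ Suc k * exp (- (real (Suc k))\<^sup>2 * a)))) (at_left 1) \<and>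
     summable (\<lambda>k. norm (2 * (-1) ^ k * exp (- (real (Suc k))\<^sup>2 * a))) \<and> ?A"
  proof (rule tannerys_theorem[where M = "\<lambda>k. 2 * u ^ k"])
    show "((\<lambda>q. 2 * (-1) ^ k * q ^ Suc k * exp (- (real (Suc k))\<^sup>2 * a)) \<longlongrightarrow> 2 * (-1) ^ k * exp (- (real (Suc k))\<^sup>2 * a)) (at_left 1)" for k
    proof -
      have "((\<lambda>q. 2 * (-1) ^ k * q ^ Suc k * exp (- (real (Suc k))\<^sup>2 * a)) \<longlongrightarrow> 2 * (-1) ^ k * 1 ^ Suc k * exp (- (real (Suc k))\<^sup>2 * a)) (at_left 1)"
        by (intro tendsto_intros)
      then show ?thesis by simp
    qed
    show "summable (\<lambda>k. 2 * u ^ k)" using u by (intro summable_mult summable_geometric) simp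
    have ev: "\<forall>\<^sub>F q in at_left 1. q \<in> {0<..<1::real}"
      by (rule eventually_at_left_real) simp
    show "\<forall>\<^sub>F (k, q) in at_top \<times>\<^sub>F at_left 1. norm (2 * (-1) ^ k * q ^ Suc k * exp (- (real (Suc k))\<^sup>2 * a)) \<le> 2 * u ^ k"
      unfolding eventually_prod_filter
    proof (rule exI[of _ "\<lambda>_. True"], rule exI[of _ "\<lambda>q. q \<in> {0<..<1}"], intro conjI allI impI)
      fix k and q :: real assume q: "q \<in> {0<..<1}"
      have "norm (2 * (-1) ^ k * q ^ Suc k * exp (- (real (Suc k))\<^sup>2 * a)) = 2 * q ^ Suc k * exp (- (real (Suc k))\<^sup>2 * a)"
        unfolding real_norm_def using q by (simp only: abs_mult power_abs) simp
      also have "\<dots> \<le> 2 * 1 * u ^ k"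
        using q power_le_one[of q "Suc k"] by (intro mult_mono le) (auto simp del: power_Suc)
      finally show "case (k, q) of (k, q) \<Rightarrow> norm (2 * (-1) ^ k * q ^ Suc k * exp (- (real (Suc k))\<^sup>2 * a)) \<le> 2 * u ^ k" by simp
    qed (use ev in auto)
  qed simp
  then show ?A by blast
  show ?C using * by blast
  show ?B using * by (blast intro: summable_norm_cancel)
qed

section \<open>The law of the running maximum\<close>

context bm3
begin

abbreviation "normB \<omega> \<equiv> (\<lambda>t. norm (B t \<omega>))"

lemma normB_cont: "\<omega> \<in> space N \<Longrightarrow> a \<ge> 0 \<Longrightarrow> continuous_on {a..b} (normB \<omega>)"
  using B_cont[of \<omega>] by (intro continuous_on_norm) (auto intro: continuous_on_subset)

lemma maxB_measurable [measurable]: "s \<ge> 0 \<Longrightarrow> (\<lambda>\<omega>. maxpath 0 s (normB \<omega>)) \<in> borel_measurable N"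
proof -
  assume s: "s \<ge> 0"
  have "(\<lambda>\<omega>. path_of (\<lambda>t \<omega>. norm (B t \<omega>)) \<omega>) \<in> measurable N path_space"
    unfolding path_of_def by (rule measurable_restrict) auto
  then have "(\<lambda>\<omega>. maxpath 0 s (path_of (\<lambda>t \<omega>. norm (B t \<omega>)) \<omega>)) \<in> borel_measurable N"
    by (rule measurable_compose[OF _ measurable_maxpath]) (use s in auto)
  moreover have "maxpath 0 s (path_of (\<lambda>t \<omega>. norm (B t \<omega>)) \<omega>) = maxpath 0 s (normB \<omega>)" for \<omega>
    unfolding maxpath_def path_of_def using s by (intro arg_cong[where f = enn2real] SUP_cong) auto
  ultimately show ?thesis by (simp only:)
qed

text \<open>A path staying below \<open>z\<close> is never stopped on the grid. If it exceeds
  \<open>z\<close>, a fine grid stops it, and uniform continuity places the stopped point near the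
  sphere, where \<open>sinc (l * z) = 0\<close> by the choice of \<open>l\<close>. A path that only
  touches the sphere may or may not be stopped, depending on the grid, whence
  \<open>ne\<close>.\<close>

lemma stopped_tendsto:
  assumes \<omega>: "\<omega> \<in> space N" and s: "s > 0" and z: "z > 0" and k: "k \<ge> 1"
    and ne: "maxpath 0 s (normB \<omega>) \<noteq> z"
  defines "l \<equiv> real k * pi / z"
  shows "(\<lambda>n. stopped l (s / real (Suc n)) z (Suc n) \<omega>) \<longlonglongrightarrow>
     (if maxpath 0 s (normB \<omega>) < z then mart l s \<omega> else 0)"
proof -
  define f where "f = normB \<omega>"
  have fc: "continuous_on {0..s} f" unfolding f_def using normB_cont[OF \<omega>] by simp
  have f0: "f 0 = 0" using B_0[OF \<omega>] by (simp add: f_def)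
  have fnn: "f t \<ge> 0" for t by (simp add: f_def)
  have grid: "real j * (s / real (Suc n)) \<in> {0..s}" if "j \<le> Suc n" for j n
    using that s by (auto simp: field_simps simp del: of_nat_Suc intro: mult_right_mono)
  show ?thesis
  proof (cases "maxpath 0 s f < z")
    case True
    then have lt: "\<And>t. t \<in> {0..s} \<Longrightarrow> f t < z"
      using maxpath_less_iff(1)[of 0 s f z] fc fnn s by simp
    have "stopped l (s / real (Suc n)) z (Suc n) \<omega> = mart l s \<omega>" for n
    proof -
      obtain K where K: "K \<le> Suc n" "stopped l (s / real (Suc n)) z (Suc n) \<omega> = mart l (real K * (s / real (Suc n))) \<omega>"
        "K < Suc n \<Longrightarrow> f (real K * (s / real (Suc n))) \<ge> z"
        using stopped_cases[OF \<omega> z] unfolding f_def by metis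
      have "K = Suc n" using K(1,3) lt[OF grid[OF K(1)]] by force
      then show ?thesis using K(2) by simp
    qed
    then show ?thesis using True by (simp add: f_def)
  next
    case False
    then have "z < maxpath 0 s f" using ne by (simp add: f_def)
    then obtain t where t: "t \<in> {0..s}" "z < f t"
      using maxpath_less_iff(3)[of 0 s f z] fc fnn s by auto
    have uc: "uniformly_continuous_on {0..s} f"
      by (rule compact_uniformly_continuous[OF fc]) simp
    define C where "C = exp (l\<^sup>2 * s / 2)"
    have C: "C > 0" by (simp add: C_def)
    have sz: "sinc (l * z) = 0" using z k by (simp add: l_def sin_npi)
    have "(\<lambda>n. stopped l (s / real (Suc n)) z (Suc n) \<omega>) \<longlonglongrightarrow> 0"
    proof (rule LIMSEQ_I)
      fix e :: real assume e: "e > 0"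
      define S where "S v = sinc (l * v)" for v
      have "isCont S z" using isCont_sinc_mult[of z l] by (simp add: S_def[abs_def])
      moreover have "S z = 0" using sz by (simp add: S_def)
      ultimately obtain d where "d > 0" "\<And>v. \<bar>v - z\<bar> < d \<Longrightarrow> \<bar>S v\<bar> < e / C"
        using e C unfolding continuous_at_eps_delta dist_real_def by (metis diff_zero divide_pos_pos)
      then have d: "d > 0" "\<And>v. \<bar>v - z\<bar> < d \<Longrightarrow> \<bar>sinc (l * v)\<bar> < e / C"
        unfolding S_def by blast+
      \<comment> \<open>One bound serves twice: \<open>d\<close> controls the overshoot past
        \<open>z\<close>, and \<open>f t - z\<close> keeps the grid point next to \<open>t\<close>
        above \<open>z\<close>, so that the rule fires.\<close>
      define d2 where "d2 = min d (f t - z)"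
      have "d2 > 0" using d t by (simp add: d2_def)
      then obtain \<delta> where \<delta>: "\<delta> > 0" "\<And>u v. u \<in> {0..s} \<Longrightarrow> v \<in> {0..s} \<Longrightarrow> \<bar>u - v\<bar> < \<delta> \<Longrightarrow> \<bar>f u - f v\<bar> < d2"
        using uc unfolding uniformly_continuous_on_def dist_real_def by metis
      obtain n0 where n0: "s / real (Suc n0) < \<delta>"
        using reals_Archimedean[of "\<delta> / s"] \<delta>(1) s by (auto simp: field_simps)
      show "\<exists>no. \<forall>n\<ge>no. norm (stopped l (s / real (Suc n)) z (Suc n) \<omega> - 0) < e"
      proof (intro exI[of _ n0] allI impI)
        fix n assume n: "n0 \<le> n"
        define h where "h = s / real (Suc n)"
        have h: "h > 0" using s by (simp add: h_def)
        have "h \<le> s / real (Suc n0)" unfolding h_def using n s by (intro divide_left_mono) auto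
        then have h\<delta>: "h < \<delta>" using n0 by simp
        obtain K where K: "K \<le> Suc n" "stopped l h z (Suc n) \<omega> = mart l (real K * h) \<omega>"
          "\<And>j. j < K \<Longrightarrow> f (real j * h) < z" "K < Suc n \<Longrightarrow> f (real K * h) \<ge> z"
          using stopped_cases[OF \<omega> z, of "Suc n" l h] unfolding f_def by metis
        \<comment> \<open>The last grid index at or before time \<open>t\<close>.\<close>
        define j where "j = nat \<lfloor>t / h\<rfloor>"
        have j0: "real j \<le> t / h" "t / h < real j + 1"
          using t h unfolding j_def by (auto simp: of_nat_nat)
        have jh: "real j * h \<le> t" "t < real j * h + h"
          using j0 h by (auto simp: field_simps)
        have "t / h \<le> s / h" using t h by (simp add: divide_right_mono)
        also have "s / h = real (Suc n)" using s by (simp add: h_def)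
        finally have "t / h \<le> real (Suc n)" .
        then have jn: "j \<le> Suc n" using j0(1) by linarith
        have "\<bar>t - real j * h\<bar> < \<delta>" using jh h\<delta> by simp
        then have "\<bar>f t - f (real j * h)\<bar> < d2"
          using \<delta>(2)[of t "real j * h"] t grid[OF jn] by (simp add: h_def)
        moreover have "d2 \<le> f t - z" by (simp add: d2_def)
        ultimately have fj: "f (real j * h) > z" by linarith
        have Kj: "K \<le> j" using K(3)[of j] fj by force
        have fK: "f (real K * h) \<ge> z"
          using K(1,4) Kj jn fj by (cases "K = Suc n") (auto)
        \<comment> \<open>The path starts inside the ball, so there is a previous grid point, and
          that one is still below \<open>z\<close>.\<close>
        have "K \<noteq> 0" using fK f0 z by (intro notI) simp
        then obtain K' where K': "K = Suc K'" by (cases K) auto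
        have "f (real K' * h) < z" using K(3) K' by simp
        moreover have "\<bar>f (real K * h) - f (real K' * h)\<bar> < d2"
        proof (rule \<delta>(2))
          show "real K * h \<in> {0..s}" "real K' * h \<in> {0..s}"
            using grid[of K n] grid[of K' n] K(1) K' by (simp_all add: h_def)
          have "real K * h - real K' * h = h" by (simp add: K' algebra_simps)
          then show "\<bar>real K * h - real K' * h\<bar> < \<delta>" using h\<delta> h by simp
        qed
        moreover have "d2 \<le> d" by (simp add: d2_def)
        ultimately have "\<bar>f (real K * h) - z\<bar> < d" using fK by linarith
        then have lt: "\<bar>sinc (l * f (real K * h))\<bar> < e / C" by (rule d(2))
        have Ks: "real K * h \<le> s" using grid[OF K(1)] by (simp add: h_def)
        have "\<bar>mart l (real K * h) \<omega>\<bar> = exp (l\<^sup>2 * (real K * h) / 2) * \<bar>sinc (l * f (real K * h))\<bar>"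
          unfolding mart_def sincn_def f_def abs_mult by simp
        also have "\<dots> \<le> C * \<bar>sinc (l * f (real K * h))\<bar>"
          unfolding C_def using Ks by (intro mult_right_mono) (auto intro: mult_left_mono)
        also have "\<dots> < C * (e / C)" using lt C by (intro mult_strict_left_mono)
        finally show "norm (stopped l (s / real (Suc n)) z (Suc n) \<omega> - 0) < e"
          using K(2) C by (simp add: h_def)
      qed
    qed
    then show ?thesis using False by (simp add: f_def)
  qed
qed

lemma abs_stopped_le:
  assumes "\<omega> \<in> space N" "z > 0" "h \<ge> 0" "real n * h \<le> s"
  shows "\<bar>stopped l h z n \<omega>\<bar> \<le> exp (l\<^sup>2 * s / 2)"
proof -
  obtain K where "K \<le> n" "stopped l h z n \<omega> = mart l (real K * h) \<omega>"
    using stopped_cases[OF assms(1,2)] by metis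
  moreover have "real K * h \<le> s" using mult_right_mono[of "real K" "real n" h] assms \<open>K \<le> n\<close> by simp
  ultimately show ?thesis using abs_mart_le by simp
qed

text \<open>The stopped martingales have mean 1 on every grid. In the limit the stopped paths
  contribute 0, leaving the mean of \<open>mart l s\<close> over the surviving ones; the
  deterministic factor \<open>exp (l\<^sup>2 * s / 2)\<close> is then divided out.\<close>

lemma integral_sincn_below:
  assumes s: "s > 0" and z: "z > 0" and k: "k \<ge> 1"
    and atom: "AE \<omega> in N. maxpath 0 s (normB \<omega>) \<noteq> z"
  shows "(\<integral>\<omega>. (if maxpath 0 s (normB \<omega>) < z then sincn (real k * pi / z) (B s \<omega>) else 0) \<partial>N)
     = exp (- ((real k)\<^sup>2 * (pi\<^sup>2 * s / (2 * z\<^sup>2))))"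
proof -
  define l where "l = real k * pi / z"
  have l: "l \<noteq> 0" using k z by (simp add: l_def)
  have [measurable]: "(\<lambda>\<omega>. maxpath 0 s (normB \<omega>)) \<in> borel_measurable N" "B s \<in> borel_measurable N"
    using s by auto
  have [measurable]: "mart l s \<in> borel_measurable N" using s by simp
  have "(\<lambda>n. \<integral>\<omega>. stopped l (s / real (Suc n)) z (Suc n) \<omega> \<partial>N) \<longlonglongrightarrow>
     (\<integral>\<omega>. (if maxpath 0 s (normB \<omega>) < z then mart l s \<omega> else 0) \<partial>N)"
  proof (rule integral_dominated_convergence[where w = "\<lambda>_. exp (l\<^sup>2 * s / 2)"])
    show "stopped l (s / real (Suc n)) z (Suc n) \<in> borel_measurable N" for n
      using s by (intro stopped_measurable) simp
    show "AE \<omega> in N. norm (stopped l (s / real (Suc n)) z (Suc n) \<omega>) \<le> exp (l\<^sup>2 * s / 2)" for n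
      using s z by (intro AE_I2) (auto intro!: abs_stopped_le simp del: of_nat_Suc)
    show "AE \<omega> in N. (\<lambda>n. stopped l (s / real (Suc n)) z (Suc n) \<omega>) \<longlonglongrightarrow>
        (if maxpath 0 s (normB \<omega>) < z then mart l s \<omega> else 0)"
      using atom AE_space
    proof eventually_elim
      case (elim \<omega>)
      then show ?case using stopped_tendsto[OF _ s z k, of \<omega>] unfolding l_def by blast
    qed
  qed auto
  moreover have "(\<integral>\<omega>. stopped l (s / real (Suc n)) z (Suc n) \<omega> \<partial>N) = 1" for n
    using s l by (intro stopped_integral) auto
  ultimately have "(\<integral>\<omega>. (if maxpath 0 s (normB \<omega>) < z then mart l s \<omega> else 0) \<partial>N) = 1"
    using LIMSEQ_unique[of "\<lambda>_. 1::real"] by fastforce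
  moreover have "(if maxpath 0 s (normB \<omega>) < z then mart l s \<omega> else 0)
     = exp (l\<^sup>2 * s / 2) * (if maxpath 0 s (normB \<omega>) < z then sincn l (B s \<omega>) else 0)" for \<omega>
    by (simp add: mart_def)
  ultimately have "exp (l\<^sup>2 * s / 2) * (\<integral>\<omega>. (if maxpath 0 s (normB \<omega>) < z then sincn l (B s \<omega>) else 0) \<partial>N) = 1"
    by simp
  then have "(\<integral>\<omega>. (if maxpath 0 s (normB \<omega>) < z then sincn l (B s \<omega>) else 0) \<partial>N) = exp (- (l\<^sup>2 * s / 2))"
    by (simp add: exp_minus field_simps)
  moreover have "l\<^sup>2 * s / 2 = (real k)\<^sup>2 * (pi\<^sup>2 * s / (2 * z\<^sup>2))"
    by (simp add: l_def power_divide power_mult_distrib)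
  ultimately show ?thesis unfolding l_def by metis
qed

text \<open>For each \<open>q n < 1\<close> the series can be integrated termwise. As
  \<open>q n\<close> tends to 1, dominated convergence turns the integrand into the indicator of the
  event, while Tannery's theorem removes the damping from the sum of the means.\<close>

lemma prob_maxB_less:
  assumes s: "s > 0" and z: "z > 0" and atom: "AE \<omega> in N. maxpath 0 s (normB \<omega>) \<noteq> z"
  shows "prob {\<omega>\<in>space N. maxpath 0 s (normB \<omega>) < z}
    = (\<Sum>k. 2 * (-1) ^ k * exp (- (real (Suc k))\<^sup>2 * (pi\<^sup>2 * s / (2 * z\<^sup>2))))"
proof -
  define a where "a = pi\<^sup>2 * s / (2 * z\<^sup>2)"
  have a: "a > 0" using s z by (simp add: a_def)
  have [measurable]: "(\<lambda>\<omega>. maxpath 0 s (normB \<omega>)) \<in> borel_measurable N" "B s \<in> borel_measurable N"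
    using s by auto
  define \<phi> where "\<phi> \<omega> = pi * normB \<omega> s / z" for \<omega>
  have \<phi>: "0 \<le> \<phi> \<omega>" "\<phi> \<omega> < pi" if "\<omega> \<in> space N" "maxpath 0 s (normB \<omega>) < z" for \<omega>
  proof -
    have "normB \<omega> s < z"
      using maxpath_less_iff(1)[of 0 s "normB \<omega>" z] normB_cont[of \<omega> 0 s] that s by auto
    then show "0 \<le> \<phi> \<omega>" "\<phi> \<omega> < pi" using z by (auto simp: \<phi>_def field_simps)
  qed
  \<comment> \<open>The offset 2 keeps \<open>q 0\<close> positive.\<close>
  define q where "q n = 1 - 1 / real (n + 2)" for n :: nat
  have q: "0 < q n" "q n < 1" for n by (auto simp: q_def field_simps)
  have qlim: "filterlim q (at_left 1) sequentially"
    unfolding filterlim_at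
  proof
    have "(\<lambda>n. 1 - 1 / real (n + 2)) \<longlonglongrightarrow> 1 - 0"
      by (intro tendsto_diff tendsto_const LIMSEQ_ignore_initial_segment[OF lim_1_over_n])
    then show "q \<longlonglongrightarrow> 1" by (simp add: q_def[abs_def])
    show "\<forall>\<^sub>F n in sequentially. q n \<in> {..<1} \<and> q n \<noteq> 1"
      using q(2) by (intro always_eventually) (auto simp: less_imp_neq)
  qed
  define c where "c n k = 2 * (-1) ^ k * q n ^ Suc k" for n k
  define g where "g k \<omega> = (if maxpath 0 s (normB \<omega>) < z then sincn (real (Suc k) * pi / z) (B s \<omega>) else 0)" for k \<omega>
  have [measurable]: "g k \<in> borel_measurable N" for k unfolding g_def[abs_def] by measurable
  have gle: "\<bar>g k \<omega>\<bar> \<le> 1" for k \<omega> by (simp add: g_def abs_sincn_le_1)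
  have cabs: "\<bar>c n k\<bar> = 2 * q n ^ Suc k" for n k
    unfolding c_def using q[of n] by (simp only: abs_mult power_abs) simp
  have csum: "summable (\<lambda>k. 2 * q n ^ Suc k)" for n
    using q[of n] by (intro summable_mult summable_Suc_iff[THEN iffD2] summable_geometric) simp
  have cg: "\<bar>c n k * g k \<omega>\<bar> \<le> 2 * q n ^ Suc k" for n k \<omega>
    unfolding abs_mult cabs using q[of n] by (intro mult_left_le gle) simp
  have cgi: "integrable N (\<lambda>\<omega>. c n k * g k \<omega>)" for n k
    by (rule integrable_const_bound[where B = "2 * q n ^ Suc k"]) (use cg in auto)
  have gi: "(\<integral>\<omega>. g k \<omega> \<partial>N) = exp (- (real (Suc k))\<^sup>2 * a)" for k
    unfolding g_def using integral_sincn_below[OF s z _ atom, of "Suc k"] by (simp add: a_def)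
  \<comment> \<open>On surviving paths the angle lies in [0, pi), where the Abel means are bounded
    and converge; on the others every term is 0.\<close>
  have F: "(\<Sum>k. c n k * g k \<omega>) = (if maxpath 0 s (normB \<omega>) < z then abel (q n) (\<phi> \<omega>) else 0)" for n \<omega>
  proof -
    have e: "real (Suc k) * pi / z * normB \<omega> s = real (Suc k) * (pi * normB \<omega> s / z)" for k by simp
    show ?thesis
      unfolding g_def abel_def c_def sincn_def \<phi>_def e
      by (cases "maxpath 0 s (normB \<omega>) < z") (simp_all only: if_True if_False mult_zero_right suminf_zero)
  qed
  have swap: "(\<integral>\<omega>. (\<Sum>k. c n k * g k \<omega>) \<partial>N) = (\<Sum>k. c n k * exp (- (real (Suc k))\<^sup>2 * a))" for n
  proof -
    have "(\<integral>\<omega>. (\<Sum>k. c n k * g k \<omega>) \<partial>N) = (\<Sum>k. \<integral>\<omega>. c n k * g k \<omega> \<partial>N)"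
    proof (rule integral_suminf)
      show "AE \<omega> in N. summable (\<lambda>k. norm (c n k * g k \<omega>))"
        by (intro AE_I2 summable_comparison_test'[OF csum[of n]]) (use cg in simp)
      show "summable (\<lambda>k. \<integral>\<omega>. norm (c n k * g k \<omega>) \<partial>N)"
      proof (rule summable_comparison_test'[OF csum[of n]])
        fix k
        have "(\<integral>\<omega>. norm (c n k * g k \<omega>) \<partial>N) \<le> (\<integral>\<omega>. 2 * q n ^ Suc k \<partial>N)"
          by (rule integral_mono) (use cg cgi in \<open>auto intro!: integrable_abs\<close>)
        then show "norm (\<integral>\<omega>. norm (c n k * g k \<omega>) \<partial>N) \<le> 2 * q n ^ Suc k"
          by (simp add: prob_space)
      qed
    qed (rule cgi)
    then show ?thesis by (simp add: gi)
  qed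
  have "(\<lambda>n. \<integral>\<omega>. (\<Sum>k. c n k * g k \<omega>) \<partial>N) \<longlonglongrightarrow> (\<integral>\<omega>. indicator {\<omega>. maxpath 0 s (normB \<omega>) < z} \<omega> \<partial>N)"
  proof (rule integral_dominated_convergence[where w = "\<lambda>_. 1"])
    show "AE \<omega> in N. (\<lambda>n. \<Sum>k. c n k * g k \<omega>) \<longlonglongrightarrow> indicator {\<omega>. maxpath 0 s (normB \<omega>) < z} \<omega>"
    proof (rule AE_I2)
      fix \<omega> assume "\<omega> \<in> space N"
      then show "(\<lambda>n. \<Sum>k. c n k * g k \<omega>) \<longlonglongrightarrow> indicator {\<omega>. maxpath 0 s (normB \<omega>) < z} \<omega>"
        unfolding F using filterlim_compose[OF abel_tendsto_1[OF \<phi>] qlim] by (auto simp: indicator_def)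
    qed
    show "AE \<omega> in N. norm (\<Sum>k. c n k * g k \<omega>) \<le> 1" for n
      unfolding F using abs_abel_le_1[OF q \<phi>] by (intro AE_I2) auto
  qed auto
  moreover have "(\<lambda>n. \<Sum>k. c n k * exp (- (real (Suc k))\<^sup>2 * a)) \<longlonglongrightarrow> (\<Sum>k. 2 * (-1) ^ k * exp (- (real (Suc k))\<^sup>2 * a))"
    unfolding c_def by (rule filterlim_compose[OF damped_sum_tendsto(1)[OF a] qlim])
  ultimately have "(\<integral>\<omega>. indicator {\<omega>. maxpath 0 s (normB \<omega>) < z} \<omega> \<partial>N) = (\<Sum>k. 2 * (-1) ^ k * exp (- (real (Suc k))\<^sup>2 * a))"
    unfolding swap by (rule LIMSEQ_unique)
  moreover have "(\<integral>\<omega>. indicator {\<omega>. maxpath 0 s (normB \<omega>) < z} \<omega> \<partial>N) = prob {\<omega>\<in>space N. maxpath 0 s (normB \<omega>) < z}"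
    by (subst Bochner_Integration.integral_cong[OF refl, of N _ "indicator {\<omega>\<in>space N. maxpath 0 s (normB \<omega>) < z}"])
       (auto simp: indicator_def)
  ultimately show ?thesis by (simp add: a_def)
qed

end

section \<open>The dyadic cells\<close>

definition dyad :: "real \<Rightarrow> int \<Rightarrow> real" where
  "dyad \<theta> j = 2 powr (of_int j + \<theta>)"

lemma dyad_pos [simp]: "dyad \<theta> j > 0" by (simp add: dyad_def)

lemma dyad_neq_0 [simp]: "dyad \<theta> j \<noteq> 0" by (simp add: dyad_def)

lemma dyad_nonneg [simp]: "dyad \<theta> j \<ge> 0" by (simp add: dyad_def)

lemma dyad_plus_1: "dyad \<theta> (j + 1) = 2 * dyad \<theta> j"
  by (simp add: dyad_def powr_add)

lemma dyad_minus_1: "dyad \<theta> (j - 1) = dyad \<theta> j / 2"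
  using dyad_plus_1[of \<theta> "j - 1"] by simp

lemma dyad_minus_nat: "dyad \<theta> (j - int n) = dyad \<theta> j * (1 / 2) ^ n"
proof (induction n)
  case (Suc n)
  have e: "j - int (Suc n) = (j - int n) - 1" by simp
  show ?case unfolding e dyad_minus_1 Suc by simp
qed simp

lemma dyad_mono: "i \<le> j \<Longrightarrow> dyad \<theta> i \<le> dyad \<theta> j"
  by (simp add: dyad_def)

lemma dyad_powr_minus_1: "2 powr (of_int j + \<theta> - 1) = dyad \<theta> j / 2"
  by (simp add: dyad_def powr_diff)

lemma dyad_powr_plus_1: "2 powr (of_int j + \<theta> + 1) = 2 * dyad \<theta> j"
  by (simp add: dyad_def powr_add)

lemma dyad_small: "c > 0 \<Longrightarrow> \<exists>n. dyad \<theta> (j - int n) < c"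
  using real_arch_pow_inv[of "c / dyad \<theta> j" "1 / 2"]
  by (auto simp: dyad_minus_nat pos_less_divide_eq mult.commute)

lemma dyad_bracket:
  assumes "m > 0"
  obtains i where "dyad \<theta> (i - 1) \<le> m" "m < dyad \<theta> i"
proof -
  define i where "i = \<lfloor>log 2 m - \<theta>\<rfloor> + 1"
  have "of_int (i - 1) \<le> log 2 m - \<theta>" "log 2 m - \<theta> < of_int i" unfolding i_def by linarith+
  then have "of_int (i - 1) + \<theta> \<le> log 2 m" "log 2 m < of_int i + \<theta>" by linarith+
  then show ?thesis
    using that[of i] assms unfolding dyad_def by (simp add: le_log_iff log_less_iff)
qed

text \<open>Used with two sign sequences: for \<open>w\<close> it is the shift of the lattice at
  scale \<open>j\<close>, for \<open>dyadic_G w \<theta> \<alpha>\<close> the displacement of the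
  particle when the radial process first reaches \<open>dyad \<theta> j / 2\<close>.\<close>

definition sgn_sum :: "(int \<Rightarrow> real) \<Rightarrow> real \<Rightarrow> int \<Rightarrow> real" where
  "sgn_sum b \<theta> j = (\<Sum>\<^sub>\<infinity>k\<in>{..j - 1}. b k * 2 powr (of_int k + \<theta> - 1))"

lemma has_sum_dyad: "((\<lambda>k. 2 powr (of_int k + \<theta> - 1)) has_sum (dyad \<theta> j / 2)) {..j - 1}"
proof -
  have "(\<lambda>n. dyad \<theta> j / 4 * (1 / 2) ^ n) sums (dyad \<theta> j / 4 * (1 / (1 - 1 / 2)))"
    by (intro sums_mult geometric_sums) simp
  then have "((\<lambda>n. dyad \<theta> j / 4 * (1 / 2) ^ n) has_sum (dyad \<theta> j / 2)) UNIV"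
    by (intro sums_nonneg_imp_has_sum) simp_all
  moreover have "bij_betw (\<lambda>n. j - 1 - int n) UNIV {..j - 1}"
    by (rule bij_betwI[where g = "\<lambda>k. nat (j - 1 - k)"]) auto
  moreover have "2 powr (of_int (j - 1 - int n) + \<theta> - 1) = dyad \<theta> j / 4 * (1 / 2) ^ n" for n
    using dyad_minus_nat[of \<theta> "j - 1" n] dyad_powr_minus_1[of "j - 1 - int n" \<theta>] by (simp add: dyad_minus_1)
  ultimately show ?thesis
    using has_sum_reindex_bij_betw[of "\<lambda>n. j - 1 - int n" UNIV "{..j - 1}" "\<lambda>k. 2 powr (of_int k + \<theta> - 1)"] by (simp only:)
qed

context
  fixes b :: "int \<Rightarrow> real" and \<theta> :: real
  assumes b: "\<And>k. \<bar>b k\<bar> \<le> 1"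
begin

lemma sgn_sum_abs_summable: "(\<lambda>k. norm (b k * 2 powr (of_int k + \<theta> - 1))) summable_on {..j - 1}"
proof (rule Infinite_Sum.abs_summable_on_comparison_test)
  show "(\<lambda>k. norm (2 powr (of_int k + \<theta> - 1))) summable_on {..j - 1}"
    using has_sum_dyad[of \<theta> j] by (simp add: has_sum_imp_summable)
qed (use b in \<open>simp add: abs_mult mult_left_le_one_le\<close>)

lemma sgn_sum_bound: "\<bar>sgn_sum b \<theta> j\<bar> \<le> dyad \<theta> j / 2"
proof -
  have "\<bar>sgn_sum b \<theta> j\<bar> \<le> (\<Sum>\<^sub>\<infinity>k\<in>{..j - 1}. norm (b k * 2 powr (of_int k + \<theta> - 1)))"
    unfolding sgn_sum_def using norm_infsum_bound[OF sgn_sum_abs_summable] by simp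
  also have "\<dots> \<le> (\<Sum>\<^sub>\<infinity>k\<in>{..j - 1}. 2 powr (of_int k + \<theta> - 1))"
    by (rule infsum_mono[OF sgn_sum_abs_summable has_sum_imp_summable[OF has_sum_dyad]])
       (use b in \<open>simp add: abs_mult mult_left_le_one_le\<close>)
  also have "\<dots> = dyad \<theta> j / 2" using has_sum_dyad by (rule infsumI)
  finally show ?thesis .
qed

lemma sgn_sum_Suc: "sgn_sum b \<theta> (j + 1) = sgn_sum b \<theta> j + b j * (dyad \<theta> j / 2)"
proof -
  have "{..j + 1 - 1} = insert j {..j - 1}" by auto
  then show ?thesis
    unfolding sgn_sum_def using infsum_insert[OF abs_summable_summable[OF sgn_sum_abs_summable[of j]], of j]
    by (simp add: dyad_powr_minus_1)
qed

end

text \<open>Rounding to the nearest integer: the index of the point nearest to \<alpha> in the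
  lattice \<open>sgn_sum w \<theta> j + dyad \<theta> j * n\<close>, ties going up.\<close>

definition cell :: "(int \<Rightarrow> real) \<Rightarrow> real \<Rightarrow> real \<Rightarrow> int \<Rightarrow> int" where
  "cell w \<theta> \<alpha> j = \<lfloor>(\<alpha> - sgn_sum w \<theta> j) / dyad \<theta> j + 1 / 2\<rfloor>"

text \<open>In units of the mesh the modulus is 2, and a remainder in [0, 1) means that the integer
  part is even. So the direction depends on \<alpha> only through the parity of its cell.\<close>

lemma dyadic_G_eq: "dyadic_G w \<theta> \<alpha> j = (if even (cell w \<theta> \<alpha> j) then w j else - w j)"
proof -
  define L where "L = dyad \<theta> j"
  define x where "x = (\<alpha> - sgn_sum w \<theta> j) / L + 1 / 2"
  have L: "L > 0" by (simp add: L_def)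
  have e: "\<alpha> - sgn_sum w \<theta> j + L / 2 = L * x" using L by (simp add: x_def field_simps)
  have "L * x rmod (2 * L) = L * (x - 2 * of_int \<lfloor>x / 2\<rfloor>)"
    using L by (simp add: rmod_def algebra_simps)
  then have "(L * x rmod (2 * L) \<in> {0..<L}) \<longleftrightarrow> 0 \<le> x - 2 * of_int \<lfloor>x / 2\<rfloor> \<and> x - 2 * of_int \<lfloor>x / 2\<rfloor> < 1"
    using L by (simp add: zero_le_mult_iff)
  also have "\<dots> \<longleftrightarrow> \<lfloor>x\<rfloor> = 2 * \<lfloor>x / 2\<rfloor>" by (simp add: floor_eq_iff) linarith
  also have "\<dots> \<longleftrightarrow> even \<lfloor>x\<rfloor>"
  proof
    assume "even \<lfloor>x\<rfloor>"
    then obtain m where "\<lfloor>x\<rfloor> = 2 * m" by blast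
    moreover have "\<lfloor>x / 2\<rfloor> = m" using calculation by (simp add: floor_eq_iff)
    ultimately show "\<lfloor>x\<rfloor> = 2 * \<lfloor>x / 2\<rfloor>" by simp
  qed (metis dvd_triv_left)
  finally show ?thesis
    unfolding dyadic_G_def sgn_sum_def[symmetric]
    unfolding dyad_powr_minus_1 dyad_powr_plus_1 dyad_def[symmetric]
    unfolding cell_def L_def[symmetric] x_def[symmetric] e by simp
qed

definition landing :: "(int \<Rightarrow> real) \<Rightarrow> real \<Rightarrow> int \<Rightarrow> real \<Rightarrow> real" where
  "landing w \<theta> j \<alpha> = \<alpha> + sgn_sum (dyadic_G w \<theta> \<alpha>) \<theta> j"

text \<open>The position while the index is \<open>j\<close>, with \<open>d\<close> standing for
  \<open>y t - dyad \<theta> j / 2\<close>. Keeping \<open>d\<close> free separates the lattice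
  geometry from the path.\<close>

definition shifted :: "(int \<Rightarrow> real) \<Rightarrow> real \<Rightarrow> int \<Rightarrow> real \<Rightarrow> real \<Rightarrow> real" where
  "shifted w \<theta> j d \<alpha> = landing w \<theta> j \<alpha> + d * dyadic_G w \<theta> \<alpha> j"

context
  fixes w :: "int \<Rightarrow> real" and \<theta> :: real
  assumes w: "\<And>k. w k \<in> {1, -1}"
begin

lemma abs_w_le: "\<bar>w k\<bar> \<le> 1" using w[of k] by auto

lemma abs_G_le: "\<bar>dyadic_G w \<theta> \<alpha> k\<bar> \<le> 1" using w[of k] by (auto simp: dyadic_G_eq)

lemma landing_Suc: "landing w \<theta> (j + 1) \<alpha> = landing w \<theta> j \<alpha> + dyadic_G w \<theta> \<alpha> j * (dyad \<theta> j / 2)"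
  unfolding landing_def sgn_sum_Suc[of "dyadic_G w \<theta> \<alpha>", OF abs_G_le] by simp

text \<open>Even cells move by \<open>w j\<close>, odd ones the opposite way, each by half a mesh,
  so lattice points meet in pairs: \<open>2 * n\<close> with \<open>2 * n + 1\<close> if
  \<open>w j = 1\<close>, and \<open>2 * n - 1\<close> with \<open>2 * n\<close> if
  \<open>w j = - 1\<close>. The meeting points form the lattice of scale \<open>j + 1\<close>, and
  rounding \<alpha> to that lattice selects the point reached.\<close>

lemma cell_Suc:
  "sgn_sum w \<theta> (j + 1) + dyad \<theta> (j + 1) * of_int (cell w \<theta> \<alpha> (j + 1))
     = sgn_sum w \<theta> j + dyad \<theta> j * of_int (cell w \<theta> \<alpha> j) + dyadic_G w \<theta> \<alpha> j * (dyad \<theta> j / 2)"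
proof -
  define L where "L = dyad \<theta> j"
  define x where "x = (\<alpha> - sgn_sum w \<theta> j) / L + 1 / 2"
  have L: "L > 0" by (simp add: L_def)
  have m: "cell w \<theta> \<alpha> j = \<lfloor>x\<rfloor>" by (simp add: cell_def x_def L_def)
  have "(\<alpha> - (sgn_sum w \<theta> j + w j * (L / 2))) / (2 * L) + 1 / 2 = (x + 1 / 2 - w j / 2) / 2"
    using L by (simp add: x_def field_simps)
  then have m': "cell w \<theta> \<alpha> (j + 1) = \<lfloor>(x + 1 / 2 - w j / 2) / 2\<rfloor>"
    unfolding cell_def sgn_sum_Suc[of w, OF abs_w_le] dyad_plus_1 L_def by (simp only: mult.commute)
  obtain n where "\<lfloor>x\<rfloor> = 2 * n \<or> \<lfloor>x\<rfloor> = 2 * n + 1" by (metis evenE oddE)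
  then have n: "(\<lfloor>x\<rfloor> = 2 * n \<and> 2 * of_int n \<le> x \<and> x < 2 * of_int n + 1) \<or>
     (\<lfloor>x\<rfloor> = 2 * n + 1 \<and> 2 * of_int n + 1 \<le> x \<and> x < 2 * of_int n + 2)"
    using floor_eq_iff[of x "2 * n"] floor_eq_iff[of x "2 * n + 1"] by auto
  consider "w j = 1" | "w j = - 1" using w[of j] by auto
  then show ?thesis
  proof cases
    case 1
    have "\<lfloor>x / 2\<rfloor> = n" using n by (auto simp: floor_eq_iff)
    then show ?thesis
      using n 1 unfolding sgn_sum_Suc[of w, OF abs_w_le] dyad_plus_1 dyadic_G_eq m m'
      by (auto simp: L_def algebra_simps)
  next
    case 2
    have "\<lfloor>(x + 1) / 2\<rfloor> = (if even \<lfloor>x\<rfloor> then n else n + 1)"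
    proof (rule disjE[OF n])
      assume a: "\<lfloor>x\<rfloor> = 2 * n \<and> 2 * of_int n \<le> x \<and> x < 2 * of_int n + 1"
      then have "\<lfloor>(x + 1) / 2\<rfloor> = n" by (auto simp: floor_eq_iff)
      moreover have "even \<lfloor>x\<rfloor>" using a by (metis dvd_triv_left)
      ultimately show ?thesis by simp
    next
      assume a: "\<lfloor>x\<rfloor> = 2 * n + 1 \<and> 2 * of_int n + 1 \<le> x \<and> x < 2 * of_int n + 2"
      then have "\<lfloor>(x + 1) / 2\<rfloor> = n + 1" by (auto simp: floor_eq_iff)
      moreover have "odd \<lfloor>x\<rfloor>" using a by (metis odd_two_times_div_two_succ even_mult_iff even_plus_one_iff dvd_triv_left)
      ultimately show ?thesis by simp
    qed
    then show ?thesis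
      using n 2 unfolding sgn_sum_Suc[of w, OF abs_w_le] dyad_plus_1 dyadic_G_eq m m'
      by (auto simp: L_def algebra_simps)
  qed
qed

text \<open>Both sides obey the same recursion in \<open>j\<close>, so their difference does not
  depend on the scale. At scale \<open>i\<close> both lie within \<open>dyad \<theta> i / 2\<close>
  of \<alpha>, and \<open>dyad \<theta> i\<close> becomes arbitrarily small as \<open>i\<close>
  decreases.\<close>

lemma landing_eq: "landing w \<theta> j \<alpha> = sgn_sum w \<theta> j + dyad \<theta> j * of_int (cell w \<theta> \<alpha> j)"
proof -
  define N where "N j = sgn_sum w \<theta> j + dyad \<theta> j * of_int (cell w \<theta> \<alpha> j)" for j
  have step: "landing w \<theta> (j + 1) \<alpha> - N (j + 1) = landing w \<theta> j \<alpha> - N j" for j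
    unfolding N_def cell_Suc landing_Suc by simp
  have const: "landing w \<theta> j \<alpha> - N j = landing w \<theta> (j - int n) \<alpha> - N (j - int n)" for n
  proof (induction n)
    case (Suc n)
    have "j - int n = j - int (Suc n) + 1" by simp
    then show ?case using Suc step[of "j - int (Suc n)"] by simp
  qed simp
  have close: "\<bar>landing w \<theta> i \<alpha> - N i\<bar> \<le> dyad \<theta> i" for i
  proof -
    define x where "x = (\<alpha> - sgn_sum w \<theta> i) / dyad \<theta> i + 1 / 2"
    have "\<bar>x - 1 / 2 - of_int \<lfloor>x\<rfloor>\<bar> \<le> 1 / 2" by linarith
    then have "dyad \<theta> i * \<bar>x - 1 / 2 - of_int \<lfloor>x\<rfloor>\<bar> \<le> dyad \<theta> i * (1 / 2)"
      by (intro mult_left_mono) auto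
    also have "dyad \<theta> i * \<bar>x - 1 / 2 - of_int \<lfloor>x\<rfloor>\<bar> = \<bar>dyad \<theta> i * (x - 1 / 2 - of_int \<lfloor>x\<rfloor>)\<bar>"
      by (simp add: abs_mult)
    also have "dyad \<theta> i * (x - 1 / 2 - of_int \<lfloor>x\<rfloor>) = \<alpha> - N i"
      using dyad_pos[of \<theta> i] by (simp add: x_def N_def cell_def right_diff_distrib diff_divide_distrib)
    finally show ?thesis
      using sgn_sum_bound[of "dyadic_G w \<theta> \<alpha>" \<theta> i, OF abs_G_le] unfolding landing_def by linarith
  qed
  have "landing w \<theta> j \<alpha> - N j = 0"
  proof (rule ccontr)
    assume "landing w \<theta> j \<alpha> - N j \<noteq> 0"
    then obtain n where "dyad \<theta> (j - int n) < \<bar>landing w \<theta> j \<alpha> - N j\<bar>"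
      using dyad_small[of "\<bar>landing w \<theta> j \<alpha> - N j\<bar>"] by auto
    then show False using close[of "j - int n"] const[of n] by simp
  qed
  then show ?thesis by (simp add: N_def)
qed

lemma cell_mono: "\<alpha> \<le> \<beta> \<Longrightarrow> cell w \<theta> \<alpha> j \<le> cell w \<theta> \<beta> j"
  unfolding cell_def by (intro floor_mono add_right_mono divide_right_mono) auto

text \<open>Landing points of distinct cells are at least one mesh apart, and each particle then
  moves by at most \<open>\<bar>d\<bar>\<close>. For
  \<open>\<bar>d\<bar> \<le> dyad \<theta> j / 2\<close> the order is kept, and below that bound the
  positions stay distinct.\<close>

lemma shifted_cell_less:
  assumes "cell w \<theta> \<alpha> j < cell w \<theta> \<beta> j"
  shows "shifted w \<theta> j d \<beta> - shifted w \<theta> j d \<alpha> \<ge> dyad \<theta> j - 2 * \<bar>d\<bar>"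
proof -
  have "of_int (cell w \<theta> \<alpha> j) + 1 \<le> (of_int (cell w \<theta> \<beta> j) :: real)" using assms by linarith
  then have "dyad \<theta> j * (of_int (cell w \<theta> \<alpha> j) + 1) \<le> dyad \<theta> j * of_int (cell w \<theta> \<beta> j)"
    by (intro mult_left_mono) auto
  moreover have "\<bar>d * dyadic_G w \<theta> \<gamma> j\<bar> \<le> \<bar>d\<bar>" for \<gamma>
    unfolding abs_mult by (intro mult_left_le abs_G_le) auto
  from this[of \<alpha>] this[of \<beta>]
  have "d * dyadic_G w \<theta> \<alpha> j \<le> \<bar>d\<bar>" "d * dyadic_G w \<theta> \<beta> j \<ge> - \<bar>d\<bar>" by linarith+
  ultimately show ?thesis unfolding shifted_def landing_eq by (simp add: algebra_simps)
qed

lemma shifted_cell_eq: "cell w \<theta> \<alpha> j = cell w \<theta> \<beta> j \<Longrightarrow> shifted w \<theta> j d \<alpha> = shifted w \<theta> j d \<beta>"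
  by (simp add: shifted_def landing_eq dyadic_G_eq)

lemma shifted_mono: "\<alpha> \<le> \<beta> \<Longrightarrow> \<bar>d\<bar> \<le> dyad \<theta> j / 2 \<Longrightarrow> shifted w \<theta> j d \<alpha> \<le> shifted w \<theta> j d \<beta>"
  using shifted_cell_less[of \<alpha> j \<beta> d] shifted_cell_eq[of \<alpha> j \<beta> d] cell_mono[of \<alpha> \<beta> j] by (cases "cell w \<theta> \<alpha> j = cell w \<theta> \<beta> j") auto

lemma shifted_neq: "\<alpha> \<le> \<beta> \<Longrightarrow> cell w \<theta> \<alpha> j \<noteq> cell w \<theta> \<beta> j \<Longrightarrow> \<bar>d\<bar> < dyad \<theta> j / 2 \<Longrightarrow> shifted w \<theta> j d \<alpha> \<noteq> shifted w \<theta> j d \<beta>"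
  using shifted_cell_less[of \<alpha> j \<beta> d] cell_mono[of \<alpha> \<beta> j] by auto

lemma cell_eq_iff_landing: "cell w \<theta> \<alpha> j = cell w \<theta> \<beta> j \<longleftrightarrow> landing w \<theta> j \<alpha> = landing w \<theta> j \<beta>"
  using dyad_pos[of \<theta> j] by (simp add: landing_eq)

text \<open>Particles in the same cell have the same landing point and the same direction, so they
  share the next landing point too.\<close>

lemma cell_eq_up:
  assumes "cell w \<theta> \<alpha> i = cell w \<theta> \<beta> i" "i \<le> k"
  shows "cell w \<theta> \<alpha> k = cell w \<theta> \<beta> k"
  using assms(2)
proof (induction k rule: int_ge_induct)
  case (step k)
  then show ?case
    using cell_eq_iff_landing[of \<alpha> "k + 1" \<beta>] landing_Suc cell_eq_iff_landing[of \<alpha> k \<beta>] by (simp add: dyadic_G_eq)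
qed (use assms in simp)

lemma cell_neq_small:
  assumes "\<alpha> < \<beta>" "dyad \<theta> j < \<beta> - \<alpha>"
  shows "cell w \<theta> \<alpha> j \<noteq> cell w \<theta> \<beta> j"
proof -
  have "(\<beta> - sgn_sum w \<theta> j) / dyad \<theta> j + 1 / 2 - ((\<alpha> - sgn_sum w \<theta> j) / dyad \<theta> j + 1 / 2) = (\<beta> - \<alpha>) / dyad \<theta> j"
    by (simp add: diff_divide_distrib)
  also have "\<dots> > 1" using assms by simp
  finally show ?thesis unfolding cell_def by linarith
qed

end

section \<open>The coupled paths\<close>

locale dyadic_path =
  fixes y :: "real \<Rightarrow> real" and w :: "int \<Rightarrow> real" and \<theta> :: real
  assumes y_cont: "continuous_on {0..} y" and y_0: "y 0 = 0" and y_nonneg: "\<And>t. t \<ge> 0 \<Longrightarrow> y t \<ge> 0"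
    and w: "\<And>k. w k \<in> {1, -1}"
begin

lemma y_cont_on: "a \<ge> 0 \<Longrightarrow> continuous_on {a..b} y"
  using y_cont by (rule continuous_on_subset) auto

lemma y_passage:
  assumes "0 \<le> a" "a \<le> b" "y a \<le> z" "z \<le> y b"
  obtains v where "v \<in> {a..b}" "y v = z" "\<And>u. a \<le> u \<Longrightarrow> u < v \<Longrightarrow> y u < z"
  using first_passage[OF y_cont_on[OF assms(1)] assms(2-4)] by blast

lemma y_hits:
  assumes "0 \<le> t" "0 \<le> z" "z \<le> y t"
  obtains v where "v \<in> {0..t}" "y v = z"
proof -
  have "y 0 \<le> z" using assms y_0 by simp
  then show ?thesis by (rule y_passage[OF order.refl assms(1) _ assms(3)], intro that)
qed

text \<open>As \<open>y\<close> starts at 0, reaching at least a level before \<open>t\<close> is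
  the same as hitting it exactly, by the intermediate value theorem. This replaces the infimum of
  hitting times by a condition on the path.\<close>

lemma dyadic_T_less_iff: "dyadic_T y \<theta> k < ereal t \<longleftrightarrow> (\<exists>u. 0 \<le> u \<and> u < t \<and> dyad \<theta> k \<le> y u)"
proof
  assume "dyadic_T y \<theta> k < ereal t"
  then obtain u where "0 \<le> u" "y u = 2 powr (of_int k + \<theta>)" "ereal u < ereal t"
    unfolding dyadic_T_def INF_less_iff by blast
  then show "\<exists>u. 0 \<le> u \<and> u < t \<and> dyad \<theta> k \<le> y u"
    by (intro exI[of _ u]) (simp add: dyad_def)
next
  assume "\<exists>u. 0 \<le> u \<and> u < t \<and> dyad \<theta> k \<le> y u"
  then obtain u where u: "0 \<le> u" "u < t" "dyad \<theta> k \<le> y u" by blast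
  then obtain v where "v \<in> {0..u}" "y v = dyad \<theta> k"
    using y_hits[OF u(1) dyad_nonneg u(3)] by blast
  then show "dyadic_T y \<theta> k < ereal t"
    using u unfolding dyadic_T_def INF_less_iff dyad_def by (intro bexI[of _ v]) simp_all
qed

text \<open>
  The junk value of the index in \<open>dyadic_X\<close> as long as \<open>y\<close> has not left \<open>0\<close>.
\<close>

definition no_index :: int where "no_index = (THE i. False)"

lemma X_left:
  assumes t: "t > 0" and "0 \<le> u" "u < t" "dyad \<theta> (i - 1) \<le> y u" and lt: "\<And>u. 0 \<le> u \<Longrightarrow> u < t \<Longrightarrow> y u < dyad \<theta> i"
  shows "dyadic_X y w \<theta> \<gamma> t = shifted w \<theta> i (y t - dyad \<theta> i / 2) \<gamma>"
proof -
  have "(THE i. dyadic_T y \<theta> (i - 1) < ereal t \<and> ereal t \<le> dyadic_T y \<theta> i) = i"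
  proof (rule the_equality)
    show "dyadic_T y \<theta> (i - 1) < ereal t \<and> ereal t \<le> dyadic_T y \<theta> i"
      using assms unfolding not_less[symmetric] dyadic_T_less_iff by auto
    fix j assume j: "dyadic_T y \<theta> (j - 1) < ereal t \<and> ereal t \<le> dyadic_T y \<theta> j"
    then obtain v where v: "0 \<le> v" "v < t" "dyad \<theta> (j - 1) \<le> y v"
      unfolding dyadic_T_less_iff by blast
    have lt': "y u < dyad \<theta> j" if "0 \<le> u" "u < t" for u
      using j that unfolding not_less[symmetric] dyadic_T_less_iff by force
    have "j - 1 < i" using v lt[of v] dyad_mono[of i "j - 1" \<theta>] by force
    moreover have "i - 1 < j" using assms(2-4) lt'[of u] dyad_mono[of j "i - 1" \<theta>] by force
    ultimately show "j = i" by simp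
  qed
  then show ?thesis
    using t unfolding dyadic_X_def shifted_def landing_def sgn_sum_def
    by (simp add: dyad_powr_minus_1)
qed

text \<open>
  The index of \<open>dyadic_X\<close> is left-continuous in time, the one used here is right-continuous; they disagree
  only at the hitting times, where both give the same position.
\<close>

lemma X_index:
  assumes t: "t > 0" and u: "u \<in> {0..t}" "dyad \<theta> (i - 1) \<le> y u" and lt: "\<And>u. u \<in> {0..t} \<Longrightarrow> y u < dyad \<theta> i"
  shows "dyadic_X y w \<theta> \<gamma> t = shifted w \<theta> i (y t - dyad \<theta> i / 2) \<gamma>"
proof (cases "\<exists>u\<in>{0..<t}. dyad \<theta> (i - 1) \<le> y u")
  case True
  then obtain u where "0 \<le> u" "u < t" "dyad \<theta> (i - 1) \<le> y u" by auto
  then show ?thesis by (rule X_left[OF t]) (use lt in auto)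
next
  case False
  then have lt': "y u < dyad \<theta> (i - 1)" if "0 \<le> u" "u < t" for u using that by force
  have ge: "dyad \<theta> (i - 1) \<le> y t"
  proof (rule ccontr)
    assume "\<not> dyad \<theta> (i - 1) \<le> y t"
    then have "u \<noteq> t" using u(2) by blast
    then show False using lt'[of u] u by auto
  qed
  have yt: "y t = dyad \<theta> (i - 1)"
  proof -
    obtain v where "v \<in> {0..t}" "y v = dyad \<theta> (i - 1)"
      using y_hits[OF less_imp_le[OF t] dyad_nonneg ge] by blast
    then show ?thesis using lt'[of v] by (cases "v = t") auto
  qed
  obtain v where v: "v \<in> {0..t}" "y v = dyad \<theta> (i - 1 - 1)"
    by (rule y_hits[OF less_imp_le[OF t], of "dyad \<theta> (i - 1 - 1)"]) (simp_all add: yt dyad_mono)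
  then have "v \<noteq> t" using yt dyad_minus_1[of \<theta> "i - 1"] by force
  then have "dyadic_X y w \<theta> \<gamma> t = shifted w \<theta> (i - 1) (y t - dyad \<theta> (i - 1) / 2) \<gamma>"
    using v lt' by (intro X_left[OF t, of v]) auto
  \<comment> \<open>At the hitting time the step of index \<open>i - 1\<close> is complete, while
    that of index \<open>i\<close> has displacement 0.\<close>
  also have "\<dots> = shifted w \<theta> i (y t - dyad \<theta> i / 2) \<gamma>"
    using landing_Suc[of w \<theta> "i - 1" \<gamma>, OF w] by (simp add: shifted_def yt dyad_minus_1)
  finally show ?thesis .
qed

lemma X_no_index:
  assumes t: "t > 0" and "\<And>u. u \<in> {0..t} \<Longrightarrow> y u = 0"
  shows "dyadic_X y w \<theta> \<gamma> t = shifted w \<theta> no_index (y t - dyad \<theta> no_index / 2) \<gamma>"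
proof -
  have "\<not> dyadic_T y \<theta> k < ereal t" for k
    unfolding dyadic_T_less_iff using assms(2) dyad_pos[of \<theta> k]
    by (metis atLeastAtMost_iff less_imp_le not_less)
  \<comment> \<open>The defining condition fails for every integer, so the description is the very
    term \<open>no_index\<close>.\<close>
  then have "(THE i. dyadic_T y \<theta> (i - 1) < ereal t \<and> ereal t \<le> dyadic_T y \<theta> i) = no_index"
    unfolding no_index_def by simp
  then show ?thesis
    using t unfolding dyadic_X_def shifted_def landing_def sgn_sum_def
    by (simp add: dyad_powr_minus_1)
qed

lemma index_exists:
  assumes "t \<ge> 0" "v \<in> {0..t}" "y v > 0"
  obtains i u where "u \<in> {0..t}" "dyad \<theta> (i - 1) \<le> y u" "\<And>u. u \<in> {0..t} \<Longrightarrow> y u < dyad \<theta> i"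
proof -
  obtain u where u: "u \<in> {0..t}" "\<And>v. v \<in> {0..t} \<Longrightarrow> y v \<le> y u"
    using continuous_attains_sup[of "{0..t}" y] y_cont_on[of 0 t] assms by auto
  then have "y u > 0" using assms by force
  then obtain i where "dyad \<theta> (i - 1) \<le> y u" "y u < dyad \<theta> i" by (rule dyad_bracket)
  then show ?thesis using u by (intro that[of u i]) (auto intro: le_less_trans)
qed

lemma index_cases:
  assumes "t > 0"
  obtains (index) i u where "u \<in> {0..t}" "dyad \<theta> (i - 1) \<le> y u" "\<And>u. u \<in> {0..t} \<Longrightarrow> y u < dyad \<theta> i"
  | (none) "\<And>u. u \<in> {0..t} \<Longrightarrow> y u = 0"
proof (cases "\<exists>v\<in>{0..t}. y v > 0")
  case True
  then obtain v where v: "v \<in> {0..t}" "y v > 0" by blast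
  show ?thesis by (rule index_exists[OF less_imp_le[OF assms] v]) (rule index)
next
  case False
  show ?thesis
  proof (rule none)
    fix u assume "u \<in> {0..t}"
    then show "y u = 0" using False y_nonneg[of u] by force
  qed
qed

text \<open>The index is common to all starting points, and
  \<open>0 \<le> y t \<le> dyad \<theta> i\<close> gives the bound on the displacement required by
  \<open>shifted_mono\<close>. Paths that have not left 0 are covered by
  \<open>no_index\<close>.\<close>

lemma X_mono:
  assumes t: "t \<ge> 0" and le: "\<alpha> \<le> \<beta>"
  shows "dyadic_X y w \<theta> \<alpha> t \<le> dyadic_X y w \<theta> \<beta> t"
proof (cases "t = 0")
  case True then show ?thesis using le by (simp add: dyadic_X_def)
next
  case False
  then have t0: "t > 0" using t by simp
  have mono: "shifted w \<theta> i (y t - dyad \<theta> i / 2) \<alpha> \<le> shifted w \<theta> i (y t - dyad \<theta> i / 2) \<beta>" if "y t \<le> dyad \<theta> i" for i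
    proof (rule shifted_mono[OF w le])
    show "\<bar>y t - dyad \<theta> i / 2\<bar> \<le> dyad \<theta> i / 2" using that y_nonneg[OF t] by linarith
  qed
  from t0 show ?thesis
  proof (cases rule: index_cases)
    case (index i u)
    have X: "dyadic_X y w \<theta> \<gamma> t = shifted w \<theta> i (y t - dyad \<theta> i / 2) \<gamma>" for \<gamma>
      by (rule X_index[OF t0 index])
    show ?thesis unfolding X by (rule mono) (use index(3)[of t] t in simp)
  next
    case none
    have X: "dyadic_X y w \<theta> \<gamma> t = shifted w \<theta> no_index (y t - dyad \<theta> no_index / 2) \<gamma>" for \<gamma>
      by (rule X_no_index[OF t0 none])
    show ?thesis unfolding X by (rule mono) (use none[of t] t in simp)
  qed
qed

lemma X_differ_iff:
  assumes le: "\<alpha> \<le> \<beta>" and t: "t \<ge> 0"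
  shows "(\<exists>\<gamma>1\<in>{\<alpha>..\<beta>}. \<exists>\<gamma>2\<in>{\<alpha>..\<beta>}. dyadic_X y w \<theta> \<gamma>1 t \<noteq> dyadic_X y w \<theta> \<gamma>2 t)
    \<longleftrightarrow> dyadic_X y w \<theta> \<alpha> t \<noteq> dyadic_X y w \<theta> \<beta> t"
proof
  assume "\<exists>\<gamma>1\<in>{\<alpha>..\<beta>}. \<exists>\<gamma>2\<in>{\<alpha>..\<beta>}. dyadic_X y w \<theta> \<gamma>1 t \<noteq> dyadic_X y w \<theta> \<gamma>2 t"
  then obtain \<gamma>1 \<gamma>2 where *: "\<gamma>1 \<in> {\<alpha>..\<beta>}" "\<gamma>2 \<in> {\<alpha>..\<beta>}" "dyadic_X y w \<theta> \<gamma>1 t \<noteq> dyadic_X y w \<theta> \<gamma>2 t" by blast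
  then show "dyadic_X y w \<theta> \<alpha> t \<noteq> dyadic_X y w \<theta> \<beta> t"
    using X_mono[OF t, of \<alpha> \<gamma>1] X_mono[OF t, of \<gamma>1 \<beta>] X_mono[OF t, of \<alpha> \<gamma>2] X_mono[OF t, of \<gamma>2 \<beta>] by auto
qed (use le in force)

text \<open>If \<open>y s = 0\<close>, the first passage of a small level after \<open>s\<close>
  does it. The resulting time avoids \<open>y = 0\<close>, where neighbouring particles from
  distinct cells can meet momentarily.\<close>

lemma positive_passage:
  assumes s: "0 \<le> s" and t: "s \<le> t" "0 < y t" and z: "z > 0" "\<And>u. u \<in> {0..s} \<Longrightarrow> y u < z"
  obtains v where "v \<ge> s" "0 < y v" "\<And>u. u \<in> {0..v} \<Longrightarrow> y u < z"
proof (cases "y s > 0")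
  case True
  then show ?thesis using that[of s] z by auto
next
  case False
  then have ys: "y s = 0" using y_nonneg[OF s] by simp
  define c where "c = min (y t) (z / 2)"
  have c: "0 < c" "c \<le> y t" "c < z" using t z by (auto simp: c_def)
  obtain v where v: "v \<in> {s..t}" "y v = c" "\<And>u. s \<le> u \<Longrightarrow> u < v \<Longrightarrow> y u < c"
    by (rule y_passage[of s t c]) (use s t ys c in simp_all)
  show ?thesis
  proof (rule that[of v])
    fix u assume u: "u \<in> {0..v}"
    consider "u \<le> s" | "u = v" | "s \<le> u" "u < v" using u by force
    then show "y u < z" using z(2)[of u] v(2) v(3)[of u] c u by cases auto
  qed (use v c in auto)
qed

text \<open>Distinct cells give distinct positions as long as
  \<open>0 < y t < dyad \<theta> i\<close>, and equal cells stay equal at all larger scales. At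
  \<open>y t = 0\<close> the displacement is \<open>- (dyad \<theta> i / 2)\<close> and particles
  from distinct cells may coincide; the last alternative settles the paths that vanish from
  \<open>s\<close> on.\<close>

lemma event_index:
  assumes s: "s > 0" and le: "\<alpha> \<le> \<beta>"
    and u: "u \<in> {0..s}" "dyad \<theta> (i - 1) \<le> y u" and lt: "\<And>u. u \<in> {0..s} \<Longrightarrow> y u < dyad \<theta> i"
  shows "(\<exists>t\<ge>s. dyadic_X y w \<theta> \<alpha> t \<noteq> dyadic_X y w \<theta> \<beta> t) \<longleftrightarrow>
    cell w \<theta> \<alpha> i \<noteq> cell w \<theta> \<beta> i \<and>
    ((\<exists>t\<ge>s. 0 < y t) \<or> shifted w \<theta> i (- (dyad \<theta> i / 2)) \<alpha> \<noteq> shifted w \<theta> i (- (dyad \<theta> i / 2)) \<beta>)"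
proof
  assume "\<exists>t\<ge>s. dyadic_X y w \<theta> \<alpha> t \<noteq> dyadic_X y w \<theta> \<beta> t"
  then obtain t where t: "s \<le> t" "dyadic_X y w \<theta> \<alpha> t \<noteq> dyadic_X y w \<theta> \<beta> t" by blast
  have t0: "t > 0" using s t by simp
  have yu: "y u > 0" using u dyad_pos[of \<theta> "i - 1"] by linarith
  have t1: "0 \<le> t" "u \<in> {0..t}" using u s t by auto
  obtain k v where k: "v \<in> {0..t}" "dyad \<theta> (k - 1) \<le> y v" "\<And>u. u \<in> {0..t} \<Longrightarrow> y u < dyad \<theta> k"
    by (rule index_exists[OF t1 yu], rule that)
  have "i - 1 < k"
    using k(3)[of u] u t dyad_mono[of k "i - 1" \<theta>] by force
  then have ik: "i \<le> k" by simp
  have X: "dyadic_X y w \<theta> \<gamma> t = shifted w \<theta> k (y t - dyad \<theta> k / 2) \<gamma>" for \<gamma>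
    by (rule X_index[OF t0 k])
  have "cell w \<theta> \<alpha> k \<noteq> cell w \<theta> \<beta> k"
    using t(2) shifted_cell_eq[of w \<theta> \<alpha> k \<beta>] w unfolding X by blast
  then have D: "cell w \<theta> \<alpha> i \<noteq> cell w \<theta> \<beta> i" using cell_eq_up[of w, OF w _ ik] by blast
  moreover have "(\<exists>t\<ge>s. 0 < y t) \<or> shifted w \<theta> i (- (dyad \<theta> i / 2)) \<alpha> \<noteq> shifted w \<theta> i (- (dyad \<theta> i / 2)) \<beta>"
  proof (cases "\<exists>t\<ge>s. 0 < y t")
    case False
    \<comment> \<open>If \<open>y\<close> vanishes from \<open>s\<close> on, its maximum was reached
      by time \<open>s\<close>, so the index at \<open>t\<close> is still \<open>i\<close>.\<close>
    then have z: "y t = 0" if "t \<ge> s" for t using y_nonneg[of t] s that by force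
    have "v \<le> s" using z[of v] k(2) dyad_pos[of \<theta> "k - 1"] by force
    then have "k - 1 < i" using lt[of v] k dyad_mono[of i "k - 1" \<theta>] by force
    then have "k = i" using ik by simp
    then show ?thesis using t(2) z[OF t(1)] unfolding X by simp
  qed blast
  ultimately show "cell w \<theta> \<alpha> i \<noteq> cell w \<theta> \<beta> i \<and>
    ((\<exists>t\<ge>s. 0 < y t) \<or> shifted w \<theta> i (- (dyad \<theta> i / 2)) \<alpha> \<noteq> shifted w \<theta> i (- (dyad \<theta> i / 2)) \<beta>)" by blast
next
  assume D: "cell w \<theta> \<alpha> i \<noteq> cell w \<theta> \<beta> i \<and>
    ((\<exists>t\<ge>s. 0 < y t) \<or> shifted w \<theta> i (- (dyad \<theta> i / 2)) \<alpha> \<noteq> shifted w \<theta> i (- (dyad \<theta> i / 2)) \<beta>)"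
  show "\<exists>t\<ge>s. dyadic_X y w \<theta> \<alpha> t \<noteq> dyadic_X y w \<theta> \<beta> t"
  proof (cases "\<exists>t\<ge>s. 0 < y t")
    case True
    then obtain t where "s \<le> t" "0 < y t" by blast
    have s0: "0 \<le> s" using s by simp
    obtain v where v: "v \<ge> s" "0 < y v" "\<And>u. u \<in> {0..v} \<Longrightarrow> y u < dyad \<theta> i"
      by (rule positive_passage[OF s0 \<open>s \<le> t\<close> \<open>0 < y t\<close> dyad_pos lt], assumption, rule that)
    have v0: "v > 0" using v s by simp
    have X: "dyadic_X y w \<theta> \<gamma> v = shifted w \<theta> i (y v - dyad \<theta> i / 2) \<gamma>" for \<gamma>
      by (rule X_index[OF v0 _ u(2) v(3)]) (use u v in auto)
    have "\<bar>y v - dyad \<theta> i / 2\<bar> < dyad \<theta> i / 2" using v(2) v(3)[of v] v0 unfolding abs_less_iff by auto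
    then have "dyadic_X y w \<theta> \<alpha> v \<noteq> dyadic_X y w \<theta> \<beta> v"
      unfolding X using D le by (intro shifted_neq[OF w]) auto
    then show ?thesis using v(1) by blast
  next
    case False
    then have z: "y s = 0" using y_nonneg[of s] s by force
    have "dyadic_X y w \<theta> \<gamma> s = shifted w \<theta> i (y s - dyad \<theta> i / 2) \<gamma>" for \<gamma>
      by (rule X_index[OF s u lt])
    then show ?thesis using D False z by (intro exI[of _ s]) simp
  qed
qed

text \<open>If \<open>y\<close> becomes positive later, pick a time at which its running maximum is
  positive but below a mesh finer than \<open>\<beta> - \<alpha>\<close>: the two particles are then
  in different cells whatever the signs.\<close>

lemma event_no_index:
  assumes s: "s > 0" and less: "\<alpha> < \<beta>" and y0: "\<And>u. u \<in> {0..s} \<Longrightarrow> y u = 0"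
  shows "(\<exists>t\<ge>s. dyadic_X y w \<theta> \<alpha> t \<noteq> dyadic_X y w \<theta> \<beta> t) \<longleftrightarrow>
    ((\<exists>t\<ge>s. 0 < y t) \<or>
      shifted w \<theta> no_index (- (dyad \<theta> no_index / 2)) \<alpha> \<noteq> shifted w \<theta> no_index (- (dyad \<theta> no_index / 2)) \<beta>)"
proof (cases "\<exists>t\<ge>s. 0 < y t")
  case True
  then obtain t where t: "s \<le> t" "0 < y t" by blast
  obtain n where n: "dyad \<theta> (0 - int n) < \<beta> - \<alpha>" using dyad_small[of "\<beta> - \<alpha>" \<theta> 0] less by auto
  obtain v where v: "v \<ge> s" "0 < y v" "\<And>u. u \<in> {0..v} \<Longrightarrow> y u < dyad \<theta> (0 - int n)"
    by (rule positive_passage[of s t "dyad \<theta> (0 - int n)"]) (use s t y0 in auto)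
  have v0: "v > 0" using v s by simp
  obtain i u where i: "u \<in> {0..v}" "dyad \<theta> (i - 1) \<le> y u" "\<And>u. u \<in> {0..v} \<Longrightarrow> y u < dyad \<theta> i"
    by (rule index_exists[of v v]) (use v(2) v0 in auto)
  have X: "dyadic_X y w \<theta> \<gamma> v = shifted w \<theta> i (y v - dyad \<theta> i / 2) \<gamma>" for \<gamma>
    by (rule X_index[OF v0 i])
  have "i - 1 < 0 - int n" using i(2) v(3)[OF i(1)] dyad_mono[of "0 - int n" "i - 1" \<theta>] by force
  then have "dyad \<theta> i \<le> dyad \<theta> (0 - int n)" by (intro dyad_mono) simp
  then have "cell w \<theta> \<alpha> i \<noteq> cell w \<theta> \<beta> i"
    using n less by (intro cell_neq_small[OF w]) auto
  moreover have "\<bar>y v - dyad \<theta> i / 2\<bar> < dyad \<theta> i / 2" using v(2) i(3)[of v] v0 unfolding abs_less_iff by auto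
  ultimately have "dyadic_X y w \<theta> \<alpha> v \<noteq> dyadic_X y w \<theta> \<beta> v"
    unfolding X using less by (intro shifted_neq[OF w]) auto
  then show ?thesis using True v(1) by blast
next
  case False
  then have z: "y t = 0" if "t \<ge> s" for t using y_nonneg[of t] s that by force
  have "dyadic_X y w \<theta> \<gamma> t = shifted w \<theta> no_index (- (dyad \<theta> no_index / 2)) \<gamma>" if "t \<ge> s" for t \<gamma>
  proof -
    have "y u = 0" if "u \<in> {0..t}" for u using y0[of u] z[of u] that by (cases "u \<le> s") auto
    then show ?thesis using X_no_index[of t \<gamma>] z[OF that] that s by simp
  qed
  then show ?thesis using False by auto
qed

end

section \<open>Uniformity of the cell offset\<close>

text \<open>The lattice shift in units of the mesh, moved into [0, 1]: for signs \<open>w\<close> it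
  is the number with binary digits \<open>(w (j - 1) + 1) / 2\<close>,
  \<open>(w (j - 2) + 1) / 2\<close> and so on. The factor \<open>2 powr \<theta>\<close> cancels,
  so \<theta> can be set to 0.\<close>

definition binx :: "int \<Rightarrow> (int \<Rightarrow> real) \<Rightarrow> real" where
  "binx j w = sgn_sum w 0 j / dyad 0 j + 1 / 2"

lemma sgn_sum_eq_binx: "sgn_sum w \<theta> j = dyad \<theta> j * (binx j w - 1 / 2)"
proof -
  have "sgn_sum w \<theta> j = (\<Sum>\<^sub>\<infinity>k\<in>{..j - 1}. (2 powr \<theta>) * (w k * 2 powr (of_int k + 0 - 1)))"
    unfolding sgn_sum_def by (intro infsum_cong) (simp add: powr_add powr_diff)
  also have "\<dots> = 2 powr \<theta> * sgn_sum w 0 j"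
    unfolding sgn_sum_def by (rule infsum_cmult_right') 
  finally show ?thesis by (simp add: binx_def) (simp add: dyad_def powr_add)
qed

lemma cell_eq_binx: "cell w \<theta> \<alpha> j = \<lfloor>\<alpha> / dyad \<theta> j + 1 - binx j w\<rfloor>"
proof -
  have "(\<alpha> - sgn_sum w \<theta> j) / dyad \<theta> j + 1 / 2 = \<alpha> / dyad \<theta> j + 1 - binx j w"
    by (simp add: sgn_sum_eq_binx diff_divide_distrib)
  then show ?thesis by (simp only: cell_def)
qed

text \<open>The first \<open>n\<close> binary digits of \<open>binx j w\<close> read as an integer,
  with \<open>w (j - 1)\<close> the most significant. For signs \<open>w\<close> it is the floor of
  \<open>2 ^ n * binx j w\<close>, except when all later digits are 1.\<close>

primrec bits :: "(int \<Rightarrow> real) \<Rightarrow> int \<Rightarrow> nat \<Rightarrow> int" where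
  "bits w j 0 = 0"
| "bits w j (Suc n) = 2 * bits w j n + (if w (j - 1 - int n) = 1 then 1 else 0)"

context
  fixes w :: "int \<Rightarrow> real"
  assumes w: "\<And>k. w k \<in> {1, -1}"
begin

lemma binx_Suc: "binx (j + 1) w = (binx j w + (if w j = 1 then 1 else 0)) / 2"
proof -
  have "binx (j + 1) w = (sgn_sum w 0 j + w j * (dyad 0 j / 2)) / (2 * dyad 0 j) + 1 / 2"
    unfolding binx_def sgn_sum_Suc[of w, OF abs_w_le[of w, OF w]] dyad_plus_1 ..
  also have "\<dots> = (sgn_sum w 0 j / dyad 0 j + 1 / 2) / 2 + (w j + 1) / 4"
    by (simp add: add_divide_distrib)
  finally show ?thesis using w[of j] by (auto simp: binx_def add_divide_distrib)
qed

lemma binx_bounds: "0 \<le> binx j w" "binx j w \<le> 1"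
proof -
  have "\<bar>sgn_sum w 0 j / dyad 0 j\<bar> \<le> 1 / 2"
    using sgn_sum_bound[of w 0 j, OF abs_w_le[of w, OF w]] by (simp add: abs_divide divide_le_eq)
  then show "0 \<le> binx j w" "binx j w \<le> 1" unfolding binx_def by linarith+
qed

lemma binx_bits: "2 ^ n * binx j w = of_int (bits w j n) + binx (j - int n) w"
proof (induction n)
  case (Suc n)
  have e: "j - int n = (j - int (Suc n)) + 1" "j - 1 - int n = j - int (Suc n)" by simp_all
  have "2 * binx (j - int n) w = binx (j - int (Suc n)) w + (if w (j - int (Suc n)) = 1 then 1 else 0)"
    unfolding e(1) binx_Suc by simp
  then show ?case
    unfolding bits.simps e(2) power_Suc using Suc by (simp add: algebra_simps del: of_nat_Suc)
qed simp

lemma bits_bounds: "0 \<le> bits w j n" "bits w j n < 2 ^ n"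
  by (induction n) auto

lemma abs_bits_binx_le: "\<bar>of_int (bits w j n) * (1 / 2) ^ n - binx j w\<bar> \<le> (1 / 2) ^ n"
proof -
  have "of_int (bits w j n) * (1 / 2) ^ n - binx j w = (of_int (bits w j n) - 2 ^ n * binx j w) * (1 / 2) ^ n"
    by (simp add: field_simps)
  also have "\<bar>\<dots>\<bar> \<le> 1 * (1 / 2) ^ n"
    unfolding abs_mult binx_bits using binx_bounds[of "j - int n"] by (intro mult_mono) auto
  finally show ?thesis by simp
qed

lemma bits_tendsto: "(\<lambda>n. of_int (bits w j n) * (1 / 2) ^ n) \<longlonglongrightarrow> binx j w"
proof (rule LIM_zero_cancel, rule Lim_null_comparison)
  show "\<forall>\<^sub>F n in sequentially. norm (of_int (bits w j n) * (1 / 2) ^ n - binx j w) \<le> (1 / 2) ^ n"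
    using abs_bits_binx_le by simp
  show "(\<lambda>n. (1 / 2 :: real) ^ n) \<longlonglongrightarrow> 0" by (rule LIMSEQ_power_zero) simp
qed

end

text \<open>Each value corresponds to one pattern of signs, which turns an event about
  \<open>bits\<close> into an intersection over finitely many independent signs.\<close>

lemma bits_eq_iff:
  assumes "0 \<le> m" "m < 2 ^ n"
  shows "\<exists>c. (\<forall>i. c i \<in> {1, -1}) \<and> (\<forall>w. (\<forall>k. w k \<in> {1, -1}) \<longrightarrow> (bits w j n = m \<longleftrightarrow> (\<forall>i<n. w (j - 1 - int i) = c i)))"
  using assms
proof (induction n arbitrary: m)
  case 0
  then show ?case by (intro exI[of _ "\<lambda>_. 1"]) auto
next
  case (Suc n)
  then have "0 \<le> m div 2" "m div 2 < 2 ^ n" by auto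
  then obtain c where c: "\<And>i. c i \<in> {1, -1}"
    "\<And>w. (\<And>k. w k \<in> {1, -1}) \<Longrightarrow> (bits w j n = m div 2 \<longleftrightarrow> (\<forall>i<n. w (j - 1 - int i) = c i))"
    using Suc.IH by blast
  define c' where "c' i = (if i = n then (if odd m then 1 else - 1) else c i)" for i
  show ?case
  proof (intro exI[of _ c'] conjI allI impI)
    show "c' i \<in> {1, -1}" for i using c(1)[of i] by (auto simp: c'_def)
    fix w :: "int \<Rightarrow> real" assume w: "\<forall>k. w k \<in> {1, -1}"
    have "bits w j (Suc n) = m \<longleftrightarrow> bits w j n = m div 2 \<and> (w (j - 1 - int n) = 1 \<longleftrightarrow> odd m)"
      by (cases "w (j - 1 - int n) = 1") (auto; presburger)+
    also have "\<dots> \<longleftrightarrow> (\<forall>i<n. w (j - 1 - int i) = c i) \<and> w (j - 1 - int n) = c' n"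
      using c(2)[of w] w[rule_format, of "j - 1 - int n"] w by (auto simp: c'_def)
    also have "\<dots> \<longleftrightarrow> (\<forall>i<Suc n. w (j - 1 - int i) = c' i)"
      by (auto simp: c'_def less_Suc_eq)
    finally show "bits w j (Suc n) = m \<longleftrightarrow> (\<forall>i<Suc n. w (j - 1 - int i) = c' i)" .
  qed
qed

lemma measurable_bits [measurable]:
  "(\<lambda>w. bits w j n) \<in> measurable (PiM UNIV (\<lambda>_. sign_space)) (count_space UNIV)"
proof (induction n)
  case (Suc n)
  have [measurable]: "Measurable.pred (PiM UNIV (\<lambda>_. sign_space)) (\<lambda>w. w k = 1)" for k :: int
  proof -
    have "(\<lambda>w. w k) \<in> measurable (PiM UNIV (\<lambda>_. sign_space)) sign_space" by measurable
    then show ?thesis by measurable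
  qed
  show ?case unfolding bits.simps using Suc by measurable
qed simp

lemma space_signs: "w \<in> space (PiM UNIV (\<lambda>_. sign_space)) \<longleftrightarrow> (\<forall>k. w k \<in> {1, -1})"
  by (auto simp: space_PiM PiE_def Pi_def)

lemma measurable_binx [measurable]: "binx j \<in> borel_measurable (PiM UNIV (\<lambda>_. sign_space))"
proof (rule borel_measurable_LIMSEQ_real)
  show "(\<lambda>w. of_int (bits w j n) * (1 / 2) ^ n :: real) \<in> borel_measurable (PiM UNIV (\<lambda>_. sign_space))" for n
    by measurable
  fix w :: "int \<Rightarrow> real" assume "w \<in> space (PiM UNIV (\<lambda>_. sign_space))"
  then show "(\<lambda>n. of_int (bits w j n) * (1 / 2) ^ n :: real) \<longlonglongrightarrow> binx j w"
    unfolding space_signs by (intro bits_tendsto) blast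
qed

section \<open>The law of a random binary expansion\<close>

context prob_space
begin

context
  fixes W :: "int \<Rightarrow> 'a \<Rightarrow> real"
  assumes W_indep: "indep_vars (\<lambda>_. sign_space) W UNIV"
    and W_distr: "\<And>i. distr M sign_space (W i) = uniform_count_measure {1, -1}"
begin

lemma W_rv: "W i \<in> measurable M sign_space"
  using W_indep by (auto simp: indep_vars_def)

lemma W_signs: "\<omega> \<in> space M \<Longrightarrow> W i \<omega> \<in> {1, -1}"
  using W_rv[of i] by (auto simp: measurable_def)

lemma signs_rv: "(\<lambda>\<omega> i. W i \<omega>) \<in> measurable M (PiM UNIV (\<lambda>_. sign_space))"
proof -
  have "(\<lambda>\<omega>. \<lambda>i\<in>UNIV. W i \<omega>) \<in> measurable M (PiM UNIV (\<lambda>_. sign_space))"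
    by (rule measurable_restrict) (rule W_rv)
  then show ?thesis by (simp only: restrict_UNIV)
qed

lemma prob_W: "c \<in> {1, -1} \<Longrightarrow> prob (W i -` {c} \<inter> space M) = 1 / 2"
  using measure_distr[OF W_rv[of i], of "{c}"] unfolding W_distr
  by (auto simp: measure_uniform_count_measure)

lemma prob_bits:
  assumes "0 \<le> m" "m < 2 ^ n"
  shows "prob {\<omega>\<in>space M. bits (\<lambda>i. W i \<omega>) j n = m} = (1 / 2) ^ n"
proof (cases "n = 0")
  \<comment> \<open>The product rule for independent events is applied to a nonempty index set,
    hence the separate case \<open>n = 0\<close>.\<close>
  case True
  then show ?thesis using assms by (simp add: prob_space)
next
  case False
  obtain c where c: "\<And>i. c i \<in> {1, -1}"
    "\<And>w. (\<And>k. w k \<in> {1, -1}) \<Longrightarrow> (bits w j n = m \<longleftrightarrow> (\<forall>i<n. w (j - 1 - int i) = c i))"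
    using bits_eq_iff[OF assms] by blast
  define J where "J = (\<lambda>i. j - 1 - int i) ` {..<n}"
  define d where "d k = c (nat (j - 1 - k))" for k
  have inj: "inj_on (\<lambda>i. j - 1 - int i) {..<n}" by (auto simp: inj_on_def)
  have "{\<omega>\<in>space M. bits (\<lambda>i. W i \<omega>) j n = m} = (\<Inter>k\<in>J. W k -` {d k} \<inter> space M)"
  proof -
    have "bits (\<lambda>i. W i \<omega>) j n = m \<longleftrightarrow> (\<forall>i<n. W (j - 1 - int i) \<omega> = c i)" if "\<omega> \<in> space M" for \<omega>
      by (rule c(2)) (rule W_signs[OF that])
    then show ?thesis using False by (auto simp: J_def d_def)
  qed
  also have "prob \<dots> = (\<Prod>k\<in>J. prob (W k -` {d k} \<inter> space M))"
    by (rule indep_varsD[OF W_indep]) (use False c(1) in \<open>auto simp: J_def d_def\<close>)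
  also have "\<dots> = (\<Prod>k\<in>J. 1 / 2)"
    by (intro prod.cong refl prob_W) (simp only: d_def c(1))
  also have "\<dots> = (1 / 2) ^ n" using card_image[OF inj] by (simp add: J_def)
  finally show ?thesis .
qed

lemma bits_rv [measurable]: "(\<lambda>\<omega>. bits (\<lambda>i. W i \<omega>) j n) \<in> measurable M (count_space UNIV)"
  by (rule measurable_compose[OF signs_rv measurable_bits])

lemma binx_rv [measurable]: "(\<lambda>\<omega>. binx j (\<lambda>i. W i \<omega>)) \<in> borel_measurable M"
  by (rule measurable_compose[OF signs_rv measurable_binx])

lemma prob_bits_less:
  assumes "0 \<le> m" "m \<le> 2 ^ n"
  shows "prob {\<omega>\<in>space M. bits (\<lambda>i. W i \<omega>) j n < m} = of_int m * (1 / 2) ^ n"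
proof -
  have "{\<omega>\<in>space M. bits (\<lambda>i. W i \<omega>) j n < m} = (\<Union>i\<in>{0..<m}. {\<omega>\<in>space M. bits (\<lambda>i. W i \<omega>) j n = i})"
    using bits_bounds(1)[OF W_signs] by auto
  also have "prob \<dots> = (\<Sum>i\<in>{0..<m}. prob {\<omega>\<in>space M. bits (\<lambda>i. W i \<omega>) j n = i})"
    by (rule finite_measure_finite_Union) (auto simp: disjoint_family_on_def)
  also have "\<dots> = (\<Sum>i\<in>{0..<m}. (1 / 2) ^ n)"
    by (intro sum.cong prob_bits refl) (use assms in auto)
  finally show ?thesis using assms by simp
qed

lemma binx_W_bounds:
  assumes "\<omega> \<in> space M"
  shows "0 \<le> binx j (\<lambda>i. W i \<omega>)" "binx j (\<lambda>i. W i \<omega>) \<le> 1"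
  by (rule binx_bounds, rule W_signs, rule assms)+

text \<open>With \<open>m\<close> the floor of \<open>x * 2 ^ n\<close>, the event lies between
  \<open>bits < m\<close> and \<open>bits < m + 1\<close>, because the digits after the first
  \<open>n\<close> add a remainder in [0, 1]. Both bounds are within \<open>(1 / 2) ^ n\<close> of
  \<open>x\<close>.\<close>

lemma prob_binx_le:
  assumes x: "0 \<le> x" "x < 1"
  shows "prob {\<omega>\<in>space M. binx j (\<lambda>i. W i \<omega>) \<le> x} = x"
proof -
  let ?p = "prob {\<omega>\<in>space M. binx j (\<lambda>i. W i \<omega>) \<le> x}"
  have "\<bar>?p - x\<bar> \<le> (1 / 2) ^ n" for n
  proof -
    define m where "m = \<lfloor>x * 2 ^ n\<rfloor>"
    have m: "of_int m \<le> x * 2 ^ n" "x * 2 ^ n < of_int m + 1" unfolding m_def by linarith+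
    have m0: "0 \<le> m" using x by (simp add: m_def)
    have "x * 2 ^ n < 1 * 2 ^ n" by (rule mult_strict_right_mono[OF x(2)]) simp
    then have "of_int m < (2 :: real) ^ n" using m(1) by linarith
    then have "real_of_int m < real_of_int (2 ^ n)" by simp
    then have m1: "m < 2 ^ n" by (simp only: of_int_less_iff)
    have bb: "of_int (bits (\<lambda>i. W i \<omega>) j n) \<le> 2 ^ n * binx j (\<lambda>i. W i \<omega>)"
      "2 ^ n * binx j (\<lambda>i. W i \<omega>) \<le> of_int (bits (\<lambda>i. W i \<omega>) j n) + 1" if "\<omega> \<in> space M" for \<omega>
      using binx_bits[of "\<lambda>i. W i \<omega>" n j, OF W_signs[OF that]] binx_W_bounds[OF that, of "j - int n"]
      by linarith+
    have "?p \<le> prob {\<omega>\<in>space M. bits (\<lambda>i. W i \<omega>) j n < m + 1}"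
    proof (rule finite_measure_mono)
      show "{\<omega>\<in>space M. binx j (\<lambda>i. W i \<omega>) \<le> x} \<subseteq> {\<omega>\<in>space M. bits (\<lambda>i. W i \<omega>) j n < m + 1}"
      proof safe
        fix \<omega> assume \<omega>: "\<omega> \<in> space M" "binx j (\<lambda>i. W i \<omega>) \<le> x"
        then have "2 ^ n * binx j (\<lambda>i. W i \<omega>) \<le> 2 ^ n * x" by (intro mult_left_mono) auto
        then have "of_int (bits (\<lambda>i. W i \<omega>) j n) < real_of_int m + 1"
          using bb(1)[OF \<omega>(1)] m(2) mult.commute[of x "2 ^ n"] by linarith
        then show "bits (\<lambda>i. W i \<omega>) j n < m + 1" by linarith
      qed
    qed measurable
    also have "\<dots> = of_int (m + 1) * (1 / 2) ^ n" by (rule prob_bits_less) (use m0 m1 in auto)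
    also have "\<dots> \<le> (x * 2 ^ n + 1) * (1 / 2) ^ n" using m by (intro mult_right_mono) auto
    also have "\<dots> = x + (1 / 2) ^ n" by (simp add: field_simps)
    finally have 1: "?p \<le> x + (1 / 2) ^ n" .
    have "x - (1 / 2) ^ n = (x * 2 ^ n - 1) * (1 / 2) ^ n" by (simp add: field_simps)
    also have "\<dots> \<le> of_int m * (1 / 2) ^ n" using m by (intro mult_right_mono) auto
    also have "\<dots> = prob {\<omega>\<in>space M. bits (\<lambda>i. W i \<omega>) j n < m}"
      by (rule prob_bits_less[symmetric]) (use m0 m1 in auto)
    also have "\<dots> \<le> ?p"
    proof (rule finite_measure_mono)
      show "{\<omega>\<in>space M. bits (\<lambda>i. W i \<omega>) j n < m} \<subseteq> {\<omega>\<in>space M. binx j (\<lambda>i. W i \<omega>) \<le> x}"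
      proof safe
        fix \<omega> assume \<omega>: "\<omega> \<in> space M" "bits (\<lambda>i. W i \<omega>) j n < m"
        then have "real_of_int (bits (\<lambda>i. W i \<omega>) j n) + 1 \<le> of_int m" by linarith
        then have "2 ^ n * binx j (\<lambda>i. W i \<omega>) \<le> 2 ^ n * x"
          using bb(2)[OF \<omega>(1)] m(1) mult.commute[of x "2 ^ n"] by linarith
        then show "binx j (\<lambda>i. W i \<omega>) \<le> x" by simp
      qed
    qed measurable
    finally show ?thesis using 1 by linarith
  qed
  then have "\<bar>?p - x\<bar> \<le> 0"
    by (intro LIMSEQ_le_const[OF LIMSEQ_power_zero[of "1 / 2 :: real"]]) auto
  then show ?thesis by simp
qed

lemma distr_binx: "distr M borel (\<lambda>\<omega>. binx j (\<lambda>i. W i \<omega>)) = uniform_measure lborel {0..1}"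
proof (rule cdf_unique')
  show "finite_borel_measure (distr M borel (\<lambda>\<omega>. binx j (\<lambda>i. W i \<omega>)))"
    by (intro real_distribution.finite_borel_measure_M real_distribution_distr) measurable
  interpret U: prob_space "uniform_measure lborel {0..1::real}" by (rule prob_space_uniform_measure) auto
  have "real_distribution (uniform_measure lborel {0..1::real})"
    by standard auto
  then show "finite_borel_measure (uniform_measure lborel {0..1::real})"
    by (rule real_distribution.finite_borel_measure_M)
  show "cdf (distr M borel (\<lambda>\<omega>. binx j (\<lambda>i. W i \<omega>))) = cdf (uniform_measure lborel {0..1})"
  proof
    fix x :: real
    have "cdf (distr M borel (\<lambda>\<omega>. binx j (\<lambda>i. W i \<omega>))) x = prob {\<omega>\<in>space M. binx j (\<lambda>i. W i \<omega>) \<le> x}"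
      unfolding cdf_def by (subst measure_distr) (auto intro!: arg_cong[where f = prob])
    also have "\<dots> = (if x < 0 then 0 else if x < 1 then x else 1)"
    proof -
      consider "x < 0" | "0 \<le> x" "x < 1" | "x \<ge> 1" by linarith
      then show ?thesis
      proof cases
        case 1
        have "{\<omega>\<in>space M. binx j (\<lambda>i. W i \<omega>) \<le> x} = {}" using 1 binx_W_bounds(1)[of _ j] by force
        then show ?thesis using 1 by (simp only: measure_empty if_True)
      next
        case 2 then show ?thesis using prob_binx_le by simp
      next
        case 3
        then have "{\<omega>\<in>space M. binx j (\<lambda>i. W i \<omega>) \<le> x} = space M" using binx_W_bounds(2)[of _ j] by force
        then show ?thesis using 3 by (simp add: prob_space)
      qed
    qed
    also have "\<dots> = measure lborel ({0..1} \<inter> {..x})"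
      by (auto simp: Int_atLeastAtMost min_def atMost_def[symmetric] simp flip: atLeastAtMost_def)
    also have "\<dots> = cdf (uniform_measure lborel {0..1}) x"
      unfolding cdf_def by (subst measure_uniform_measure) auto
    finally show "cdf (distr M borel (\<lambda>\<omega>. binx j (\<lambda>i. W i \<omega>))) x = cdf (uniform_measure lborel {0..1}) x" .
  qed
qed

end

end

section \<open>Two integral identities\<close>

text \<open>Translates of the unit interval tile the line. This serves twice: for the offset of the
  lattice and for the scale \<open>\<theta> + i\<close>.\<close>

lemma nn_integral_periodize:
  fixes f :: "real \<Rightarrow> ennreal"
  assumes [measurable]: "f \<in> borel_measurable borel"
  shows "(\<integral>\<^sup>+u. (\<integral>\<^sup>+n. f (u + of_int n) \<partial>count_space UNIV) \<partial>uniform_measure lborel {0..1}) = (\<integral>\<^sup>+x. f x \<partial>lborel)"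
proof -
  have "(\<integral>\<^sup>+u. (\<integral>\<^sup>+n. f (u + of_int n) \<partial>count_space UNIV) \<partial>uniform_measure lborel {0..1})
      = (\<integral>\<^sup>+n. (\<integral>\<^sup>+u. f (u + of_int n) \<partial>uniform_measure lborel {0..1}) \<partial>count_space (UNIV :: int set))"
    by (rule nn_integral_count_space_nn_integral) auto
  also have "\<dots> = (\<integral>\<^sup>+n. (\<integral>\<^sup>+x. f x * indicator {of_int n..<of_int n + 1} x \<partial>lborel) \<partial>count_space (UNIV :: int set))"
  proof (rule nn_integral_cong)
    fix n :: int
    have "(\<integral>\<^sup>+u. f (u + of_int n) \<partial>uniform_measure lborel {0..1}) = (\<integral>\<^sup>+u. f (u + of_int n) * indicator {0..1} u \<partial>lborel)"
      by (subst nn_integral_uniform_measure) (auto simp: divide_ennreal_def)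
    \<comment> \<open>Closed and half-open unit intervals differ by a null set; the half-open ones
      tile without overlap.\<close>
    also have "\<dots> = (\<integral>\<^sup>+u. f (of_int n + u) * indicator {of_int n..<of_int n + 1} (of_int n + u) \<partial>lborel)"
      using AE_lborel_singleton[of "1::real"]
      by (intro nn_integral_cong_AE) (auto elim!: eventually_mono simp: indicator_def add.commute)
    also have "\<dots> = (\<integral>\<^sup>+x. f x * indicator {of_int n..<of_int n + 1} x \<partial>lborel)"
      by (subst (2) lborel_distr_plus[symmetric, of "of_int n"]) (simp add: nn_integral_distr)
    finally show "(\<integral>\<^sup>+u. f (u + of_int n) \<partial>uniform_measure lborel {0..1}) =
      (\<integral>\<^sup>+x. f x * indicator {of_int n..<of_int n + 1} x \<partial>lborel)" .
  qed
  also have "\<dots> = (\<integral>\<^sup>+x. (\<integral>\<^sup>+n. f x * indicator {of_int n..<of_int n + 1} x \<partial>count_space (UNIV :: int set)) \<partial>lborel)"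
    by (rule nn_integral_count_space_nn_integral[symmetric]) auto
  also have "\<dots> = (\<integral>\<^sup>+x. f x \<partial>lborel)"
  proof (rule nn_integral_cong)
    fix x :: real
    have "(\<integral>\<^sup>+n. f x * indicator {of_int n..<of_int n + 1} x \<partial>count_space (UNIV :: int set))
      = (\<integral>\<^sup>+n. f x * indicator {\<lfloor>x\<rfloor>} n \<partial>count_space (UNIV :: int set))"
      by (intro nn_integral_cong) (auto simp: indicator_def floor_eq_iff; linarith)
    also have "\<dots> = f x" by (simp add: nn_integral_cmult_indicator one_ennreal_def[symmetric])
    finally show "(\<integral>\<^sup>+n. f x * indicator {of_int n..<of_int n + 1} x \<partial>count_space (UNIV :: int set)) = f x" .
  qed
  finally show ?thesis .
qed

text \<open>If \<open>b - a < 1\<close>, the floors differ exactly when some translate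
  \<open>u + n\<close> lies in \<open>{a<..b}\<close>, and then only for \<open>n\<close> the floor
  of \<open>b - u\<close>. Periodising gives the length of that interval.\<close>

lemma emeasure_floor_neq:
  fixes a b :: real
  assumes ab: "a < b"
  shows "(\<integral>\<^sup>+u. indicator {u. \<lfloor>a - u\<rfloor> \<noteq> \<lfloor>b - u\<rfloor>} u \<partial>uniform_measure lborel {0..1}) = ennreal (min (b - a) 1)"
proof (cases "b - a \<ge> 1")
  case True
  interpret U: prob_space "uniform_measure lborel {0..1::real}" by (rule prob_space_uniform_measure) auto
  have "\<lfloor>a - u\<rfloor> \<noteq> \<lfloor>b - u\<rfloor>" for u using True by linarith
  then show ?thesis using True U.emeasure_space_1 by (simp add: min_def)
next
  case False
  have "(\<integral>\<^sup>+u. indicator {u. \<lfloor>a - u\<rfloor> \<noteq> \<lfloor>b - u\<rfloor>} u \<partial>uniform_measure lborel {0..1})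
    = (\<integral>\<^sup>+u. (\<integral>\<^sup>+n. indicator {a<..b} (u + of_int n) \<partial>count_space (UNIV :: int set)) \<partial>uniform_measure lborel {0..1})"
  proof (rule nn_integral_cong)
    fix u :: real
    have "(\<integral>\<^sup>+n. indicator {a<..b} (u + of_int n) \<partial>count_space (UNIV :: int set))
      = (\<integral>\<^sup>+n. indicator {u. \<lfloor>a - u\<rfloor> \<noteq> \<lfloor>b - u\<rfloor>} u * indicator {\<lfloor>b - u\<rfloor>} n \<partial>count_space UNIV)"
    proof (rule nn_integral_cong)
      fix n :: int
      have "u + of_int n \<in> {a<..b} \<longleftrightarrow> \<lfloor>a - u\<rfloor> \<noteq> \<lfloor>b - u\<rfloor> \<and> n = \<lfloor>b - u\<rfloor>"
      proof
        assume "u + of_int n \<in> {a<..b}"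
        then have n: "a < u + of_int n" "u + of_int n \<le> b" by auto
        have "\<lfloor>b - u\<rfloor> = n" by (rule floor_unique) (use n False in linarith)+
        moreover have "\<lfloor>a - u\<rfloor> < n" using n by linarith
        ultimately show "\<lfloor>a - u\<rfloor> \<noteq> \<lfloor>b - u\<rfloor> \<and> n = \<lfloor>b - u\<rfloor>" by simp
      next
        assume n: "\<lfloor>a - u\<rfloor> \<noteq> \<lfloor>b - u\<rfloor> \<and> n = \<lfloor>b - u\<rfloor>"
        moreover have "\<lfloor>a - u\<rfloor> \<le> \<lfloor>b - u\<rfloor>" using ab by (intro floor_mono) simp
        ultimately have "\<lfloor>a - u\<rfloor> < n" "n \<le> \<lfloor>b - u\<rfloor>" by auto
        then show "u + of_int n \<in> {a<..b}" by (auto simp: floor_less_iff le_floor_iff)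
      qed
      then show "indicator {a<..b} (u + of_int n) = (indicator {u. \<lfloor>a - u\<rfloor> \<noteq> \<lfloor>b - u\<rfloor>} u * indicator {\<lfloor>b - u\<rfloor>} n :: ennreal)"
        by (auto simp: indicator_def)
    qed
    then show "indicator {u. \<lfloor>a - u\<rfloor> \<noteq> \<lfloor>b - u\<rfloor>} u = (\<integral>\<^sup>+n. indicator {a<..b} (u + of_int n) \<partial>count_space (UNIV :: int set))"
      by (simp add: nn_integral_cmult_indicator one_ennreal_def[symmetric])
  qed
  also have "\<dots> = (\<integral>\<^sup>+x. indicator {a<..b} x \<partial>lborel)"
    by (rule nn_integral_periodize) simp
  also have "\<dots> = ennreal (min (b - a) 1)" using False ab by (simp add: min_def)
  finally show ?thesis .
qed

text \<open>On \<open>\<zeta> \<ge> \<psi> / 2\<close> this is minus the derivative in \<zeta> of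
  the integral of \<open>min (\<psi> / 2 powr x) 1\<close> over the unit interval starting at
  \<open>log 2 \<zeta>\<close>.\<close>

definition kern :: "real \<Rightarrow> real \<Rightarrow> real" where
  "kern \<psi> \<zeta> = \<zeta> powi (- 2) * \<psi> / ln 2 * (min (\<zeta> * \<psi> powi (- 1)) 1 - 1 / 2)"

text \<open>The left side is \<open>- H r\<close>. The derivative of \<open>H\<close> at
  \<open>z\<close> compares the integrand at meshes \<open>z\<close> and \<open>2 * z\<close>: for
  \<open>z < \<psi> / 2\<close> both values are 1 and cancel, which explains the lower limit, and
  otherwise the value at \<open>2 * z\<close> is \<open>\<psi> / (2 * z)\<close>, which explains the
  \<open>1 / 2\<close> in \<open>kern\<close>. As \<open>H\<close> vanishes at infinity, integrating
  its derivative from \<open>r\<close> recovers the left side.\<close>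

lemma nn_integral_kern:
  assumes \<psi>: "\<psi> > 0" and r: "r > 0"
  shows "(\<integral>\<^sup>+x. ennreal (min (\<psi> / 2 powr x) 1) * indicator {x. r < 2 powr x \<and> 2 powr x \<le> 2 * r} x \<partial>lborel)
    = (\<integral>\<^sup>+\<zeta>. ennreal (kern \<psi> \<zeta>) * indicator {\<psi> / 2..} \<zeta> * indicator {\<zeta>. r < \<zeta>} \<zeta> \<partial>lborel)"
proof -
  define m where "m x = min (\<psi> / 2 powr x) 1" for x :: real
  have mc: "continuous_on UNIV m" unfolding m_def by (intro continuous_intros) auto
  have mnn: "m x \<ge> 0" and m1: "m x \<le> 1" for x using \<psi> by (auto simp: m_def)
  have "\<exists>F. \<forall>x::real. -\<infinity> < ereal x \<longrightarrow> ereal x < \<infinity> \<longrightarrow> (F has_vector_derivative m x) (at x)"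
    by (rule einterval_antiderivative) (use mc in \<open>auto simp: continuous_on_eq_continuous_at\<close>)
  then obtain F where F: "(F has_real_derivative m x) (at x)" for x
    by (auto simp: has_real_derivative_iff_has_vector_derivative)
  define a where "a = log 2 r"
  have lhs: "(\<integral>\<^sup>+x. ennreal (min (\<psi> / 2 powr x) 1) * indicator {x. r < 2 powr x \<and> 2 powr x \<le> 2 * r} x \<partial>lborel)
     = ennreal (F (a + 1) - F a)"
  proof -
    have iff: "r < 2 powr x \<and> 2 powr x \<le> 2 * r \<longleftrightarrow> a < x \<and> x \<le> a + 1" for x
    proof -
      have "2 powr x \<le> 2 * r \<longleftrightarrow> x \<le> log 2 (2 * r)" using r by (simp add: le_log_iff)
      moreover have "log 2 (2 * r) = a + 1" using r by (simp add: a_def log_mult)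
      ultimately show ?thesis using r by (simp add: a_def log_less_iff)
    qed
    have "(\<integral>\<^sup>+x. ennreal (min (\<psi> / 2 powr x) 1) * indicator {x. r < 2 powr x \<and> 2 powr x \<le> 2 * r} x \<partial>lborel)
      = (\<integral>\<^sup>+x. ennreal (m x) * indicator {a..a + 1} x \<partial>lborel)"
      using AE_lborel_singleton[of a]
      by (intro nn_integral_cong_AE) (auto elim!: eventually_mono simp: iff m_def indicator_def)
    also have "\<dots> = ennreal (F (a + 1) - F a)"
      by (rule nn_integral_FTC_Icc) (use F mnn mc in \<open>auto intro: borel_measurable_continuous_onI\<close>)
    finally show ?thesis .
  qed
  define H where "H z = - (F (log 2 z + 1) - F (log 2 z))" for z
  define k where "k z = (m (log 2 z) - m (log 2 z + 1)) / (z * ln 2)" for z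
  have dH: "(H has_real_derivative k z) (at z)" if "z > 0" for z
  proof -
    have l: "((\<lambda>z. log 2 z) has_real_derivative 1 / (ln 2 * z)) (at z)"
      using that by (auto intro!: derivative_eq_intros simp: field_simps)
    have "((\<lambda>z. log 2 z + 1) has_real_derivative 1 / (ln 2 * z)) (at z)"
      using DERIV_add[OF l DERIV_const[of 1]] by simp
    then have "((\<lambda>z. F (log 2 z + 1)) has_real_derivative m (log 2 z + 1) * (1 / (ln 2 * z))) (at z)"
      by (rule DERIV_chain2[OF F])
    then have "(H has_real_derivative - (m (log 2 z + 1) * (1 / (ln 2 * z)) - m (log 2 z) * (1 / (ln 2 * z)))) (at z)"
      unfolding H_def[abs_def] by (intro DERIV_minus DERIV_diff DERIV_chain2[OF F l])
    then show ?thesis by (simp add: k_def diff_divide_distrib mult.commute)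
  qed
  have k_eq: "k z = (if \<psi> / 2 \<le> z then kern \<psi> z else 0)" if z: "z > 0" for z
  proof -
    have p: "2 powr (log 2 z) = z" "2 powr (log 2 z + 1) = 2 * z" using z by (simp_all add: powr_add)
    show ?thesis
      using z \<psi> unfolding k_def m_def p kern_def
      by (auto simp: min_def field_simps power_int_minus power2_eq_square)
  qed
  have knn: "k z \<ge> 0" if z: "z > 0" for z
  proof -
    have p: "2 powr (log 2 z) = z" "2 powr (log 2 z + 1) = 2 * z" using z by (simp_all add: powr_add)
    have "\<psi> / (2 * z) \<le> \<psi> / z" using z \<psi> by (simp add: field_simps)
    then have "m (log 2 z + 1) \<le> m (log 2 z)" unfolding m_def p by (intro min.mono) auto
    then show ?thesis using z by (simp add: k_def)
  qed
  have lim: "(H \<longlongrightarrow> 0) at_top"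
  proof (rule Lim_null_comparison)
    show "\<forall>\<^sub>F z in at_top. norm (H z) \<le> \<psi> / z"
      using eventually_gt_at_top[of 0]
    proof eventually_elim
      case (elim z)
      have p: "2 powr (log 2 z) = z" using elim by simp
      \<comment> \<open>By the mean value theorem the integral over the unit interval is a value
        \<open>m x\<close> with \<open>x\<close> beyond \<open>log 2 z\<close>, hence at most
        \<open>\<psi> / z\<close>.\<close>
      obtain x where x: "log 2 z < x" "F (log 2 z + 1) - F (log 2 z) = (log 2 z + 1 - log 2 z) * m x"
        using MVT2[of "log 2 z" "log 2 z + 1" F m] F by auto
      have "z \<le> 2 powr x" using x(1) elim by (simp add: log_less_iff less_imp_le)
      then have "\<psi> / 2 powr x \<le> \<psi> / z" using \<psi> elim by (intro divide_left_mono) auto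
      then have "m x \<le> \<psi> / z" unfolding m_def by simp
      then show ?case using x(2) mnn[of x] by (simp add: H_def)
    qed
    show "((\<lambda>z. \<psi> / z) \<longlongrightarrow> 0) at_top"
      by (intro tendsto_divide_0[OF tendsto_const] filterlim_at_top_imp_at_infinity filterlim_ident)
  qed
  have [measurable]: "m \<in> borel_measurable borel" using mc by (rule borel_measurable_continuous_onI)
  have [measurable]: "k \<in> borel_measurable borel" unfolding k_def[abs_def] by measurable
  have "(\<integral>\<^sup>+z. ennreal (k z) * indicator {r..} z \<partial>lborel) = ennreal (0 - H r)"
    by (rule nn_integral_FTC_atLeast) (use dH knn lim r in \<open>auto\<close>)
  moreover have "(\<integral>\<^sup>+z. ennreal (k z) * indicator {r..} z \<partial>lborel)
      = (\<integral>\<^sup>+\<zeta>. ennreal (kern \<psi> \<zeta>) * indicator {\<psi> / 2..} \<zeta> * indicator {\<zeta>. r < \<zeta>} \<zeta> \<partial>lborel)"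
    using AE_lborel_singleton[of r] r
    by (intro nn_integral_cong_AE) (auto elim!: eventually_mono simp: k_eq indicator_def)
  ultimately show ?thesis unfolding lhs by (simp add: H_def a_def)
qed

section \<open>The event of not having coalesced\<close>

text \<open>Converts independence of generated sigma-algebras, stated for variables of different
  types, into a product law to which Fubini's theorem applies.\<close>

lemma (in prob_space) distr_pair_indep_set:
  assumes f [measurable]: "f \<in> measurable M A" and g [measurable]: "g \<in> measurable M B"
    and ind: "indep_set (sigma_gen M f A) (sigma_gen M g B)"
  shows "distr M (A \<Otimes>\<^sub>M B) (\<lambda>\<omega>. (f \<omega>, g \<omega>)) = distr M A f \<Otimes>\<^sub>M distr M B g"
proof (rule pair_measure_eqI[symmetric])
  show "sigma_finite_measure (distr M A f)" "sigma_finite_measure (distr M B g)"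
    by (intro prob_space_imp_sigma_finite prob_space_distr f g)+
  fix X Z assume X: "X \<in> sets (distr M A f)" and Z: "Z \<in> sets (distr M B g)"
  have "prob ((f -` X \<inter> space M) \<inter> (g -` Z \<inter> space M)) = prob (f -` X \<inter> space M) * prob (g -` Z \<inter> space M)"
    by (rule indep_setD[OF ind]) (use X Z in \<open>auto intro!: in_vimage_algebra\<close>)
  moreover have "(\<lambda>\<omega>. (f \<omega>, g \<omega>)) -` (X \<times> Z) \<inter> space M = (f -` X \<inter> space M) \<inter> (g -` Z \<inter> space M)" by auto
  ultimately show "emeasure (distr M A f) X * emeasure (distr M B g) Z = emeasure (distr M (A \<Otimes>\<^sub>M B) (\<lambda>\<omega>. (f \<omega>, g \<omega>))) (X \<times> Z)"
    using X Z by (simp add: emeasure_distr emeasure_eq_measure ennreal_mult)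
qed simp

lemma measurable_floor_neq [measurable (raw)]:
  fixes f g :: "'a \<Rightarrow> real"
  assumes f: "f \<in> borel_measurable M" and g: "g \<in> borel_measurable M"
  shows "Measurable.pred M (\<lambda>x. \<lfloor>f x\<rfloor> \<noteq> \<lfloor>g x\<rfloor>)"
proof -
  have [measurable]: "(\<lambda>x. \<lfloor>f x\<rfloor>) \<in> measurable M (count_space UNIV)" "(\<lambda>x. \<lfloor>g x\<rfloor>) \<in> measurable M (count_space UNIV)"
    by (rule measurable_compose[OF _ measurable_real_floor], rule f, rule measurable_compose[OF _ measurable_real_floor], rule g)
  show ?thesis by measurable
qed

lemma measurable_dyad [measurable]: "(\<lambda>\<theta>. dyad \<theta> j) \<in> borel_measurable borel"
  unfolding dyad_def by measurable

lemma maxpath_path_of: "a \<ge> 0 \<Longrightarrow> b \<ge> 0 \<Longrightarrow> maxpath a b (path_of Y \<omega>) = maxpath a b (\<lambda>t. Y t \<omega>)"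
  unfolding maxpath_def path_of_def by (intro arg_cong[where f = enn2real] SUP_cong) auto

lemma emeasure_gauss_singleton: "emeasure (gauss \<sigma>) {x} = 0"
proof -
  have "AE y in lborel. gauss_density \<sigma> y * indicator {x} y = 0"
    using AE_lborel_singleton[of x] by (auto elim!: eventually_mono)
  then show ?thesis
    unfolding gauss_def by (subst emeasure_density) (simp_all add: nn_integral_0_iff_AE)
qed

context dyadic_coupling
begin

lemma Y_rv [measurable]: "t \<ge> 0 \<Longrightarrow> Y t \<in> borel_measurable M"
  using bessel by (simp add: bessel3_process_def)

lemma path_rv: "path_of Y \<in> measurable M path_space"
  unfolding path_of_def[abs_def] by (rule measurable_restrict) auto

lemmas W_sign = W_signs[OF W_indep W_distr]
lemmas W_family_rv = signs_rv[OF W_indep W_distr]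
lemmas distr_binx_uniform = distr_binx[OF W_indep W_distr]

lemma W_real_rv [measurable]: "W i \<in> borel_measurable M"
  using measurable_compose[OF W_rv[OF W_indep W_distr, of i], of "\<lambda>x. x" borel] by simp

declare Theta_measurable [measurable]

lemma binx_W_rv [measurable]: "(\<lambda>\<omega>. binx j (\<lambda>i. W i \<omega>)) \<in> borel_measurable M"
  by (rule binx_rv[OF W_indep W_distr])

lemma maxY_rv [measurable]: "a \<ge> 0 \<Longrightarrow> b \<ge> 0 \<Longrightarrow> (\<lambda>\<omega>. maxpath a b (\<lambda>t. Y t \<omega>)) \<in> borel_measurable M"
  using measurable_compose[OF path_rv measurable_maxpath[of a b]] by (simp add: maxpath_path_of)

lemma path: "\<omega> \<in> space M \<Longrightarrow> dyadic_path (\<lambda>t. Y t \<omega>) (\<lambda>i. W i \<omega>)"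
  by (rule dyadic_path.intro) (use bessel W_sign in \<open>simp_all add: bessel3_process_def\<close>)

lemma Y_cont: "\<omega> \<in> space M \<Longrightarrow> a \<ge> 0 \<Longrightarrow> continuous_on {a..b} (\<lambda>t. Y t \<omega>)"
  by (rule dyadic_path.y_cont_on[OF path])

lemma Y_nonneg: "\<omega> \<in> space M \<Longrightarrow> t \<ge> 0 \<Longrightarrow> Y t \<omega> \<ge> 0"
  using bessel by (simp add: bessel3_process_def)

lemma maxY_iff:
  assumes "\<omega> \<in> space M" "a \<ge> 0" "b \<ge> 0"
  shows "maxpath a b (\<lambda>t. Y t \<omega>) < z \<longleftrightarrow> (\<forall>t\<in>{a..a+b}. Y t \<omega> < z)"
    and "z \<le> maxpath a b (\<lambda>t. Y t \<omega>) \<longleftrightarrow> (\<exists>t\<in>{a..a+b}. z \<le> Y t \<omega>)"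
    and "z < maxpath a b (\<lambda>t. Y t \<omega>) \<longleftrightarrow> (\<exists>t\<in>{a..a+b}. z < Y t \<omega>)"
proof -
  have nn: "Y t \<omega> \<ge> 0" if "t \<in> {a..a+b}" for t using Y_nonneg[OF assms(1), of t] that assms(2) by simp
  show "maxpath a b (\<lambda>t. Y t \<omega>) < z \<longleftrightarrow> (\<forall>t\<in>{a..a+b}. Y t \<omega> < z)"
    and "z \<le> maxpath a b (\<lambda>t. Y t \<omega>) \<longleftrightarrow> (\<exists>t\<in>{a..a+b}. z \<le> Y t \<omega>)"
    and "z < maxpath a b (\<lambda>t. Y t \<omega>) \<longleftrightarrow> (\<exists>t\<in>{a..a+b}. z < Y t \<omega>)"
    by (rule maxpath_less_iff[OF Y_cont[OF assms(1,2)] assms(3) nn], assumption)+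
qed

text \<open>Only the law of the whole path is shared with the Brownian motion, so facts are
  transferred through measurable functionals \<open>h\<close> of the path.\<close>

lemma brownian_model:
  obtains N :: "(real \<Rightarrow> real ^ 3) measure" and B :: "real \<Rightarrow> (real \<Rightarrow> real ^ 3) \<Rightarrow> real ^ 3" where "bm3 N B"
    "\<And>h. h \<in> borel_measurable path_space \<Longrightarrow>
      distr M borel (\<lambda>\<omega>. h (path_of Y \<omega>)) = distr N borel (\<lambda>\<omega>. h (path_of (\<lambda>t \<omega>. norm (B t \<omega>)) \<omega>) :: real)"
proof -
  have "\<exists>(N :: (real \<Rightarrow> real ^ 3) measure) (B :: real \<Rightarrow> (real \<Rightarrow> real ^ 3) \<Rightarrow> real ^ 3). brownian_motion N B \<and>
      distr M path_space (path_of Y) = distr N path_space (path_of (\<lambda>t \<omega>. norm (B t \<omega>)))"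
    using bessel unfolding bessel3_process_def by (elim conjE)
  then obtain N :: "(real \<Rightarrow> real ^ 3) measure" and B :: "real \<Rightarrow> (real \<Rightarrow> real ^ 3) \<Rightarrow> real ^ 3" where bm: "brownian_motion N B"
    and law: "distr M path_space (path_of Y) = distr N path_space (path_of (\<lambda>t \<omega>. norm (B t \<omega>)))"
    by (elim exE conjE)
  have "prob_space N" using bm unfolding brownian_motion_def by blast
  then have bm3: "bm3 N B" using bm by (intro bm3.intro bm3_axioms.intro)
  then interpret N: bm3 N B .
  have nB: "path_of (\<lambda>t \<omega>. norm (B t \<omega>)) \<in> measurable N path_space"
    unfolding path_of_def[abs_def] by (rule measurable_restrict) auto
  have "distr M borel (\<lambda>\<omega>. h (path_of Y \<omega>)) = distr N borel (\<lambda>\<omega>. h (path_of (\<lambda>t \<omega>. norm (B t \<omega>)) \<omega>))"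
    if h: "h \<in> borel_measurable path_space" for h :: "(real \<Rightarrow> real) \<Rightarrow> real"
    using arg_cong[OF law, of "\<lambda>D. distr D borel h"] distr_distr[OF h path_rv] distr_distr[OF h nB]
    by (simp add: o_def)
  then show ?thesis by (rule that[OF bm3])
qed

lemma AE_Y_pos:
  assumes s: "s > 0"
  shows "AE \<omega> in M. Y s \<omega> > 0"
proof -
  obtain N :: "(real \<Rightarrow> real ^ 3) measure" and B :: "real \<Rightarrow> (real \<Rightarrow> real ^ 3) \<Rightarrow> real ^ 3" where "bm3 N B"
    and law: "\<And>h. h \<in> borel_measurable path_space \<Longrightarrow>
      distr M borel (\<lambda>\<omega>. h (path_of Y \<omega>)) = distr N borel (\<lambda>\<omega>. h (path_of (\<lambda>t \<omega>. norm (B t \<omega>)) \<omega>) :: real)"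
    using brownian_model by blast
  interpret N: bm3 N B by fact
  have [measurable]: "B s \<in> borel_measurable N" "Y s \<in> borel_measurable M" using s by auto
  have "(\<lambda>p. p s) \<in> borel_measurable path_space"
    using s by (intro measurable_component_singleton) auto
  from law[OF this] have "distr M borel (Y s) = distr N borel (\<lambda>\<omega>. norm (B s \<omega>))"
    using s by (simp add: path_of_def)
  then have "emeasure (distr M borel (Y s)) {0} = emeasure (distr N borel (\<lambda>\<omega>. norm (B s \<omega>))) {0}" by simp
  then have "emeasure M (Y s -` {0} \<inter> space M) = emeasure N ((\<lambda>\<omega>. norm (B s \<omega>)) -` {0} \<inter> space N)"
    by (simp add: emeasure_distr)
  also have "(\<lambda>\<omega>. norm (B s \<omega>)) -` {0} \<inter> space N = (\<lambda>\<omega>. B s \<omega> - B 0 \<omega>) -` {0} \<inter> space N"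
    using N.B_0 by auto
  also have "emeasure N \<dots> = emeasure (distr N borel (\<lambda>\<omega>. B s \<omega> - B 0 \<omega>)) {0}"
    by (subst emeasure_distr) auto
  also have "\<dots> = 0"
    using brownian_motion_distr[OF N.bm, of 0 s] s by (simp add: emeasure_gauss_singleton)
  finally have "AE \<omega> in M. Y s \<omega> \<noteq> 0"
    by (intro AE_I'[of "Y s -` {0} \<inter> space M"]) (auto simp: null_sets_def)
  then show ?thesis
    using AE_space by eventually_elim (use Y_nonneg[of _ s] s in force)
qed

text \<open>The law of the maximum has at most countably many atoms, and outside them
  \<open>prob_maxB_less\<close> applies with radius \<open>\<zeta> * sqrt s\<close>;
  \<open>s\<close> then cancels from the exponent.\<close>

lemma AE_prob_maxY_less:
  assumes s: "s > 0"
  shows "AE \<zeta> in lborel. \<zeta> > 0 \<longrightarrow> prob {\<omega>\<in>space M. maxpath 0 s (\<lambda>t. Y t \<omega>) < \<zeta> * sqrt s}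
    = (\<Sum>k. 2 * (-1) ^ k * exp (- (real (Suc k))\<^sup>2 * (pi\<^sup>2 / (2 * \<zeta>\<^sup>2))))"
proof -
  obtain N :: "(real \<Rightarrow> real ^ 3) measure" and B :: "real \<Rightarrow> (real \<Rightarrow> real ^ 3) \<Rightarrow> real ^ 3" where "bm3 N B"
    and law: "\<And>h. h \<in> borel_measurable path_space \<Longrightarrow>
      distr M borel (\<lambda>\<omega>. h (path_of Y \<omega>)) = distr N borel (\<lambda>\<omega>. h (path_of (\<lambda>t \<omega>. norm (B t \<omega>)) \<omega>) :: real)"
    using brownian_model by blast
  interpret N: bm3 N B by fact
  define R where "R \<omega> = maxpath 0 s (\<lambda>t. Y t \<omega>)" for \<omega>
  define RB where "RB \<omega> = maxpath 0 s (\<lambda>t. norm (B t \<omega>))" for \<omega>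
  have [measurable]: "R \<in> borel_measurable M" "RB \<in> borel_measurable N"
    unfolding R_def[abs_def] RB_def[abs_def] using s by auto
  have D: "distr M borel R = distr N borel RB"
    using law[OF measurable_maxpath[of 0 s]] s by (simp add: maxpath_path_of R_def[abs_def] RB_def[abs_def])
  interpret DN: prob_space "distr N borel RB" by (rule N.prob_space_distr) simp
  define A where "A = {z. measure (distr N borel RB) {z} \<noteq> 0}"
  have "countable A" unfolding A_def by (rule DN.countable_support)
  then have "countable ((\<lambda>z. z / sqrt s) ` A)" by simp
  then have "AE \<zeta> in lborel. \<zeta> \<notin> (\<lambda>z. z / sqrt s) ` A"
    by (intro AE_not_in countable_imp_null_set_lborel)
  then show ?thesis
  proof eventually_elim
    case (elim \<zeta>)
    show ?case
    proof
      assume \<zeta>: "\<zeta> > 0"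
      define z where "z = \<zeta> * sqrt s"
      have z: "z > 0" using \<zeta> s by (simp add: z_def)
      have "\<zeta> = z / sqrt s" using s by (simp add: z_def)
      then have "z \<notin> A" using elim by blast
      then have "N.prob (RB -` {z} \<inter> space N) = 0" unfolding A_def by (simp add: measure_distr)
      then have "AE \<omega> in N. RB \<omega> \<noteq> z"
        by (intro AE_I'[of "RB -` {z} \<inter> space N"]) (auto simp: null_sets_def N.emeasure_eq_measure)
      then have "N.prob {\<omega>\<in>space N. RB \<omega> < z} = (\<Sum>k. 2 * (-1) ^ k * exp (- (real (Suc k))\<^sup>2 * (pi\<^sup>2 * s / (2 * z\<^sup>2))))"
        unfolding RB_def by (rule N.prob_maxB_less[OF s z])
      moreover have "N.prob {\<omega>\<in>space N. RB \<omega> < z} = prob {\<omega>\<in>space M. R \<omega> < z}"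
      proof -
        have "measure (distr N borel RB) {..<z} = N.prob {\<omega>\<in>space N. RB \<omega> < z}"
          by (subst measure_distr) (auto intro!: arg_cong[where f = N.prob])
        moreover have "measure (distr M borel R) {..<z} = prob {\<omega>\<in>space M. R \<omega> < z}"
          by (subst measure_distr) (auto intro!: arg_cong[where f = prob])
        ultimately show ?thesis using D by simp
      qed
      moreover have "pi\<^sup>2 * s / (2 * z\<^sup>2) = pi\<^sup>2 / (2 * \<zeta>\<^sup>2)"
        using s by (simp add: z_def power_mult_distrib)
      ultimately show "prob {\<omega>\<in>space M. maxpath 0 s (\<lambda>t. Y t \<omega>) < \<zeta> * sqrt s}
        = (\<Sum>k. 2 * (-1) ^ k * exp (- (real (Suc k))\<^sup>2 * (pi\<^sup>2 / (2 * \<zeta>\<^sup>2))))"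
        unfolding R_def z_def by simp
    qed
  qed
qed

text \<open>The scale, the maximum and the normalised lattice shift are functions of the three
  independent sources. This is why the shift is expressed by \<open>binx\<close>, which does not
  involve \<theta>; its law is uniform at every \<open>j\<close>.\<close>

lemma nn_integral_triple:
  assumes [measurable]: "(\<lambda>(\<theta>, r, v). h \<theta> r v) \<in> borel_measurable (borel \<Otimes>\<^sub>M borel \<Otimes>\<^sub>M borel)" and s: "s \<ge> 0"
  shows "(\<integral>\<^sup>+\<omega>. h (\<Theta> \<omega>) (maxpath 0 s (\<lambda>t. Y t \<omega>)) (binx j (\<lambda>i. W i \<omega>)) \<partial>M)
    = (\<integral>\<^sup>+\<theta>. (\<integral>\<^sup>+r. (\<integral>\<^sup>+v. h \<theta> r v \<partial>uniform_measure lborel {0..1})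
         \<partial>distr M borel (\<lambda>\<omega>. maxpath 0 s (\<lambda>t. Y t \<omega>))) \<partial>uniform_measure lborel {0..1})"
proof -
  let ?S = "\<Pi>\<^sub>M i\<in>(UNIV :: int set). sign_space"
  let ?w = "\<lambda>\<omega> i. W i \<omega>"
  note [measurable] = path_rv W_family_rv
  have mp [measurable]: "maxpath 0 s \<in> borel_measurable path_space" using s by (intro measurable_maxpath) auto
  have d1: "distr M (path_space \<Otimes>\<^sub>M ?S) (\<lambda>\<omega>. (path_of Y \<omega>, ?w \<omega>)) = distr M path_space (path_of Y) \<Otimes>\<^sub>M distr M ?S ?w"
    by (rule distr_pair_indep_set[OF path_rv W_family_rv Y_W_indep])
  have d2: "distr M (borel \<Otimes>\<^sub>M (path_space \<Otimes>\<^sub>M ?S)) (\<lambda>\<omega>. (\<Theta> \<omega>, (path_of Y \<omega>, ?w \<omega>)))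
    = distr M borel \<Theta> \<Otimes>\<^sub>M (distr M path_space (path_of Y) \<Otimes>\<^sub>M distr M ?S ?w)"
    unfolding d1[symmetric] by (rule distr_pair_indep_set[OF _ _ Theta_indep]) measurable
  interpret T: prob_space "distr M borel \<Theta>" by (rule prob_space_distr) measurable
  interpret P: prob_space "distr M path_space (path_of Y)" by (rule prob_space_distr) measurable
  interpret S: prob_space "distr M ?S ?w" by (rule prob_space_distr) measurable
  interpret PS: pair_prob_space "distr M path_space (path_of Y)" "distr M ?S ?w" ..
  define g where "g x = h (fst x) (maxpath 0 s (fst (snd x))) (binx j (snd (snd x)))" for x :: "real \<times> (real \<Rightarrow> real) \<times> (int \<Rightarrow> real)"
  have gm [measurable]: "g \<in> borel_measurable (borel \<Otimes>\<^sub>M (path_space \<Otimes>\<^sub>M ?S))"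
  proof -
    have "(\<lambda>x. (fst x, maxpath 0 s (fst (snd x)), binx j (snd (snd x)))) \<in> measurable (borel \<Otimes>\<^sub>M (path_space \<Otimes>\<^sub>M ?S)) (borel \<Otimes>\<^sub>M borel \<Otimes>\<^sub>M borel)"
      by measurable
    from measurable_compose[OF this assms(1)] show ?thesis by (simp add: g_def[abs_def] split_beta')
  qed
  have "(\<integral>\<^sup>+\<omega>. h (\<Theta> \<omega>) (maxpath 0 s (\<lambda>t. Y t \<omega>)) (binx j (?w \<omega>)) \<partial>M) = (\<integral>\<^sup>+\<omega>. g (\<Theta> \<omega>, (path_of Y \<omega>, ?w \<omega>)) \<partial>M)"
    using s by (simp add: g_def maxpath_path_of)
  also have "\<dots> = (\<integral>\<^sup>+x. g x \<partial>distr M (borel \<Otimes>\<^sub>M (path_space \<Otimes>\<^sub>M ?S)) (\<lambda>\<omega>. (\<Theta> \<omega>, (path_of Y \<omega>, ?w \<omega>))))"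
    by (subst nn_integral_distr) auto
  also have "\<dots> = (\<integral>\<^sup>+\<theta>. (\<integral>\<^sup>+x. g (\<theta>, x) \<partial>(distr M path_space (path_of Y) \<Otimes>\<^sub>M distr M ?S ?w)) \<partial>distr M borel \<Theta>)"
    unfolding d2 by (rule PS.nn_integral_fst[symmetric]) simp
  also have "\<dots> = (\<integral>\<^sup>+\<theta>. (\<integral>\<^sup>+p. (\<integral>\<^sup>+w. g (\<theta>, p, w) \<partial>distr M ?S ?w) \<partial>distr M path_space (path_of Y)) \<partial>distr M borel \<Theta>)"
    by (intro nn_integral_cong S.nn_integral_fst[symmetric]) simp
  also have "\<dots> = (\<integral>\<^sup>+\<theta>. (\<integral>\<^sup>+p. (\<integral>\<^sup>+v. h \<theta> (maxpath 0 s p) v \<partial>uniform_measure lborel {0..1}) \<partial>distr M path_space (path_of Y)) \<partial>distr M borel \<Theta>)"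
  proof (intro nn_integral_cong)
    fix \<theta> p
    have hv: "(\<lambda>v. h \<theta> (maxpath 0 s p) v) \<in> borel_measurable borel"
      using measurable_compose[OF _ assms(1), of "\<lambda>v. (\<theta>, maxpath 0 s p, v)" borel] by simp
    have "(\<integral>\<^sup>+w. g (\<theta>, p, w) \<partial>distr M ?S ?w) = (\<integral>\<^sup>+\<omega>. h \<theta> (maxpath 0 s p) (binx j (?w \<omega>)) \<partial>M)"
      by (subst nn_integral_distr) (auto simp: g_def intro!: measurable_compose[OF measurable_binx hv])
    also have "\<dots> = (\<integral>\<^sup>+v. h \<theta> (maxpath 0 s p) v \<partial>distr M borel (\<lambda>\<omega>. binx j (?w \<omega>)))"
      by (subst nn_integral_distr) (auto intro: hv)
    finally show "(\<integral>\<^sup>+w. g (\<theta>, p, w) \<partial>distr M ?S ?w) = (\<integral>\<^sup>+v. h \<theta> (maxpath 0 s p) v \<partial>uniform_measure lborel {0..1})"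
      unfolding distr_binx_uniform .
  qed
  also have "\<dots> = (\<integral>\<^sup>+\<theta>. (\<integral>\<^sup>+r. (\<integral>\<^sup>+v. h \<theta> r v \<partial>uniform_measure lborel {0..1})
         \<partial>distr M borel (\<lambda>\<omega>. maxpath 0 s (\<lambda>t. Y t \<omega>))) \<partial>uniform_measure lborel {0..1})"
    unfolding Theta_distr
  proof (intro nn_integral_cong)
    fix \<theta>
    interpret U: prob_space "uniform_measure lborel {0..1::real}" by (rule prob_space_uniform_measure) auto
    have [measurable]: "(\<lambda>(r, v). h \<theta> r v) \<in> borel_measurable (borel \<Otimes>\<^sub>M borel)"
      using measurable_compose[OF _ assms(1), of "\<lambda>x. (\<theta>, fst x, snd x)" "borel \<Otimes>\<^sub>M borel"] by (simp add: split_beta')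
    have [measurable]: "(\<lambda>r. \<integral>\<^sup>+v. h \<theta> r v \<partial>uniform_measure lborel {0..1}) \<in> borel_measurable borel"
      by (rule U.borel_measurable_nn_integral) measurable
    show "(\<integral>\<^sup>+p. (\<integral>\<^sup>+v. h \<theta> (maxpath 0 s p) v \<partial>uniform_measure lborel {0..1}) \<partial>distr M path_space (path_of Y))
      = (\<integral>\<^sup>+r. (\<integral>\<^sup>+v. h \<theta> r v \<partial>uniform_measure lborel {0..1}) \<partial>distr M borel (\<lambda>\<omega>. maxpath 0 s (\<lambda>t. Y t \<omega>)))"
      using s by (subst (1 2) nn_integral_distr) (auto simp: maxpath_path_of)
  qed
  finally show ?thesis .
qed

end

section \<open>Decomposition of the event by the band of the maximum\<close>

context dyadic_coupling
begin

context
  fixes \<alpha> \<beta> s :: real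
  assumes less: "\<alpha> < \<beta>" and s: "s > 0"
begin

abbreviation "maxY \<omega> \<equiv> maxpath 0 s (\<lambda>t. Y t \<omega>)"

definition in_band :: "int \<Rightarrow> 'a \<Rightarrow> bool" where
  "in_band i \<omega> \<longleftrightarrow> dyad (\<Theta> \<omega>) (i - 1) \<le> maxY \<omega> \<and> maxY \<omega> < dyad (\<Theta> \<omega>) i"

definition apart :: "int \<Rightarrow> 'a \<Rightarrow> bool" where
  "apart i \<omega> \<longleftrightarrow> cell (\<lambda>k. W k \<omega>) (\<Theta> \<omega>) \<alpha> i \<noteq> cell (\<lambda>k. W k \<omega>) (\<Theta> \<omega>) \<beta> i"

text \<open>Compares the positions at \<open>Y = 0\<close>, the only value of \<open>Y\<close> below
  the top of the band at which particles from distinct cells can meet.\<close>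

definition apart_at_0 :: "int \<Rightarrow> 'a \<Rightarrow> bool" where
  "apart_at_0 i \<omega> \<longleftrightarrow> shifted (\<lambda>k. W k \<omega>) (\<Theta> \<omega>) i (- (dyad (\<Theta> \<omega>) i / 2)) \<alpha>
     \<noteq> shifted (\<lambda>k. W k \<omega>) (\<Theta> \<omega>) i (- (dyad (\<Theta> \<omega>) i / 2)) \<beta>"

definition differ :: "'a \<Rightarrow> bool" where
  "differ \<omega> \<longleftrightarrow> (\<exists>t\<ge>s. dyadic_grand_coupling Y W \<Theta> \<alpha> t \<omega> \<noteq> dyadic_grand_coupling Y W \<Theta> \<beta> t \<omega>)"

lemma maxY_measurable [measurable]: "maxY \<in> borel_measurable M"
  using s by (intro maxY_rv) auto

lemma dyad_rv [measurable]: "(\<lambda>\<omega>. dyad (\<Theta> \<omega>) i) \<in> borel_measurable M"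
  by (rule measurable_compose[OF Theta_measurable measurable_dyad])

lemma in_band_measurable [measurable]: "Measurable.pred M (in_band i)"
  unfolding in_band_def[abs_def] by measurable

lemma cell_rv: "(\<lambda>\<omega>. cell (\<lambda>k. W k \<omega>) (\<Theta> \<omega>) \<gamma> i) \<in> measurable M (count_space UNIV)"
  unfolding cell_eq_binx by (rule measurable_compose[OF _ measurable_real_floor]) measurable

lemma apart_measurable [measurable]: "Measurable.pred M (apart i)"
  unfolding apart_def[abs_def] cell_eq_binx by measurable

lemma shifted_rv: "(\<lambda>\<omega>. shifted (\<lambda>k. W k \<omega>) (\<Theta> \<omega>) i (- (dyad (\<Theta> \<omega>) i / 2)) \<gamma>) \<in> borel_measurable M"
proof -
  note [measurable] = cell_rv
  have "(\<lambda>\<omega>. dyad (\<Theta> \<omega>) i * (binx i (\<lambda>k. W k \<omega>) - 1 / 2)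
      + dyad (\<Theta> \<omega>) i * of_int (cell (\<lambda>k. W k \<omega>) (\<Theta> \<omega>) \<gamma> i)
      + - (dyad (\<Theta> \<omega>) i / 2) * (if even (cell (\<lambda>k. W k \<omega>) (\<Theta> \<omega>) \<gamma> i) then W i \<omega> else - W i \<omega>)) \<in> borel_measurable M"
    by measurable
  moreover have "shifted (\<lambda>k. W k \<omega>) (\<Theta> \<omega>) i (- (dyad (\<Theta> \<omega>) i / 2)) \<gamma> =
      dyad (\<Theta> \<omega>) i * (binx i (\<lambda>k. W k \<omega>) - 1 / 2)
      + dyad (\<Theta> \<omega>) i * of_int (cell (\<lambda>k. W k \<omega>) (\<Theta> \<omega>) \<gamma> i)
      + - (dyad (\<Theta> \<omega>) i / 2) * (if even (cell (\<lambda>k. W k \<omega>) (\<Theta> \<omega>) \<gamma> i) then W i \<omega> else - W i \<omega>)" if "\<omega> \<in> space M" for \<omega>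
    unfolding shifted_def landing_eq[of "\<lambda>k. W k \<omega>", OF W_sign[OF that]] dyadic_G_eq sgn_sum_eq_binx ..
  ultimately show ?thesis by (subst measurable_cong) auto
qed

lemma apart_at_0_measurable [measurable]: "Measurable.pred M (apart_at_0 i)"
proof -
  note [measurable] = shifted_rv
  show ?thesis unfolding apart_at_0_def[abs_def] by measurable
qed

text \<open>Positivity at some time of an unbounded interval is reduced to countably many maxima
  over \<open>{s..s + real n}\<close>.\<close>

lemma positive_measurable: "Measurable.pred M (\<lambda>\<omega>. \<exists>t\<ge>s. 0 < Y t \<omega>)"
proof -
  have "(\<lambda>\<omega>. maxpath s (real n) (\<lambda>t. Y t \<omega>)) \<in> borel_measurable M" for n
    using s by (intro maxY_rv) auto
  then have "Measurable.pred M (\<lambda>\<omega>. \<exists>n::nat. 0 < maxpath s (real n) (\<lambda>t. Y t \<omega>))"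
    by measurable
  moreover have "(\<exists>n::nat. 0 < maxpath s (real n) (\<lambda>t. Y t \<omega>)) \<longleftrightarrow> (\<exists>t\<ge>s. 0 < Y t \<omega>)" if "\<omega> \<in> space M" for \<omega>
  proof -
    have "(\<exists>n::nat. 0 < maxpath s (real n) (\<lambda>t. Y t \<omega>)) \<longleftrightarrow> (\<exists>n::nat. \<exists>t\<in>{s..s + real n}. 0 < Y t \<omega>)"
      using maxY_iff(3)[OF that, of s] s by simp
    also have "\<dots> \<longleftrightarrow> (\<exists>t\<ge>s. 0 < Y t \<omega>)"
    proof
      assume "\<exists>t\<ge>s. 0 < Y t \<omega>"
      then obtain t where t: "s \<le> t" "0 < Y t \<omega>" by blast
      obtain n where "t - s \<le> real n" using real_arch_simple by blast
      then have "t \<in> {s..s + real n}" using t by simp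
      then show "\<exists>n::nat. \<exists>t\<in>{s..s + real n}. 0 < Y t \<omega>" using t(2) by blast
    qed auto
    finally show ?thesis .
  qed
  ultimately show ?thesis by (subst measurable_cong[symmetric]) auto
qed

lemma maxY_nonneg: "\<omega> \<in> space M \<Longrightarrow> 0 \<le> maxY \<omega>"
  unfolding maxpath_def by simp

lemma differ_in_band:
  assumes \<omega>: "\<omega> \<in> space M" and i: "in_band i \<omega>"
  shows "differ \<omega> \<longleftrightarrow> apart i \<omega> \<and> ((\<exists>t\<ge>s. 0 < Y t \<omega>) \<or> apart_at_0 i \<omega>)"
proof -
  have "dyad (\<Theta> \<omega>) (i - 1) \<le> maxY \<omega>" "maxY \<omega> < dyad (\<Theta> \<omega>) i" using i by (auto simp: in_band_def)
  then obtain u where "u \<in> {0..0 + s}" "dyad (\<Theta> \<omega>) (i - 1) \<le> Y u \<omega>" "\<forall>u\<in>{0..0 + s}. Y u \<omega> < dyad (\<Theta> \<omega>) i"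
    using maxY_iff(1,2)[OF \<omega>, of 0 s] s by auto
  then show ?thesis
    using dyadic_path.event_index[OF path[OF \<omega>] s less_imp_le[OF less], of u "\<Theta> \<omega>" i]
    unfolding differ_def apart_def apart_at_0_def dyadic_grand_coupling_def by simp
qed

lemma differ_no_band:
  assumes \<omega>: "\<omega> \<in> space M" and z: "maxY \<omega> = 0"
  shows "differ \<omega> \<longleftrightarrow> (\<exists>t\<ge>s. 0 < Y t \<omega>) \<or> apart_at_0 dyadic_path.no_index \<omega>"
proof -
  have "\<not> (\<exists>u\<in>{0..0 + s}. 0 < Y u \<omega>)"
    using maxY_iff(3)[OF \<omega>, of 0 s 0] s z by simp
  then have "Y u \<omega> = 0" if "u \<in> {0..s}" for u using Y_nonneg[OF \<omega>, of u] that by force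
  from dyadic_path.event_no_index[OF path[OF \<omega>] s less this, of "\<Theta> \<omega>"]
  show ?thesis
    unfolding differ_def apart_def apart_at_0_def dyadic_grand_coupling_def by simp
qed

lemma band_exists:
  assumes "\<omega> \<in> space M" "maxY \<omega> \<noteq> 0"
  shows "\<exists>i. in_band i \<omega>"
proof -
  have "maxY \<omega> > 0" using maxY_nonneg assms by force
  then show ?thesis using dyad_bracket[of "maxY \<omega>" "\<Theta> \<omega>"] unfolding in_band_def by metis
qed

text \<open>
  \<open>M\<close> need not be complete, so the measurability of the event requires a description of it also on the
  null event that \<open>Y s = 0\<close>.
\<close>

lemma differ_iff:
  assumes \<omega>: "\<omega> \<in> space M"
  shows "differ \<omega> \<longleftrightarrow>
    (\<exists>i. in_band i \<omega> \<and> apart i \<omega> \<and> ((\<exists>t\<ge>s. 0 < Y t \<omega>) \<or> apart_at_0 i \<omega>)) \<or>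
    maxY \<omega> = 0 \<and> ((\<exists>t\<ge>s. 0 < Y t \<omega>) \<or> apart_at_0 dyadic_path.no_index \<omega>)"
proof (cases "maxY \<omega> = 0")
  case True
  then have "\<not> in_band i \<omega>" for i using dyad_pos[of "\<Theta> \<omega>" "i - 1"] unfolding in_band_def by linarith
  then show ?thesis using differ_no_band[OF \<omega> True] True by blast
next
  case False
  then show ?thesis using band_exists[OF \<omega>] differ_in_band[OF \<omega>] by blast
qed

lemma differ_measurable: "Measurable.pred M differ"
proof -
  note [measurable] = positive_measurable
  have "Measurable.pred M (\<lambda>\<omega>. (\<exists>i. in_band i \<omega> \<and> apart i \<omega> \<and> ((\<exists>t\<ge>s. 0 < Y t \<omega>) \<or> apart_at_0 i \<omega>)) \<or>
    maxY \<omega> = 0 \<and> ((\<exists>t\<ge>s. 0 < Y t \<omega>) \<or> apart_at_0 dyadic_path.no_index \<omega>))"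
    by measurable
  then show ?thesis by (subst measurable_cong[OF differ_iff]) auto
qed

lemma AE_differ_iff: "AE \<omega> in M. differ \<omega> \<longleftrightarrow> (\<exists>i. in_band i \<omega> \<and> apart i \<omega>)"
  using AE_Y_pos[OF s] AE_space
proof eventually_elim
  case (elim \<omega>)
  have p: "\<exists>t\<ge>s. 0 < Y t \<omega>" using elim by blast
  have "\<exists>u\<in>{0..0 + s}. 0 < Y u \<omega>" using elim s by (intro bexI[of _ s]) auto
  then have "0 < maxY \<omega>" using maxY_iff(3)[OF elim(2), of 0 s 0] s by simp
  then show ?case using differ_iff[OF elim(2)] p by auto
qed

lemma emeasure_differ:
  "emeasure M {\<omega>\<in>space M. differ \<omega>} = (\<integral>\<^sup>+i. emeasure M {\<omega>\<in>space M. in_band i \<omega> \<and> apart i \<omega>} \<partial>count_space UNIV)"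
proof -
  note [measurable] = differ_measurable
  have "emeasure M {\<omega>\<in>space M. differ \<omega>} = emeasure M {\<omega>\<in>space M. \<exists>i. in_band i \<omega> \<and> apart i \<omega>}"
    by (rule emeasure_eq_AE) (use AE_differ_iff in \<open>auto elim!: eventually_mono\<close>)
  also have "{\<omega>\<in>space M. \<exists>i. in_band i \<omega> \<and> apart i \<omega>} = (\<Union>i. {\<omega>\<in>space M. in_band i \<omega> \<and> apart i \<omega>})" by auto
  also have "emeasure M \<dots> = (\<integral>\<^sup>+i. emeasure M {\<omega>\<in>space M. in_band i \<omega> \<and> apart i \<omega>} \<partial>count_space UNIV)"
  proof (rule emeasure_UN_countable)
    have "i = j" if "in_band i \<omega>" "in_band j \<omega>" for i j \<omega>
    proof -
      have "\<not> i \<le> j - 1" "\<not> j \<le> i - 1"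
        using that dyad_mono[of i "j - 1" "\<Theta> \<omega>"] dyad_mono[of j "i - 1" "\<Theta> \<omega>"] unfolding in_band_def by linarith+
      then show ?thesis by linarith
    qed
    then show "disjoint_family (\<lambda>i. {\<omega>\<in>space M. in_band i \<omega> \<and> apart i \<omega>})"
      unfolding disjoint_family_on_def by blast
  qed auto
  finally show ?thesis .
qed

section \<open>Averaging over shift, scale and maximum\<close>

abbreviation "lawR \<equiv> distr M borel maxY"

abbreviation "g x \<equiv> min ((\<beta> - \<alpha>) / 2 powr x) 1"

text \<open>For fixed \<theta> and maximum \<open>r\<close>, only the uniform shift is random, and a
  cell boundary falls between \<alpha> and \<beta> with probability \<open>g (\<theta> + i)\<close>.
  The band condition reads \<open>r < 2 powr x \<le> 2 * r\<close> at
  \<open>x = \<theta> + i\<close>.\<close>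

lemma emeasure_band_apart:
  "emeasure M {\<omega>\<in>space M. in_band i \<omega> \<and> apart i \<omega>} =
    (\<integral>\<^sup>+\<theta>. (\<integral>\<^sup>+r. ennreal (g (\<theta> + of_int i)) * indicator {x. r < 2 powr x \<and> 2 powr x \<le> 2 * r} (\<theta> + of_int i) \<partial>lawR)
      \<partial>uniform_measure lborel {0..1})"
proof -
  define h where "h \<theta> r v = (if dyad \<theta> (i - 1) \<le> r \<and> r < dyad \<theta> i \<and>
      \<lfloor>\<alpha> / dyad \<theta> i + 1 - v\<rfloor> \<noteq> \<lfloor>\<beta> / dyad \<theta> i + 1 - v\<rfloor> then 1 else 0 :: ennreal)" for \<theta> r v
  have hm: "(\<lambda>(\<theta>, r, v). h \<theta> r v) \<in> borel_measurable (borel \<Otimes>\<^sub>M borel \<Otimes>\<^sub>M borel)"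
    unfolding h_def split_beta' by measurable
  have "emeasure M {\<omega>\<in>space M. in_band i \<omega> \<and> apart i \<omega>} = (\<integral>\<^sup>+\<omega>. indicator {\<omega>\<in>space M. in_band i \<omega> \<and> apart i \<omega>} \<omega> \<partial>M)"
    by (rule nn_integral_indicator[symmetric]) measurable
  also have "\<dots> = (\<integral>\<^sup>+\<omega>. h (\<Theta> \<omega>) (maxY \<omega>) (binx i (\<lambda>k. W k \<omega>)) \<partial>M)"
    by (intro nn_integral_cong) (auto simp: h_def in_band_def apart_def cell_eq_binx indicator_def)
  also have "\<dots> = (\<integral>\<^sup>+\<theta>. (\<integral>\<^sup>+r. (\<integral>\<^sup>+v. h \<theta> r v \<partial>uniform_measure lborel {0..1}) \<partial>lawR) \<partial>uniform_measure lborel {0..1})"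
    by (rule nn_integral_triple[OF hm]) (use s in simp)
  also have "\<dots> = (\<integral>\<^sup>+\<theta>. (\<integral>\<^sup>+r. ennreal (g (\<theta> + of_int i)) * indicator {x. r < 2 powr x \<and> 2 powr x \<le> 2 * r} (\<theta> + of_int i) \<partial>lawR)
      \<partial>uniform_measure lborel {0..1})"
  proof (intro nn_integral_cong)
    fix \<theta> r :: real
    have d: "2 powr (\<theta> + of_int i) = dyad \<theta> i" by (simp add: dyad_def add.commute)
    have "(\<integral>\<^sup>+v. h \<theta> r v \<partial>uniform_measure lborel {0..1}) =
      (\<integral>\<^sup>+v. indicator {x. r < 2 powr x \<and> 2 powr x \<le> 2 * r} (\<theta> + of_int i) *
        indicator {v. \<lfloor>\<alpha> / dyad \<theta> i + 1 - v\<rfloor> \<noteq> \<lfloor>\<beta> / dyad \<theta> i + 1 - v\<rfloor>} v \<partial>uniform_measure lborel {0..1})"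
      by (intro nn_integral_cong) (auto simp: h_def indicator_def d dyad_minus_1)
    also have "\<dots> = indicator {x. r < 2 powr x \<and> 2 powr x \<le> 2 * r} (\<theta> + of_int i) *
      (\<integral>\<^sup>+v. indicator {v. \<lfloor>\<alpha> / dyad \<theta> i + 1 - v\<rfloor> \<noteq> \<lfloor>\<beta> / dyad \<theta> i + 1 - v\<rfloor>} v \<partial>uniform_measure lborel {0..1})"
      by (rule nn_integral_cmult) measurable
    also have "(\<integral>\<^sup>+v. indicator {v. \<lfloor>\<alpha> / dyad \<theta> i + 1 - v\<rfloor> \<noteq> \<lfloor>\<beta> / dyad \<theta> i + 1 - v\<rfloor>} v \<partial>uniform_measure lborel {0..1})
       = ennreal (g (\<theta> + of_int i))"
      using less by (subst emeasure_floor_neq) (auto simp: d divide_strict_right_mono diff_divide_distrib)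
    finally show "(\<integral>\<^sup>+v. h \<theta> r v \<partial>uniform_measure lborel {0..1}) =
      ennreal (g (\<theta> + of_int i)) * indicator {x. r < 2 powr x \<and> 2 powr x \<le> 2 * r} (\<theta> + of_int i)"
      by (simp add: mult.commute)
  qed
  finally show ?thesis .
qed

lemma prob_lawR: "prob_space lawR"
  by (rule prob_space_distr) measurable

text \<open>Summing over \<open>i\<close> and averaging over \<theta> makes
  \<open>x = \<theta> + i\<close> run over the line with Lebesgue measure; Tonelli's theorem moves
  the average over the maximum outermost.\<close>

lemma emeasure_differ_law:
  "emeasure M {\<omega>\<in>space M. differ \<omega>} =
    (\<integral>\<^sup>+r. (\<integral>\<^sup>+x. ennreal (g x) * indicator {x. r < 2 powr x \<and> 2 powr x \<le> 2 * r} x \<partial>lborel) \<partial>lawR)"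
proof -
  define f where "f r x = ennreal (g x) * indicator {x. r < 2 powr x \<and> 2 powr x \<le> 2 * r} x" for r x
  interpret R: prob_space lawR by (rule prob_lawR)
  interpret U: prob_space "uniform_measure lborel {0..1::real}" by (rule prob_space_uniform_measure) auto
  interpret RU: pair_prob_space lawR "uniform_measure lborel {0..1::real}" ..
  have fm: "(\<lambda>z. f (fst z) (snd z + of_int i)) \<in> borel_measurable (borel \<Otimes>\<^sub>M borel)" for i :: int
    unfolding f_def by measurable
  have fm1: "(\<lambda>x. f r x) \<in> borel_measurable borel" for r
    unfolding f_def by measurable
  have fm2: "(\<lambda>r. \<integral>\<^sup>+\<theta>. f r (\<theta> + of_int i) \<partial>uniform_measure lborel {0..1}) \<in> borel_measurable borel" for i :: int
    using fm[of i] by (intro U.borel_measurable_nn_integral) (simp add: split_beta')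
  have "emeasure M {\<omega>\<in>space M. differ \<omega>} =
     (\<integral>\<^sup>+i. (\<integral>\<^sup>+\<theta>. (\<integral>\<^sup>+r. f r (\<theta> + of_int i) \<partial>lawR) \<partial>uniform_measure lborel {0..1}) \<partial>count_space UNIV)"
    unfolding emeasure_differ emeasure_band_apart f_def ..
  also have "\<dots> = (\<integral>\<^sup>+i. (\<integral>\<^sup>+r. (\<integral>\<^sup>+\<theta>. f r (\<theta> + of_int i) \<partial>uniform_measure lborel {0..1}) \<partial>lawR) \<partial>count_space UNIV)"
    by (intro nn_integral_cong RU.Fubini') (use fm in \<open>simp add: split_beta'\<close>)
  also have "\<dots> = (\<integral>\<^sup>+r. (\<integral>\<^sup>+i. (\<integral>\<^sup>+\<theta>. f r (\<theta> + of_int i) \<partial>uniform_measure lborel {0..1}) \<partial>count_space UNIV) \<partial>lawR)"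
    by (rule nn_integral_count_space_nn_integral[symmetric]) (use fm2 in auto)
  also have "\<dots> = (\<integral>\<^sup>+r. (\<integral>\<^sup>+\<theta>. (\<integral>\<^sup>+i. f r (\<theta> + of_int i) \<partial>count_space UNIV) \<partial>uniform_measure lborel {0..1}) \<partial>lawR)"
    by (intro nn_integral_cong nn_integral_count_space_nn_integral[symmetric])
       (auto intro!: measurable_compose[OF _ fm1])
  also have "\<dots> = (\<integral>\<^sup>+r. (\<integral>\<^sup>+x. f r x \<partial>lborel) \<partial>lawR)"
    by (intro nn_integral_cong nn_integral_periodize fm1)
  finally show ?thesis unfolding f_def .
qed

lemma nn_integral_kern_scaled:
  assumes r: "r > 0"
  shows "(\<integral>\<^sup>+x. ennreal (g x) * indicator {x. r < 2 powr x \<and> 2 powr x \<le> 2 * r} x \<partial>lborel) =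
    (\<integral>\<^sup>+\<zeta>. ennreal (kern ((\<beta> - \<alpha>) / sqrt s) \<zeta>) * indicator {(\<beta> - \<alpha>) / sqrt s / 2..} \<zeta> * indicator {\<zeta>. r / sqrt s < \<zeta>} \<zeta> \<partial>lborel)"
proof -
  \<comment> \<open>Translating \<open>x\<close> by \<open>c\<close> multiplies
    \<open>2 powr x\<close> by \<open>sqrt s\<close>, so lengths are measured in units of
    \<open>sqrt s\<close>.\<close>
  define c where "c = log 2 (sqrt s)"
  have c: "2 powr (c + x) = sqrt s * 2 powr x" for x using s by (simp add: c_def powr_add)
  have "(\<integral>\<^sup>+x. ennreal (g x) * indicator {x. r < 2 powr x \<and> 2 powr x \<le> 2 * r} x \<partial>lborel) =
    (\<integral>\<^sup>+x. ennreal (g (c + x)) * indicator {x. r < 2 powr x \<and> 2 powr x \<le> 2 * r} (c + x) \<partial>lborel)"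
    by (subst lborel_distr_plus[symmetric, of c]) (simp add: nn_integral_distr)
  also have "\<dots> = (\<integral>\<^sup>+x. ennreal (min ((\<beta> - \<alpha>) / sqrt s / 2 powr x) 1) *
      indicator {x. r / sqrt s < 2 powr x \<and> 2 powr x \<le> 2 * (r / sqrt s)} x \<partial>lborel)"
  proof (rule nn_integral_cong)
    fix x
    have "g (c + x) = min ((\<beta> - \<alpha>) / sqrt s / 2 powr x) 1" unfolding c by simp
    moreover have "r < 2 powr (c + x) \<and> 2 powr (c + x) \<le> 2 * r \<longleftrightarrow> r / sqrt s < 2 powr x \<and> 2 powr x \<le> 2 * (r / sqrt s)"
      unfolding c using s by (simp add: field_simps)
    ultimately show "ennreal (g (c + x)) * indicator {x. r < 2 powr x \<and> 2 powr x \<le> 2 * r} (c + x) =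
      ennreal (min ((\<beta> - \<alpha>) / sqrt s / 2 powr x) 1) *
      indicator {x. r / sqrt s < 2 powr x \<and> 2 powr x \<le> 2 * (r / sqrt s)} x"
      by (simp only: indicator_def mem_Collect_eq)
  qed
  also have "\<dots> = (\<integral>\<^sup>+\<zeta>. ennreal (kern ((\<beta> - \<alpha>) / sqrt s) \<zeta>) * indicator {(\<beta> - \<alpha>) / sqrt s / 2..} \<zeta> * indicator {\<zeta>. r / sqrt s < \<zeta>} \<zeta> \<partial>lborel)"
    by (rule nn_integral_kern) (use less s r in auto)
  finally show ?thesis .
qed

lemma kern_nonneg: "\<psi> > 0 \<Longrightarrow> \<psi> / 2 \<le> \<zeta> \<Longrightarrow> 0 \<le> kern \<psi> \<zeta>"
  unfolding kern_def by (intro mult_nonneg_nonneg divide_nonneg_nonneg) (auto simp: field_simps power_int_minus min_def)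

lemma measurable_kern [measurable]: "kern \<psi> \<in> borel_measurable borel"
proof -
  have "kern \<psi> = (\<lambda>\<zeta>. inverse (\<zeta>\<^sup>2) * \<psi> / ln 2 * (min (\<zeta> * inverse \<psi>) 1 - 1 / 2))"
    by (simp add: kern_def fun_eq_iff power_int_minus)
  then show ?thesis by simp
qed

text \<open>The weight of a maximum \<open>r\<close> has been written as the mass of
  \<open>kern\<close> above \<open>r / sqrt s\<close>. Exchanging the integrals therefore replaces
  the law of the maximum by the probability of staying below \<open>\<zeta> * sqrt s\<close>, which
  is known for almost every \<zeta>.\<close>

lemma prob_differ:
  "prob {\<omega>\<in>space M. differ \<omega>} =
    (LBINT \<zeta>:{(\<beta> - \<alpha>) / sqrt s / 2..}.
      (\<Sum>k. 2 * (-1) ^ k * exp (- (real (Suc k))\<^sup>2 * (pi\<^sup>2 / (2 * \<zeta>\<^sup>2)))) * kern ((\<beta> - \<alpha>) / sqrt s) \<zeta>)"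
proof -
  define \<psi> where "\<psi> = (\<beta> - \<alpha>) / sqrt s"
  have \<psi>: "\<psi> > 0" using less s by (simp add: \<psi>_def)
  interpret R: prob_space lawR by (rule prob_lawR)
  interpret LR: pair_sigma_finite lawR "lborel :: real measure" ..
  define P where "P \<zeta> = prob {\<omega>\<in>space M. maxY \<omega> < \<zeta> * sqrt s}" for \<zeta>
  define F where "F \<zeta> = (\<Sum>k. 2 * (-1) ^ k * exp (- (real (Suc k))\<^sup>2 * (pi\<^sup>2 / (2 * \<zeta>\<^sup>2))))" for \<zeta>
  define K where "K \<zeta> = ennreal (kern \<psi> \<zeta>) * indicator {\<psi> / 2..} \<zeta>" for \<zeta>
  have [measurable]: "K \<in> borel_measurable borel" unfolding K_def[abs_def] by measurable
  have "AE \<omega> in M. 0 < maxY \<omega>"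
    using AE_Y_pos[OF s] AE_space
  proof eventually_elim
    case (elim \<omega>)
    have "\<exists>u\<in>{0..0 + s}. 0 < Y u \<omega>" using elim s by (intro bexI[of _ s]) auto
    then show ?case using maxY_iff(3)[OF elim(2), of 0 s 0] s by simp
  qed
  then have AEr: "AE r in lawR. 0 < r" by (subst AE_distr_iff) auto
  have "emeasure M {\<omega>\<in>space M. differ \<omega>} = (\<integral>\<^sup>+r. (\<integral>\<^sup>+\<zeta>. K \<zeta> * indicator {\<zeta>. r / sqrt s < \<zeta>} \<zeta> \<partial>lborel) \<partial>lawR)"
    unfolding emeasure_differ_law
  proof (rule nn_integral_cong_AE)
    show "AE r in lawR. (\<integral>\<^sup>+x. ennreal (g x) * indicator {x. r < 2 powr x \<and> 2 powr x \<le> 2 * r} x \<partial>lborel)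
       = (\<integral>\<^sup>+\<zeta>. K \<zeta> * indicator {\<zeta>. r / sqrt s < \<zeta>} \<zeta> \<partial>lborel)"
      using AEr by eventually_elim (simp only: nn_integral_kern_scaled K_def \<psi>_def)
  qed
  also have "\<dots> = (\<integral>\<^sup>+\<zeta>. (\<integral>\<^sup>+r. K \<zeta> * indicator {\<zeta>. r / sqrt s < \<zeta>} \<zeta> \<partial>lawR) \<partial>lborel)"
    by (rule LR.Fubini'[symmetric]) (measurable)
  also have "\<dots> = (\<integral>\<^sup>+\<zeta>. K \<zeta> * ennreal (P \<zeta>) \<partial>lborel)"
  proof (rule nn_integral_cong)
    fix \<zeta> :: real
    have "(\<integral>\<^sup>+r. K \<zeta> * indicator {\<zeta>. r / sqrt s < \<zeta>} \<zeta> \<partial>lawR) = (\<integral>\<^sup>+r. K \<zeta> * indicator {..<\<zeta> * sqrt s} r \<partial>lawR)"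
      using s by (intro nn_integral_cong) (auto simp: indicator_def field_simps)
    also have "\<dots> = K \<zeta> * emeasure lawR {..<\<zeta> * sqrt s}"
      by (rule nn_integral_cmult_indicator) simp
    also have "emeasure lawR {..<\<zeta> * sqrt s} = ennreal (P \<zeta>)"
      unfolding P_def emeasure_eq_measure[symmetric]
      by (subst emeasure_distr) (auto intro!: arg_cong[where f = "emeasure M"])
    finally show "(\<integral>\<^sup>+r. K \<zeta> * indicator {\<zeta>. r / sqrt s < \<zeta>} \<zeta> \<partial>lawR) = K \<zeta> * ennreal (P \<zeta>)" .
  qed
  also have "\<dots> = (\<integral>\<^sup>+\<zeta>. ennreal (indicator {\<psi> / 2..} \<zeta> * (F \<zeta> * kern \<psi> \<zeta>)) \<partial>lborel)"
  proof (rule nn_integral_cong_AE)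
    show "AE \<zeta> in lborel. K \<zeta> * ennreal (P \<zeta>) = ennreal (indicator {\<psi> / 2..} \<zeta> * (F \<zeta> * kern \<psi> \<zeta>))"
      using AE_prob_maxY_less[OF s]
    proof eventually_elim
      case (elim \<zeta>)
      show ?case
      proof (cases "\<psi> / 2 \<le> \<zeta>")
        case True
        then have "\<zeta> > 0" using \<psi> by linarith
        then have "P \<zeta> = F \<zeta>" using elim by (simp add: P_def F_def)
        moreover have "P \<zeta> \<ge> 0" by (simp add: P_def)
        ultimately show ?thesis using True kern_nonneg[OF \<psi> True] by (simp add: K_def ennreal_mult mult.commute)
      qed (simp add: K_def)
    qed
  qed
  finally have E: "emeasure M {\<omega>\<in>space M. differ \<omega>} = (\<integral>\<^sup>+\<zeta>. ennreal (indicator {\<psi> / 2..} \<zeta> * (F \<zeta> * kern \<psi> \<zeta>)) \<partial>lborel)" .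
  \<comment> \<open>\<open>F\<close> is seen to be nonnegative by its identification with the
    probability \<open>P\<close>, hence almost everywhere.\<close>
  have nn: "AE \<zeta> in lborel. 0 \<le> indicator {\<psi> / 2..} \<zeta> * (F \<zeta> * kern \<psi> \<zeta>)"
    using AE_prob_maxY_less[OF s]
  proof eventually_elim
    case (elim \<zeta>)
    show ?case
    proof (cases "\<psi> / 2 \<le> \<zeta>")
      case True
      then have "\<zeta> > 0" using \<psi> by linarith
      then have "P \<zeta> = F \<zeta>" using elim by (simp add: P_def F_def)
      moreover have "P \<zeta> \<ge> 0" by (simp add: P_def)
      ultimately show ?thesis using True kern_nonneg[OF \<psi> True] by simp
    qed simp
  qed
  have [measurable]: "F \<in> borel_measurable borel" unfolding F_def[abs_def] by measurable
  have "(\<integral>\<zeta>. indicator {\<psi> / 2..} \<zeta> * (F \<zeta> * kern \<psi> \<zeta>) \<partial>lborel) = prob {\<omega>\<in>space M. differ \<omega>}"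
    unfolding measure_def E by (rule integral_eq_nn_integral) (use nn in auto)
  then show ?thesis
    unfolding set_lebesgue_integral_def F_def \<psi>_def by simp
qed

end

end

text \<open>Absolute convergence makes the unordered sum equal to the series; the index is shifted
  by one.\<close>

lemma infsum_theta:
  assumes "\<zeta> > 0"
  shows "(\<Sum>\<^sub>\<infinity>k\<in>{1::nat..}. 2 * (- 1) ^ (k + 1) * exp (- (real k ^ 2 * pi ^ 2 / (2 * \<zeta> ^ 2))))
    = (\<Sum>k. 2 * (-1) ^ k * exp (- (real (Suc k))\<^sup>2 * (pi\<^sup>2 / (2 * \<zeta>\<^sup>2))))"
proof -
  define f where "f k = 2 * (- 1) ^ (k + 1) * exp (- (real k ^ 2 * pi ^ 2 / (2 * \<zeta> ^ 2)))" for k :: nat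
  define a where "a = pi\<^sup>2 / (2 * \<zeta>\<^sup>2)"
  have a: "a > 0" using assms by (simp add: a_def)
  have fe: "f (Suc k) = 2 * (-1) ^ k * exp (- (real (Suc k))\<^sup>2 * a)" for k
    unfolding f_def a_def by simp
  have S: "summable (\<lambda>k. norm (f (Suc k)))"
    unfolding fe by (rule damped_sum_tendsto(3)[OF a])
  have "((\<lambda>k. f (Suc k)) has_sum (\<Sum>k. f (Suc k))) UNIV"
    by (rule norm_summable_imp_has_sum[OF S]) (rule summable_sums[OF summable_norm_cancel[OF S]])
  then have "(f has_sum (\<Sum>k. f (Suc k))) (Suc ` UNIV)"
    by (subst has_sum_reindex) (auto simp: o_def)
  moreover have "Suc ` UNIV = {1..}" by (auto simp: image_def) (metis Suc_le_D)
  ultimately have "infsum f {1..} = (\<Sum>k. f (Suc k))" by (simp add: infsumI)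
  then show ?thesis unfolding f_def[symmetric] fe a_def .
qed

theorem theorem2:
  fixes M :: "'a measure"
    and Y :: "real \<Rightarrow> 'a \<Rightarrow> real"
    and W :: "int \<Rightarrow> 'a \<Rightarrow> real"
    and \<Theta> :: "'a \<Rightarrow> real"
    and X :: "real \<Rightarrow> real \<Rightarrow> 'a \<Rightarrow> real"
    and \<alpha> \<beta> s \<psi> :: real
  assumes "dyadic_coupling M Y W \<Theta>"
    and "X = dyadic_grand_coupling Y W \<Theta>"
    and "\<alpha> < \<beta>"
    and "s > 0"
    and "\<psi> = \<bar>\<alpha> - \<beta>\<bar> / sqrt s"
  shows "measure M {\<omega> \<in> space M. \<exists>t\<ge>s. X \<alpha> t \<omega> \<noteq> X \<beta> t \<omega>}
           = measure M {\<omega> \<in> space M. \<exists>\<gamma>1\<in>{\<alpha>..\<beta>}. \<exists>\<gamma>2\<in>{\<alpha>..\<beta>}. \<exists>t\<ge>s. X \<gamma>1 t \<omega> \<noteq> X \<gamma>2 t \<omega>}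
       \<and> measure M {\<omega> \<in> space M. \<exists>\<gamma>1\<in>{\<alpha>..\<beta>}. \<exists>\<gamma>2\<in>{\<alpha>..\<beta>}. \<exists>t\<ge>s. X \<gamma>1 t \<omega> \<noteq> X \<gamma>2 t \<omega>}
           = (LBINT \<zeta>:{\<psi> / 2..}.
                (\<Sum>\<^sub>\<infinity>k\<in>{1::nat..}. 2 * (- 1) ^ (k + 1) * exp (- (real k ^ 2 * pi ^ 2 / (2 * \<zeta> ^ 2))))
                * (\<zeta> powi (- 2) * \<psi> / ln 2) * (min (\<zeta> * \<psi> powi (- 1)) 1 - 1 / 2))"
proof -
  interpret dyadic_coupling M Y W \<Theta> by fact
  have \<psi>: "\<psi> = (\<beta> - \<alpha>) / sqrt s" "\<psi> > 0" using assms(3-5) by auto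
  \<comment> \<open>Monotonicity holds for every outcome, so the two events are equal as sets; the
    second inherits measurability although its starting points range over a continuum.\<close>
  have "(\<exists>\<gamma>1\<in>{\<alpha>..\<beta>}. \<exists>\<gamma>2\<in>{\<alpha>..\<beta>}. \<exists>t\<ge>s. X \<gamma>1 t \<omega> \<noteq> X \<gamma>2 t \<omega>) \<longleftrightarrow> (\<exists>t\<ge>s. X \<alpha> t \<omega> \<noteq> X \<beta> t \<omega>)"
    if \<omega>: "\<omega> \<in> space M" for \<omega>
  proof -
    have "(\<exists>\<gamma>1\<in>{\<alpha>..\<beta>}. \<exists>\<gamma>2\<in>{\<alpha>..\<beta>}. \<exists>t\<ge>s. X \<gamma>1 t \<omega> \<noteq> X \<gamma>2 t \<omega>) \<longleftrightarrow>
      (\<exists>t\<ge>s. \<exists>\<gamma>1\<in>{\<alpha>..\<beta>}. \<exists>\<gamma>2\<in>{\<alpha>..\<beta>}. X \<gamma>1 t \<omega> \<noteq> X \<gamma>2 t \<omega>)" by blast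
    also have "\<dots> \<longleftrightarrow> (\<exists>t\<ge>s. X \<alpha> t \<omega> \<noteq> X \<beta> t \<omega>)"
    proof (rule ex_cong1, rule conj_cong[OF refl])
      fix t assume "t \<ge> s"
      then show "(\<exists>\<gamma>1\<in>{\<alpha>..\<beta>}. \<exists>\<gamma>2\<in>{\<alpha>..\<beta>}. X \<gamma>1 t \<omega> \<noteq> X \<gamma>2 t \<omega>) \<longleftrightarrow> X \<alpha> t \<omega> \<noteq> X \<beta> t \<omega>"
        using dyadic_path.X_differ_iff[OF path[OF \<omega>], of \<alpha> \<beta> t "\<Theta> \<omega>"] assms(3,4)
        unfolding assms(2) dyadic_grand_coupling_def by simp
    qed
    finally show ?thesis .
  qed
  then have eq: "{\<omega> \<in> space M. \<exists>\<gamma>1\<in>{\<alpha>..\<beta>}. \<exists>\<gamma>2\<in>{\<alpha>..\<beta>}. \<exists>t\<ge>s. X \<gamma>1 t \<omega> \<noteq> X \<gamma>2 t \<omega>}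
    = {\<omega> \<in> space M. \<exists>t\<ge>s. X \<alpha> t \<omega> \<noteq> X \<beta> t \<omega>}" by (intro Collect_cong conj_cong refl)
  have "measure M {\<omega> \<in> space M. \<exists>t\<ge>s. X \<alpha> t \<omega> \<noteq> X \<beta> t \<omega>}
    = (LBINT \<zeta>:{\<psi> / 2..}. (\<Sum>k. 2 * (-1) ^ k * exp (- (real (Suc k))\<^sup>2 * (pi\<^sup>2 / (2 * \<zeta>\<^sup>2)))) * kern \<psi> \<zeta>)"
    using prob_differ[OF assms(3,4)] unfolding differ_def[OF assms(3,4)] assms(2) \<psi>(1) .
  also have "\<dots> = (LBINT \<zeta>:{\<psi> / 2..}.
                (\<Sum>\<^sub>\<infinity>k\<in>{1::nat..}. 2 * (- 1) ^ (k + 1) * exp (- (real k ^ 2 * pi ^ 2 / (2 * \<zeta> ^ 2))))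
                * (\<zeta> powi (- 2) * \<psi> / ln 2) * (min (\<zeta> * \<psi> powi (- 1)) 1 - 1 / 2))"
  proof (rule set_lebesgue_integral_cong)
    show "\<forall>\<zeta>. \<zeta> \<in> {\<psi> / 2..} \<longrightarrow>
      (\<Sum>k. 2 * (-1) ^ k * exp (- (real (Suc k))\<^sup>2 * (pi\<^sup>2 / (2 * \<zeta>\<^sup>2)))) * kern \<psi> \<zeta> =
      (\<Sum>\<^sub>\<infinity>k\<in>{1::nat..}. 2 * (- 1) ^ (k + 1) * exp (- (real k ^ 2 * pi ^ 2 / (2 * \<zeta> ^ 2))))
                * (\<zeta> powi (- 2) * \<psi> / ln 2) * (min (\<zeta> * \<psi> powi (- 1)) 1 - 1 / 2)"
    proof (intro allI impI)
      fix \<zeta> assume "\<zeta> \<in> {\<psi> / 2..}"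
      then have "\<zeta> > 0" using \<psi>(2) by simp
      then show "(\<Sum>k. 2 * (-1) ^ k * exp (- (real (Suc k))\<^sup>2 * (pi\<^sup>2 / (2 * \<zeta>\<^sup>2)))) * kern \<psi> \<zeta> =
      (\<Sum>\<^sub>\<infinity>k\<in>{1::nat..}. 2 * (- 1) ^ (k + 1) * exp (- (real k ^ 2 * pi ^ 2 / (2 * \<zeta> ^ 2))))
                * (\<zeta> powi (- 2) * \<psi> / ln 2) * (min (\<zeta> * \<psi> powi (- 1)) 1 - 1 / 2)"
        unfolding infsum_theta[OF \<open>\<zeta> > 0\<close>] kern_def by (simp only: mult.assoc)
    qed
  qed simp
  finally show ?thesis unfolding eq by simp
qed

end
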